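(* Let $K$ be a field and let $n,p\geq 3$ be integers. Let $\mathcal{O}_n(p)$ be the $p$-triangular ouroboros snake graph, let $Q_{n,p}=K[V(\mathcal{O}_n(p))]$ and let $J_{n,p}\subset Q_{n,p}$ be the edge ideal of $\mathcal{O}_n(p)$. Then $$\operatorname{reg}(Q_{n,p}/J_{n,p})=\left\lceil\frac{n-1}{2}\right\rceil .$$
   Context: All graphs are finite, simple and undirected. For a graph $G$, $K[V(G)]$ denotes the polynomial ring over $K$ whose variables are the vertices of $G$, with standard grading (every variable has degree 1), and the edge ideal is $I(G)=(uv : \{u,v\}\in E(G))\subset K[V(G)]$. The $p$-triangular snake $\mathcal{T}_n(p)$ is the graph with vertex set $\{x_1,\dots,x_{n+1}\}\cup\{y_{ij}:1\le i\le n,\ 1\le j\le p\}$ and edge set $\{\{x_i,x_{i+1}\}:1\le i\le n\}\cup\{\{x_i,y_{ij}\},\{x_{i+1},y_{ij}\}:1\le i\le n,\ 1\le j\le p\}$. For $n\ge 3$, the $p$-triangular ouroboros snake $\mathcal{O}_n(p)$ is obtained from $\mathcal{T}_n(p)$ by fusing (identifying) the vertices $x_1$ and $x_{n+1}$. Explicitly, $\mathcal{O}_n(p)$ has vertex set $\{x_1,\dots,x_n\}\cup\{y_{ij}:1\le i\le n,\ 1\le j\le p\}$ and edge set $\{\{x_i,x_{i+1}\}:1\le i\le n\}\cup\{\{x_i,y_{ij}\},\{x_{i+1},y_{ij}\}:1\le i\le n,\ 1\le j\le p\}$, where $x_{n+1}$ is read as $x_1$. For a finitely generated graded module $N$ over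 a standard graded polynomial ring with graded Betti numbers $\beta_{i,j}(N)$ (from the minimal graded free resolution), the Castelnuovo–Mumford regularity is $\operatorname{reg}(N)=\max\{j-i:\beta_{i,j}(N)\neq 0\}$. *)

theory Defs
  imports Complex_Main "HOL-Algebra.QuotRing" "HOL-Algebra.Module" "HOL-Library.Poly_Mapping"
begin

section \<open>Standard graded polynomial rings\<close>

type_synonym ('v, 'k) mpoly = "('v \<Rightarrow>\<^sub>0 nat) \<Rightarrow>\<^sub>0 'k"

text \<open>\<open>poly_ring V\<close> is \<open>K[V]\<close>: those polynomials over the type \<open>'k\<close> that involve only variables from \<open>V\<close>.\<close>

definition poly_ring :: "'v set \<Rightarrow> ('v, 'k::field) mpoly ring" where
  "poly_ring V = \<lparr>carrier = {f. \<forall>m\<in>Poly_Mapping.keys f. Poly_Mapping.keys m \<subseteq> V},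
     mult = (*), one = 1, zero = 0, add = (+)\<rparr>"

definition var :: "'v \<Rightarrow> ('v, 'k::field) mpoly" where
  "var v = Poly_Mapping.single (Poly_Mapping.single v 1) 1"

definition monom_degree :: "('v \<Rightarrow>\<^sub>0 nat) \<Rightarrow> nat" where
  "monom_degree m = (\<Sum>v\<in>Poly_Mapping.keys m. Poly_Mapping.lookup m v)"

definition homogeneous_part :: "'v set \<Rightarrow> int \<Rightarrow> ('v, 'k::field) mpoly set" where
  "homogeneous_part V j =
     {f \<in> carrier (poly_ring V). \<forall>m\<in>Poly_Mapping.keys f. int (monom_degree m) = j}"

definition irrelevant_ideal :: "'v set \<Rightarrow> ('v, 'k::field) mpoly set" where
  "irrelevant_ideal V = Idl\<^bsub>poly_ring V\<^esub> (var ` V)"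


section \<open>Graded modules\<close>

record ('a, 'b) graded_module = "('a, 'b) module" +
  grade :: "int \<Rightarrow> 'b set"

text \<open>The fields \<open>mult\<close> and \<open>one\<close> of a module record carry no meaning for the module.\<close>

text \<open>\<open>K[V]/I\<close> as a graded \<open>K[V]\<close>-module, for a homogeneous ideal \<open>I\<close>.\<close>

definition quotient_module ::
    "'v set \<Rightarrow> ('v, 'k::field) mpoly set \<Rightarrow> (('v, 'k) mpoly, ('v, 'k) mpoly set) graded_module" where
  "quotient_module V I =
     (let R = poly_ring V; Q = R Quot I in
      \<lparr>carrier = carrier Q, mult = mult Q, one = one Q, zero = zero Q, add = add Q,
       smult = (\<lambda>r C. (I +>\<^bsub>R\<^esub> r) \<otimes>\<^bsub>Q\<^esub> C),
       grade = (\<lambda>j. (\<lambda>f. I +>\<^bsub>R\<^esub> f) ` homogeneous_part V j)\<rparr>)"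

text \<open>\<open>free_module V [d\<^sub>0, \<dots>, d\<^sub>r]\<close> is \<open>K[V](-d\<^sub>0) \<oplus> \<dots> \<oplus> K[V](-d\<^sub>r)\<close>, whose \<open>k\<close>-th basis
  element has degree \<open>d\<^sub>k\<close>. Its elements are coordinate vectors, padded with zeros.\<close>

definition free_module ::
    "'v set \<Rightarrow> int list \<Rightarrow> (('v, 'k::field) mpoly, nat \<Rightarrow> ('v, 'k) mpoly) graded_module" where
  "free_module V ds =
     \<lparr>carrier = {f. (\<forall>k<length ds. f k \<in> carrier (poly_ring V)) \<and> (\<forall>k\<ge>length ds. f k = 0)},
      mult = (\<lambda>f g k. f k * g k), one = (\<lambda>k. if k < length ds then 1 else 0),
      zero = (\<lambda>k. 0), add = (\<lambda>f g k. f k + g k),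
      smult = (\<lambda>r f k. r * f k),
      grade = (\<lambda>j. {f. (\<forall>k<length ds. f k \<in> homogeneous_part V (j - ds ! k)) \<and>
                       (\<forall>k\<ge>length ds. f k = 0)})\<rparr>"

definition graded_hom ::
    "('a, 'r) ring_scheme \<Rightarrow> ('a, 'b) graded_module \<Rightarrow> ('a, 'c) graded_module \<Rightarrow> ('b \<Rightarrow> 'c) set" where
  "graded_hom R M N =
     {h \<in> carrier M \<rightarrow> carrier N.
        (\<forall>x\<in>carrier M. \<forall>y\<in>carrier M. h (x \<oplus>\<^bsub>M\<^esub> y) = h x \<oplus>\<^bsub>N\<^esub> h y) \<and>
        (\<forall>r\<in>carrier R. \<forall>x\<in>carrier M. h (r \<odot>\<^bsub>M\<^esub> x) = r \<odot>\<^bsub>N\<^esub> h x) \<and>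
        (\<forall>j. h ` grade M j \<subseteq> grade N j)}"


section \<open>Minimal graded free resolutions, Betti numbers and regularity\<close>

text \<open>The complex is \<open>\<dots> \<rightarrow> F 2 \<rightarrow> F 1 \<rightarrow> F 0 \<rightarrow> M \<rightarrow> 0\<close> with \<open>F i = free_module V (ds i)\<close>, differentials
  \<open>\<phi> i : F (i + 1) \<rightarrow> F i\<close> and augmentation \<open>\<epsilon> : F 0 \<rightarrow> M\<close>. A finite resolution has \<open>ds i = []\<close>
  for all large \<open>i\<close>.\<close>

definition graded_free_resolution ::
    "'v set \<Rightarrow> (('v, 'k::field) mpoly, 'b) graded_module \<Rightarrow> (nat \<Rightarrow> int list) \<Rightarrow>
     (nat \<Rightarrow> (nat \<Rightarrow> ('v, 'k) mpoly) \<Rightarrow> (nat \<Rightarrow> ('v, 'k) mpoly)) \<Rightarrow>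
     ((nat \<Rightarrow> ('v, 'k) mpoly) \<Rightarrow> 'b) \<Rightarrow> bool" where
  "graded_free_resolution V M ds \<phi> \<epsilon> \<longleftrightarrow>
     (let R = poly_ring V; F = (\<lambda>i. free_module V (ds i)) in
      \<epsilon> \<in> graded_hom R (F 0) M \<and> (\<forall>i. \<phi> i \<in> graded_hom R (F (Suc i)) (F i)) \<and>
      \<epsilon> ` carrier (F 0) = carrier M \<and>
      \<phi> 0 ` carrier (F 1) = a_kernel (F 0) M \<epsilon> \<and>
      (\<forall>i. \<phi> (Suc i) ` carrier (F (Suc (Suc i))) = a_kernel (F (Suc i)) (F i) (\<phi> i)))"

text \<open>Minimality: the image of each differential lies in \<open>\<mm> F i\<close>, with \<open>\<mm>\<close> the irrelevant ideal.\<close>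

definition minimal_graded_free_resolution ::
    "'v set \<Rightarrow> (('v, 'k::field) mpoly, 'b) graded_module \<Rightarrow> (nat \<Rightarrow> int list) \<Rightarrow>
     (nat \<Rightarrow> (nat \<Rightarrow> ('v, 'k) mpoly) \<Rightarrow> (nat \<Rightarrow> ('v, 'k) mpoly)) \<Rightarrow>
     ((nat \<Rightarrow> ('v, 'k) mpoly) \<Rightarrow> 'b) \<Rightarrow> bool" where
  "minimal_graded_free_resolution V M ds \<phi> \<epsilon> \<longleftrightarrow>
     graded_free_resolution V M ds \<phi> \<epsilon> \<and>
     (\<forall>i. \<forall>x\<in>carrier (free_module V (ds (Suc i))). \<forall>k<length (ds i). \<phi> i x k \<in> irrelevant_ideal V)"

text \<open>For finite \<open>V\<close> and a finitely generated graded module, a minimal graded free resolution exists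
  and is unique up to isomorphism, so that the number of generators of degree \<open>j\<close> of \<open>F i\<close> does not
  depend on the choice made here. For other arguments the value is meaningless.\<close>

definition graded_betti ::
    "'v set \<Rightarrow> (('v, 'k::field) mpoly, 'b) graded_module \<Rightarrow> nat \<Rightarrow> int \<Rightarrow> nat" where
  "graded_betti V M i j =
     count_list ((SOME ds. \<exists>\<phi> \<epsilon>. minimal_graded_free_resolution V M ds \<phi> \<epsilon>) i) j"

definition regularity :: "'v set \<Rightarrow> (('v, 'k::field) mpoly, 'b) graded_module \<Rightarrow> int" where
  "regularity V M = Max {j - int i | i j. graded_betti V M i j \<noteq> 0}"


section \<open>Graphs, edge ideals and the triangular ouroboros snake\<close>

text \<open>A graph is a pair of a vertex set and a set of edges, each edge being a two-element set.\<close>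

type_synonym 'v graph = "'v set \<times> 'v set set"

definition finite_simple_graph :: "'v graph \<Rightarrow> bool" where
  "finite_simple_graph G \<longleftrightarrow> finite (fst G) \<and> (\<forall>e\<in>snd G. e \<subseteq> fst G \<and> card e = 2)"

definition edge_ideal :: "'v graph \<Rightarrow> ('v, 'k::field) mpoly set" where
  "edge_ideal G = Idl\<^bsub>poly_ring (fst G)\<^esub> {var u * var v | u v. {u, v} \<in> snd G}"

text \<open>\<open>X i\<close> and \<open>Y i j\<close> stand for the vertices \<open>x\<^sub>i\<close> and \<open>y\<^sub>i\<^sub>j\<close>, with indices starting at 1.\<close>

datatype snake_vertex = X nat | Y nat nat

definition cyc_succ :: "nat \<Rightarrow> nat \<Rightarrow> nat" where
  "cyc_succ n i = (if i = n then 1 else i + 1)"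

definition ouroboros :: "nat \<Rightarrow> nat \<Rightarrow> snake_vertex graph" where
  "ouroboros n p =
     (X ` {1..n} \<union> {Y i j | i j. i \<in> {1..n} \<and> j \<in> {1..p}},
      {{X i, X (cyc_succ n i)} | i. i \<in> {1..n}} \<union>
      {{X i, Y i j} | i j. i \<in> {1..n} \<and> j \<in> {1..p}} \<union>
      {{X (cyc_succ n i), Y i j} | i j. i \<in> {1..n} \<and> j \<in> {1..p}})"

lemma finite_simple_graph_ouroboros:
  assumes "n \<ge> 3"
  shows "finite_simple_graph (ouroboros n p)"
proof -
  have "{Y i j | i j. i \<in> {1..n} \<and> j \<in> {1..p}} = (\<lambda>(i, j). Y i j) ` ({1..n} \<times> {1..p})"
    by auto
  then have "finite {Y i j | i j. i \<in> {1..n} \<and> j \<in> {1..p}}"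
    by (metis finite_SigmaI finite_atLeastAtMost finite_imageI)
  then have "finite (fst (ouroboros n p))"
    by (simp add: ouroboros_def)
  moreover have "e \<subseteq> fst (ouroboros n p) \<and> card e = 2" if "e \<in> snd (ouroboros n p)" for e
  proof -
    have succ: "cyc_succ n i \<in> {1..n}" "cyc_succ n i \<noteq> i" if "i \<in> {1..n}" for i
      using that assms by (auto simp: cyc_succ_def)
    from that consider i where "i \<in> {1..n}" "e = {X i, X (cyc_succ n i)}"
      | i j where "i \<in> {1..n}" "j \<in> {1..p}" "e = {X i, Y i j}"
      | i j where "i \<in> {1..n}" "j \<in> {1..p}" "e = {X (cyc_succ n i), Y i j}"
      unfolding ouroboros_def by (simp only: snd_conv Un_iff mem_Collect_eq) blast
    then show ?thesis
    proof cases
      case 1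
      then show ?thesis using succ[of i] by (simp add: ouroboros_def)
    next
      case 2
      then show ?thesis by (simp add: ouroboros_def)
    next
      case 3
      then show ?thesis using succ[of i] by (simp add: ouroboros_def)
    qed
  qed
  ultimately show ?thesis
    by (simp add: finite_simple_graph_def)
qed

end

theory Submission
  imports Defs "HOL-Library.Function_Algebras"
begin

text \<open>
  Write \<open>S\<close> for the polynomial ring, \<open>J\<close> for the edge ideal and \<open>r = n div 2\<close>, which equals the
  claimed value. The vertices \<open>X 1, \<dots>, X n\<close> form a cycle and meet every edge.

  Upper bound. For a vertex \<open>x\<close> the exact sequence \<open>0 \<rightarrow> S/(J : x)(-1) \<rightarrow> S/J \<rightarrow> S/(J + x) \<rightarrow> 0\<close> and the
  horseshoe lemma bound the regularity of \<open>S/J\<close> by the maximum of those of \<open>S/(J : x)\<close>, increased by one,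
  and of \<open>S/(J + x)\<close>. In terms of graphs this deletes the closed neighbourhood of \<open>x\<close>, or \<open>x\<close> alone. If the
  edges are covered by a path of \<open>m\<close> of the \<open>X i\<close>, taking for \<open>x\<close> an end of it leaves paths with \<open>m - 2\<close>
  and \<open>m - 1\<close> vertices, so the regularity is at most half of \<open>m\<close>, rounded up. A first deletion at \<open>X n\<close>
  opens the cycle and gives \<open>r\<close>. See \<open>reg_le_colon\<close>, \<open>reg_le_path_cover\<close> and \<open>reg_le_ouroboros\<close>.

  The resolutions obtained in this way are finite but not minimal. Schanuel's lemma
  (\<open>fin_res_equiv_presentation\<close>) transports finite resolutions with bounded degrees along isomorphisms of
  presentations. It serves twice. It shows that a shortest list of generators has relations that are
  finitely resolved again, so that minimal resolutions exist (\<open>minimal_resolution_exists\<close>) and the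
  graded Betti numbers are those of some minimal resolution. And together with Nakayama's
  lemma it shows that the degree bounds hold in every minimal resolution
  (\<open>minimal_resolution_upper\<close>).

  Lower bound. The edges from \<open>X i\<close> to \<open>Y i 1\<close> with odd \<open>i < n\<close> form an induced matching of size \<open>r\<close>.
  Let \<open>f 0, \<dots>, f (r - 1)\<close> be the corresponding monomials. The \<open>r\<close>-th term of every graded free resolution \<open>F\<close> of
  \<open>S/J\<close> has a generator of degree \<open>2 * r\<close>. Indeed there are chain maps from the Koszul complex of the \<open>f j\<close>
  to \<open>F\<close>, and from \<open>F\<close> to the same complex modulo the variables outside the matching, and the composition
  is an isomorphism in the top degree modulo the irrelevant ideal. To avoid the signs of the Koszul
  complex, only one component of each map is followed. For the first map, it is an iterated
  application of null homotopies for multiplication by the \<open>f j\<close>; for the second, an iterated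
  division by the \<open>f j\<close>. See \<open>degree_of_complete_intersection\<close>.
\<close>


section \<open>Polynomials and their monomials\<close>

abbreviation coeff :: "('a \<Rightarrow>\<^sub>0 'b::zero) \<Rightarrow> 'a \<Rightarrow> 'b" where
  "coeff \<equiv> Poly_Mapping.lookup"

abbreviation supp :: "('a \<Rightarrow>\<^sub>0 'b::zero) \<Rightarrow> 'a set" where
  "supp \<equiv> Poly_Mapping.keys"

abbreviation polys :: "'v set \<Rightarrow> ('v, 'k::field) mpoly set" where
  "polys V \<equiv> carrier (poly_ring V)"

lemma polys_iff: "f \<in> polys V \<longleftrightarrow> (\<forall>m\<in>supp f. supp m \<subseteq> V)"
  by (simp add: poly_ring_def)

lemma supp_uminus [simp]: "supp (- f) = supp (f :: 'a \<Rightarrow>\<^sub>0 'b::ab_group_add)"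
  by (auto simp: in_keys_iff)

lemma supp_diff_subset: "supp (f - g) \<subseteq> supp f \<union> supp (g :: 'a \<Rightarrow>\<^sub>0 'b::ab_group_add)"
  by (auto simp: in_keys_iff lookup_minus)

lemma supp_monom_add: "supp (a + b :: 'v \<Rightarrow>\<^sub>0 nat) = supp a \<union> supp b"
  by (auto simp: in_keys_iff lookup_add)

lemma supp_mult_cases:
  fixes f g :: "('v, 'k::field) mpoly"
  assumes "m \<in> supp (f * g)"
  obtains a b where "m = a + b" "a \<in> supp f" "b \<in> supp g"
  using keys_mult[of f g] assms by auto

lemma polys_0 [simp]: "0 \<in> polys V" and polys_1 [simp]: "1 \<in> polys V"
  by (simp_all add: polys_iff)

lemma polys_add: "f \<in> polys V \<Longrightarrow> g \<in> polys V \<Longrightarrow> f + g \<in> polys V"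
  using keys_add[of f g] by (auto simp: polys_iff)

lemma polys_diff: "f \<in> polys V \<Longrightarrow> g \<in> polys V \<Longrightarrow> f - g \<in> polys V"
  using supp_diff_subset[of f g] by (auto simp: polys_iff)

lemma polys_uminus: "f \<in> polys V \<Longrightarrow> - f \<in> polys V"
  by (auto simp: polys_iff)

lemma polys_mult: "f \<in> polys V \<Longrightarrow> g \<in> polys V \<Longrightarrow> f * g \<in> polys V"
  unfolding polys_iff by (metis supp_mult_cases supp_monom_add Un_least)

lemma polys_sum: "(\<And>i. i \<in> I \<Longrightarrow> f i \<in> polys V) \<Longrightarrow> (\<Sum>i\<in>I. f i) \<in> polys V"
  by (induction I rule: infinite_finite_induct) (auto intro: polys_add)

lemma polys_single [simp]: "supp m \<subseteq> V \<Longrightarrow> Poly_Mapping.single m c \<in> polys V"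
  by (auto simp: polys_iff)

lemma monom_degree_superset:
  assumes "finite S" "supp m \<subseteq> S"
  shows "monom_degree m = (\<Sum>v\<in>S. coeff m v)"
  unfolding monom_degree_def using assms
  by (intro sum.mono_neutral_left) (auto simp: in_keys_iff)

lemma monom_degree_add: "monom_degree (a + b) = monom_degree a + monom_degree b"
proof -
  have *: "finite (supp a \<union> supp b)" by simp
  show ?thesis
    using monom_degree_superset[OF *, of "a + b"] monom_degree_superset[OF *, of a]
      monom_degree_superset[OF *, of b]
    by (simp add: supp_monom_add lookup_add sum.distrib)
qed

lemma monom_degree_0 [simp]: "monom_degree 0 = 0"
  by (simp add: monom_degree_def)

lemma monom_degree_eq_0_iff: "monom_degree m = 0 \<longleftrightarrow> m = 0"
  unfolding monom_degree_def
  by (auto simp: in_keys_iff intro!: poly_mapping_eqI)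

lemma homogeneous_part_iff:
  "f \<in> homogeneous_part V j \<longleftrightarrow> f \<in> polys V \<and> (\<forall>m\<in>supp f. int (monom_degree m) = j)"
  by (simp add: homogeneous_part_def)

lemma homogeneous_0 [simp]: "0 \<in> homogeneous_part V j"
  by (simp add: homogeneous_part_iff)

lemma homogeneous_1 [simp]: "1 \<in> homogeneous_part V 0"
  by (simp add: homogeneous_part_iff)

lemma homogeneous_uminus: "f \<in> homogeneous_part V j \<Longrightarrow> - f \<in> homogeneous_part V j"
  by (auto simp: homogeneous_part_iff polys_uminus)

lemma homogeneous_add:
  "f \<in> homogeneous_part V j \<Longrightarrow> g \<in> homogeneous_part V j \<Longrightarrow> f + g \<in> homogeneous_part V j"
  using keys_add[of f g] by (auto simp: homogeneous_part_iff polys_add)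

lemma homogeneous_mult:
  "f \<in> homogeneous_part V i \<Longrightarrow> g \<in> homogeneous_part V j \<Longrightarrow> f * g \<in> homogeneous_part V (i + j)"
  by (auto simp: homogeneous_part_iff polys_mult monom_degree_add elim!: supp_mult_cases)

lemma homogeneous_sum:
  "(\<And>i. i \<in> I \<Longrightarrow> f i \<in> homogeneous_part V j) \<Longrightarrow> (\<Sum>i\<in>I. f i) \<in> homogeneous_part V j"
  by (induction I rule: infinite_finite_induct) (auto intro: homogeneous_add)

lemma homogeneous_polys: "f \<in> homogeneous_part V j \<Longrightarrow> f \<in> polys V"
  by (simp add: homogeneous_part_iff)

definition restrict_monoms ::
    "(('v \<Rightarrow>\<^sub>0 nat) \<Rightarrow> bool) \<Rightarrow> ('v, 'k::field) mpoly \<Rightarrow> ('v, 'k) mpoly" where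
  "restrict_monoms Q f = Poly_Mapping.mapp (\<lambda>m c. if Q m then c else 0) f"

lemma coeff_restrict: "coeff (restrict_monoms Q f) m = (if Q m then coeff f m else 0)"
  by (auto simp: restrict_monoms_def lookup_mapp in_keys_iff when_def)

lemma supp_restrict: "supp (restrict_monoms Q f) = {m\<in>supp f. Q m}"
  by (auto simp: in_keys_iff coeff_restrict split: if_splits)

lemma restrict_add: "restrict_monoms Q (f + g) = restrict_monoms Q f + restrict_monoms Q g"
  by (rule poly_mapping_eqI) (simp add: coeff_restrict lookup_add)

lemma restrict_0 [simp]: "restrict_monoms Q 0 = 0"
  by (rule poly_mapping_eqI) (simp add: coeff_restrict)

lemma restrict_sum: "restrict_monoms Q (\<Sum>i\<in>I. f i) = (\<Sum>i\<in>I. restrict_monoms Q (f i))"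
  by (induction I rule: infinite_finite_induct) (auto simp: restrict_add)

lemma restrict_id: "(\<And>m. m \<in> supp f \<Longrightarrow> Q m) \<Longrightarrow> restrict_monoms Q f = f"
  by (rule poly_mapping_eqI) (auto simp: coeff_restrict in_keys_iff)

lemma restrict_eq_0: "(\<And>m. m \<in> supp f \<Longrightarrow> \<not> Q m) \<Longrightarrow> restrict_monoms Q f = 0"
  by (rule poly_mapping_eqI) (auto simp: coeff_restrict in_keys_iff)

lemma restrict_polys: "f \<in> polys V \<Longrightarrow> restrict_monoms Q f \<in> polys V"
  by (auto simp: polys_iff supp_restrict)

lemma restrict_split: "f = restrict_monoms Q f + restrict_monoms (\<lambda>m. \<not> Q m) f"
  by (rule poly_mapping_eqI) (simp add: coeff_restrict lookup_add)

definition hpart :: "int \<Rightarrow> ('v, 'k::field) mpoly \<Rightarrow> ('v, 'k) mpoly" where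
  "hpart j = restrict_monoms (\<lambda>m. int (monom_degree m) = j)"

lemma hpart_homogeneous: "f \<in> polys V \<Longrightarrow> hpart j f \<in> homogeneous_part V j"
  by (auto simp: hpart_def homogeneous_part_iff supp_restrict restrict_polys)

lemma hpart_id: "f \<in> homogeneous_part V j \<Longrightarrow> hpart j f = f"
  unfolding hpart_def by (rule restrict_id) (simp add: homogeneous_part_iff)

text \<open>This is what makes matrices with homogeneous columns commute with homogeneous components.\<close>

lemma hpart_mult_homogeneous:
  assumes "g \<in> homogeneous_part V b"
  shows "hpart (a + b) (f * g) = hpart a f * g"
proof -
  define f' where "f' = restrict_monoms (\<lambda>m. int (monom_degree m) \<noteq> a) f"
  have f: "f = hpart a f + f'"
    unfolding f'_def hpart_def by (rule restrict_split)
  have "hpart (a + b) (f * g) = hpart (a + b) (hpart a f * g) + hpart (a + b) (f' * g)"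
    by (subst f) (simp add: distrib_right hpart_def restrict_add)
  also have "hpart (a + b) (f' * g) = 0"
    unfolding hpart_def using assms
    by (intro restrict_eq_0)
       (auto simp: f'_def supp_restrict monom_degree_add homogeneous_part_iff elim!: supp_mult_cases)
  also have "hpart (a + b) (hpart a f * g) = hpart a f * g"
    unfolding hpart_def using assms
    by (intro restrict_id)
       (auto simp: supp_restrict monom_degree_add homogeneous_part_iff elim!: supp_mult_cases)
  finally show ?thesis by simp
qed

lemma monom_add_eq_0_iff: "a + b = (0 :: 'v \<Rightarrow>\<^sub>0 nat) \<longleftrightarrow> a = 0 \<and> b = 0"
  by (metis add_is_0 monom_degree_add monom_degree_eq_0_iff)

lemma constant_term_split:
  fixes f :: "('v, 'k::field) mpoly"
  obtains f' where "f = Poly_Mapping.single 0 (coeff f 0) + f'" "coeff f' 0 = 0"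
  by (rule that[of "f - Poly_Mapping.single 0 (coeff f 0)"]) (simp_all add: lookup_minus)

lemma constant_term_mult_0: "coeff f 0 = 0 \<Longrightarrow> coeff (f * g) 0 = 0"
  for f g :: "('v, 'k::field) mpoly"
  by (metis in_keys_iff monom_add_eq_0_iff supp_mult_cases)

lemma coeff_monom_mult: "coeff (Poly_Mapping.single a c * f) (a + m) = c * coeff f m"
  for f :: "('v, 'k::field) mpoly"
proof -
  have "(\<Sum>q. coeff f q when a + m = a + q) = (\<Sum>q. coeff f q when q = m)"
    by (intro Sum_any.cong) (auto simp: when_def)
  then have *: "(\<Sum>q. coeff f q when a + m = a + q) = coeff f m" by simp
  have "(\<Sum>l. coeff (Poly_Mapping.single a c) l * (\<Sum>q. coeff f q when a + m = l + q)) =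
        (\<Sum>l. c * coeff f m when l = a)"
    by (intro Sum_any.cong) (auto simp: lookup_single when_def *[unfolded when_def])
  then show ?thesis by (simp add: lookup_mult)
qed

lemma supp_monom_mult: "c \<noteq> 0 \<Longrightarrow> supp (Poly_Mapping.single a c * f) = (+) a ` supp f"
  for f :: "('v, 'k::field) mpoly"
proof safe
  fix m assume "m \<in> supp (Poly_Mapping.single a c * f)"
  then show "m \<in> (+) a ` supp f" by (auto elim!: supp_mult_cases split: if_splits)
next
  fix m assume "c \<noteq> 0" "m \<in> supp f"
  then show "a + m \<in> supp (Poly_Mapping.single a c * f)" by (simp add: in_keys_iff coeff_monom_mult)
qed

text \<open>Taking constant coefficients is the ring homomorphism onto the residue field of the irrelevant
  ideal. It detects minimality of presentations and, in the lower bound, nonzero classes.\<close>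

lemma constant_term_mult: "coeff (f * g) 0 = coeff f 0 * coeff g 0"
  for f g :: "('v, 'k::field) mpoly"
proof -
  obtain f' where f': "f = Poly_Mapping.single 0 (coeff f 0) + f'" "coeff f' 0 = 0"
    by (rule constant_term_split)
  have "coeff (f * g) 0 = coeff (Poly_Mapping.single 0 (coeff f 0) * g) (0 + 0) + coeff (f' * g) 0"
    by (subst f'(1)) (simp add: distrib_right lookup_add)
  then show ?thesis
    using f'(2) by (simp only: coeff_monom_mult constant_term_mult_0) simp
qed

lemma homogeneous_constant_term:
  assumes "f \<in> homogeneous_part V j" "coeff f 0 \<noteq> 0" shows "j = 0"
  using assms by (force simp: homogeneous_part_iff in_keys_iff)

lemma homogeneous_deg_0:
  assumes "f \<in> homogeneous_part V 0" shows "f = Poly_Mapping.single 0 (coeff f 0)"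
proof (rule poly_mapping_eqI)
  fix m
  have "m \<notin> supp f" if "m \<noteq> 0"
    using that assms by (auto simp: homogeneous_part_iff monom_degree_eq_0_iff)
  then show "coeff f m = coeff (Poly_Mapping.single 0 (coeff f 0)) m"
    by (auto simp: lookup_single when_def in_keys_iff)
qed

text \<open>The quotient of \<open>f\<close> by the monomial \<open>a\<close>, the terms that \<open>a\<close> does not divide being dropped.\<close>

definition monom_quot :: "('v \<Rightarrow>\<^sub>0 nat) \<Rightarrow> ('v, 'k::field) mpoly \<Rightarrow> ('v, 'k) mpoly" where
  "monom_quot a f = Poly_Mapping.map_key ((+) a) f"

lemma coeff_monom_quot: "coeff (monom_quot a f) m = coeff f (a + m)"
  by (simp add: monom_quot_def map_key.rep_eq)

lemma supp_monom_quot: "m \<in> supp (monom_quot a f) \<longleftrightarrow> a + m \<in> supp f"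
  by (simp add: in_keys_iff coeff_monom_quot)

lemma monom_quot_remainder:
  assumes "m \<in> supp (f - Poly_Mapping.single a 1 * monom_quot a f)"
  shows "m \<in> supp f" "\<not> (\<exists>b. m = a + b)"
proof -
  show 1: "\<not> (\<exists>b. m = a + b)"
  proof safe
    fix b assume "m = a + b"
    then show False
      using assms by (simp add: in_keys_iff lookup_minus coeff_monom_mult coeff_monom_quot)
  qed
  have "m \<notin> supp (Poly_Mapping.single a 1 * monom_quot a f)"
    using 1 by (auto simp: supp_monom_mult)
  then show "m \<in> supp f" using assms by (auto simp: in_keys_iff lookup_minus)
qed

lemma monom_quot_homogeneous:
  assumes "f \<in> homogeneous_part V j"
  shows "monom_quot a f \<in> homogeneous_part V (j - int (monom_degree a))"
  using assms
  by (force simp: homogeneous_part_iff polys_iff supp_monom_quot monom_degree_add supp_monom_add)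

lemma var_homogeneous: "v \<in> V \<Longrightarrow> var v \<in> homogeneous_part V 1"
  by (auto simp: var_def homogeneous_part_iff monom_degree_def)


section \<open>Graded free modules and matrices\<close>

type_synonym ('v, 'k) vec = "nat \<Rightarrow> ('v, 'k) mpoly"

abbreviation free :: "'v set \<Rightarrow> int list \<Rightarrow> ('v, 'k::field) vec set" where
  "free V ds \<equiv> carrier (free_module V ds)"

abbreviation free_grade :: "'v set \<Rightarrow> int list \<Rightarrow> int \<Rightarrow> ('v, 'k::field) vec set" where
  "free_grade V ds \<equiv> grade (free_module V ds)"

definition scale :: "('v, 'k::field) mpoly \<Rightarrow> ('v, 'k) vec \<Rightarrow> ('v, 'k) vec" where
  "scale r x = (\<lambda>k. r * x k)"

definition unit :: "nat \<Rightarrow> ('v, 'k::field) vec" where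
  "unit l = (\<lambda>k. if k = l then 1 else 0)"

text \<open>\<open>lin n c\<close> is the linear map with columns \<open>c 0, \<dots>, c (n - 1)\<close>. Being defined on all vectors,
  it obeys linearity without membership hypotheses.\<close>

definition lin :: "nat \<Rightarrow> (nat \<Rightarrow> ('v, 'k::field) vec) \<Rightarrow> ('v, 'k) vec \<Rightarrow> ('v, 'k) vec" where
  "lin n c x = (\<lambda>k. \<Sum>l<n. x l * c l k)"

definition columns :: "'v set \<Rightarrow> int list \<Rightarrow> int list \<Rightarrow> (nat \<Rightarrow> ('v, 'k::field) vec) \<Rightarrow> bool" where
  "columns V ds e c \<longleftrightarrow> (\<forall>l<length e. c l \<in> free_grade V ds (e ! l))"

abbreviation lker :: "'v set \<Rightarrow> int list \<Rightarrow> (nat \<Rightarrow> ('v, 'k::field) vec) \<Rightarrow> ('v, 'k) vec set" where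
  "lker V e c \<equiv> {x \<in> free V e. lin (length e) c x = 0}"

definition component :: "int list \<Rightarrow> int \<Rightarrow> ('v, 'k::field) vec \<Rightarrow> ('v, 'k) vec" where
  "component ds d x = (\<lambda>k. if k < length ds then hpart (d - ds ! k) (x k) else 0)"

definition graded_submodule :: "'v set \<Rightarrow> int list \<Rightarrow> ('v, 'k::field) vec set \<Rightarrow> bool" where
  "graded_submodule V ds N \<longleftrightarrow>
     N \<subseteq> free V ds \<and> 0 \<in> N \<and> (\<forall>x\<in>N. \<forall>y\<in>N. x + y \<in> N) \<and>
     (\<forall>r\<in>polys V. \<forall>x\<in>N. scale r x \<in> N) \<and> (\<forall>d. \<forall>x\<in>N. component ds d x \<in> N)"

lemma free_iff:
  "x \<in> free V ds \<longleftrightarrow> (\<forall>k<length ds. x k \<in> polys V) \<and> (\<forall>k\<ge>length ds. x k = 0)"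
  by (simp add: free_module_def)

lemma free_grade_iff:
  "x \<in> free_grade V ds j \<longleftrightarrow>
     (\<forall>k<length ds. x k \<in> homogeneous_part V (j - ds ! k)) \<and> (\<forall>k\<ge>length ds. x k = 0)"
  by (simp add: free_module_def)

lemma free_polys: "x \<in> free V ds \<Longrightarrow> x k \<in> polys V"
  by (cases "k < length ds") (auto simp: free_iff)

lemma free_grade_subset: "x \<in> free_grade V ds j \<Longrightarrow> x \<in> free V ds"
  by (auto simp: free_iff free_grade_iff homogeneous_polys)

lemma free_Nil [simp]: "free V [] = {0}"
  by (auto simp: free_iff fun_eq_iff)

lemma free_length_cong: "length ds = length ds' \<Longrightarrow> free V ds = free V ds'"
  by (simp add: free_iff set_eq_iff)

lemma free_0 [simp]: "0 \<in> free V ds" by (simp add: free_iff)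

lemma free_add: "x \<in> free V ds \<Longrightarrow> y \<in> free V ds \<Longrightarrow> x + y \<in> free V ds"
  by (auto simp: free_iff polys_add)

lemma free_diff: "x \<in> free V ds \<Longrightarrow> y \<in> free V ds \<Longrightarrow> x - y \<in> free V ds"
  by (auto simp: free_iff polys_diff)

lemma free_uminus: "x \<in> free V ds \<Longrightarrow> - x \<in> free V ds"
  by (auto simp: free_iff polys_uminus)

lemma free_scale: "r \<in> polys V \<Longrightarrow> x \<in> free V ds \<Longrightarrow> scale r x \<in> free V ds"
  by (auto simp: free_iff scale_def polys_mult)

lemma unit_grade: "l < length ds \<Longrightarrow> unit l \<in> free_grade V ds (ds ! l)"
  by (auto simp: free_grade_iff unit_def)

lemma unit_free: "l < length ds \<Longrightarrow> unit l \<in> free V ds"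
  by (rule free_grade_subset[OF unit_grade])

lemma columns_unit: "columns V ds ds unit"
  by (simp add: columns_def unit_grade)

lemma free_grade_uminus: "x \<in> free_grade V ds j \<Longrightarrow> - x \<in> free_grade V ds j"
  by (auto simp: free_grade_iff homogeneous_uminus)

lemma component_id: "x \<in> free_grade V ds d \<Longrightarrow> component ds d x = x"
  by (auto simp: component_def free_grade_iff fun_eq_iff intro: hpart_id)

lemma component_grade: "x \<in> free V ds \<Longrightarrow> component ds d x \<in> free_grade V ds d"
  by (auto simp: component_def free_grade_iff intro: hpart_homogeneous free_polys)

lemma lin_add: "lin n c (x + y) = lin n c x + lin n c y"
  by (simp add: lin_def fun_eq_iff distrib_right sum.distrib)

lemma lin_diff: "lin n c (x - y) = lin n c x - lin n c y"
  by (simp add: lin_def fun_eq_iff left_diff_distrib sum_subtractf)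

lemma lin_uminus: "lin n c (- x) = - lin n c x"
  by (simp add: lin_def fun_eq_iff sum_negf)

lemma lin_0 [simp]: "lin n c 0 = 0"
  by (simp add: lin_def fun_eq_iff)

lemma lin_zero_columns [simp]: "lin 0 c x = 0"
  by (simp add: lin_def fun_eq_iff)

lemma lin_scale: "lin n c (scale r x) = scale r (lin n c x)"
  by (simp add: lin_def scale_def fun_eq_iff sum_distrib_left mult.assoc)

lemma lin_cong: "(\<And>l. l < n \<Longrightarrow> c l = c' l) \<Longrightarrow> lin n c = lin n c'"
  by (simp add: lin_def fun_eq_iff)

lemma lin_lin: "lin n c (lin m d x) = lin m (\<lambda>l. lin n c (d l)) x"
proof
  fix k
  have "(\<Sum>l<n. (\<Sum>i<m. x i * d i l) * c l k) = (\<Sum>l<n. \<Sum>i<m. x i * (d i l * c l k))"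
    by (simp add: sum_distrib_right mult.assoc)
  also have "\<dots> = (\<Sum>i<m. x i * (\<Sum>l<n. d i l * c l k))"
    by (subst sum.swap) (simp add: sum_distrib_left)
  finally show "lin n c (lin m d x) k = lin m (\<lambda>l. lin n c (d l)) x k"
    by (simp add: lin_def)
qed

lemma lin_unit: "l < n \<Longrightarrow> lin n c (unit l) = c l"
  by (simp add: lin_def unit_def fun_eq_iff if_distribR cong: if_cong)
     (simp add: if_distrib[of "\<lambda>r. r * _"] cong: if_cong)

lemma lin_unit_id:
  assumes "x \<in> free V ds" shows "lin (length ds) unit x = x"
proof
  fix k
  have "lin (length ds) unit x k = (\<Sum>l<length ds. if l = k then x l else 0)"
    unfolding lin_def unit_def by (intro sum.cong) auto
  then show "lin (length ds) unit x k = x k"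
    using assms by (auto simp: free_iff)
qed

lemma lin_columns_uminus: "lin n (\<lambda>l. - c l) x = - lin n c x"
  by (simp add: lin_def fun_eq_iff sum_negf)

lemma columns_free: "columns V ds e c \<Longrightarrow> l < length e \<Longrightarrow> c l \<in> free V ds"
  by (auto simp: columns_def intro: free_grade_subset)

lemma lin_mem_free:
  assumes "\<And>l. l < n \<Longrightarrow> c l \<in> free V ds" "\<And>l. l < n \<Longrightarrow> x l \<in> polys V"
  shows "lin n c x \<in> free V ds"
  using assms unfolding free_iff lin_def by (auto intro!: polys_sum polys_mult sum.neutral)

lemma lin_free:
  assumes "columns V ds e c" "x \<in> free V e"
  shows "lin (length e) c x \<in> free V ds"
  by (rule lin_mem_free) (use assms columns_free free_polys in blast)+

lemma lin_free_grade:
  assumes "columns V ds e c" "x \<in> free_grade V e j"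
  shows "lin (length e) c x \<in> free_grade V ds j"
  unfolding free_grade_iff lin_def
proof (intro conjI allI impI homogeneous_sum sum.neutral ballI)
  fix k l assume k: "k < length ds" and "l \<in> {..<length e}"
  then have "x l * c l k \<in> homogeneous_part V ((j - e ! l) + (e ! l - ds ! k))"
    using assms by (intro homogeneous_mult) (auto simp: columns_def free_grade_iff)
  then show "x l * c l k \<in> homogeneous_part V (j - ds ! k)" by simp
next
  fix k l assume "length ds \<le> k" "l \<in> {..<length e}"
  then show "x l * c l k = 0" using assms by (auto simp: columns_def free_grade_iff)
qed

lemma columns_compose:
  assumes "columns V ds e c" "columns V e f a"
  shows "columns V ds f (\<lambda>l. lin (length e) c (a l))"
  using assms by (auto simp: columns_def[of V ds f] columns_def[of V e f] intro: lin_free_grade)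

lemma lin_component:
  assumes "columns V ds e c"
  shows "lin (length e) c (component e d x) = component ds d (lin (length e) c x)"
proof
  fix k
  show "lin (length e) c (component e d x) k = component ds d (lin (length e) c x) k"
  proof (cases "k < length ds")
    case True
    have "hpart (d - ds ! k) (x l * c l k) = hpart (d - e ! l) (x l) * c l k" if "l < length e" for l
    proof -
      have "c l k \<in> homogeneous_part V (e ! l - ds ! k)"
        using assms that True by (auto simp: columns_def free_grade_iff)
      from hpart_mult_homogeneous[OF this, of "d - e ! l" "x l"] show ?thesis by simp
    qed
    then show ?thesis using True
      by (simp add: component_def lin_def hpart_def restrict_sum)
  next
    case False
    then show ?thesis using assms
      by (auto simp: lin_def component_def columns_def free_grade_iff intro!: sum.neutral)
  qed
qed

lemma component_0 [simp]: "component ds d 0 = 0"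
  by (simp add: component_def fun_eq_iff hpart_def)

lemma graded_submoduleD:
  assumes "graded_submodule V ds N"
  shows "N \<subseteq> free V ds" "0 \<in> N" "x \<in> N \<Longrightarrow> y \<in> N \<Longrightarrow> x + y \<in> N"
    "r \<in> polys V \<Longrightarrow> x \<in> N \<Longrightarrow> scale r x \<in> N" "x \<in> N \<Longrightarrow> component ds d x \<in> N"
    "x \<in> N \<Longrightarrow> - x \<in> N" "x \<in> N \<Longrightarrow> y \<in> N \<Longrightarrow> x - y \<in> N"
proof -
  show 1: "N \<subseteq> free V ds" "0 \<in> N" "\<And>x y. x \<in> N \<Longrightarrow> y \<in> N \<Longrightarrow> x + y \<in> N"
    "\<And>r x. r \<in> polys V \<Longrightarrow> x \<in> N \<Longrightarrow> scale r x \<in> N" "x \<in> N \<Longrightarrow> component ds d x \<in> N"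
    using assms by (auto simp: graded_submodule_def)
  show 2: "- x \<in> N" if "x \<in> N" for x
    using 1(4)[OF polys_uminus[OF polys_1] that] by (simp add: scale_def fun_Compl_def)
  show "x \<in> N \<Longrightarrow> y \<in> N \<Longrightarrow> x - y \<in> N"
    using 1(3)[of x "- y"] 2[of y] by simp
qed

lemma submodule_lin:
  assumes "graded_submodule V ds N" "\<And>l. l < n \<Longrightarrow> b l \<in> N" "\<And>l. l < n \<Longrightarrow> z l \<in> polys V"
  shows "lin n b z \<in> N"
  using assms(2,3)
proof (induction n)
  case 0
  show ?case using graded_submoduleD(2)[OF assms(1)] by (metis lin_zero_columns)
next
  case (Suc n)
  have "lin (Suc n) b z = lin n b z + scale (z n) (b n)"
    by (simp add: lin_def scale_def fun_eq_iff)
  moreover have "lin n b z \<in> N" "scale (z n) (b n) \<in> N"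
    using Suc graded_submoduleD(4)[OF assms(1)] by auto
  ultimately show ?case
    using graded_submoduleD(3)[OF assms(1)] by metis
qed

lemma graded_submodule_lker:
  fixes c :: "nat \<Rightarrow> ('v, 'k::field) vec"
  assumes "columns V ds e c" shows "graded_submodule V e (lker V e c)"
proof -
  have "scale r 0 = (0 :: ('v, 'k) vec)" for r :: "('v, 'k) mpoly"
    by (simp add: scale_def fun_eq_iff)
  then show ?thesis
    unfolding graded_submodule_def
    by (auto simp: free_add free_scale lin_add lin_scale lin_component[OF assms]
        intro: free_grade_subset[OF component_grade])
qed

text \<open>Free modules are projective. Since a matrix with homogeneous columns commutes with taking
  homogeneous components, a homogeneous element of its image has a homogeneous preimage, and such
  preimages form the columns of the lift.\<close>

lemma graded_lift:
  assumes c: "columns V ds e c" and y: "columns V ds f y"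
    and im: "\<And>l. l < length f \<Longrightarrow> y l \<in> lin (length e) c ` free V e"
  shows "\<exists>a. columns V e f a \<and> (\<forall>x. lin (length e) c (lin (length f) a x) = lin (length f) y x)"
proof -
  have "\<exists>a. a \<in> free_grade V e (f ! l) \<and> lin (length e) c a = y l" if l: "l < length f" for l
  proof -
    obtain x where x: "x \<in> free V e" "lin (length e) c x = y l" using im[OF l] by auto
    have "lin (length e) c (component e (f ! l) x) = y l"
      using lin_component[OF c, of "f ! l" x] x(2) y l component_id[of "y l" V ds "f ! l"]
      by (simp add: columns_def)
    then show ?thesis using component_grade[OF x(1)] by blast
  qed
  then obtain a where a: "\<And>l. l < length f \<Longrightarrow> a l \<in> free_grade V e (f ! l) \<and> lin (length e) c (a l) = y l"
    by metis
  show ?thesis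
  proof (intro exI conjI allI)
    show "columns V e f a" using a by (simp add: columns_def)
    show "lin (length e) c (lin (length f) a x) = lin (length f) y x" for x
      using a lin_cong[of "length f" "\<lambda>l. lin (length e) c (a l)" y] by (simp add: lin_lin)
  qed
qed

definition join :: "nat \<Rightarrow> ('v, 'k::field) vec \<Rightarrow> ('v, 'k) vec \<Rightarrow> ('v, 'k) vec" where
  "join n x y = (\<lambda>k. if k < n then x k else y (k - n))"

definition tail :: "nat \<Rightarrow> ('v, 'k::field) vec \<Rightarrow> ('v, 'k) vec" where
  "tail n x = (\<lambda>k. x (k + n))"

lemma tail_join [simp]: "tail n (join n x y) = y"
  by (simp add: tail_def join_def fun_eq_iff)

lemma tail_0 [simp]: "tail n 0 = 0"
  by (simp add: tail_def fun_eq_iff)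

lemma tail_add: "tail n (x + y) = tail n x + tail n y"
  by (simp add: tail_def fun_eq_iff)

lemma tail_diff: "tail n (x - y) = tail n x - tail n y"
  by (simp add: tail_def fun_eq_iff)

lemma tail_free: "x \<in> free V (d1 @ d2) \<Longrightarrow> tail (length d1) x \<in> free V d2"
  by (auto simp: free_iff tail_def)

lemma tail_lin: "tail m (lin n c x) = lin n (\<lambda>l. tail m (c l)) x"
  by (simp add: tail_def lin_def)

lemma join_free: "x \<in> free V d1 \<Longrightarrow> y \<in> free V d2 \<Longrightarrow> join (length d1) x y \<in> free V (d1 @ d2)"
  by (auto simp: free_iff join_def)

lemma join_grade:
  "x \<in> free_grade V d1 j \<Longrightarrow> y \<in> free_grade V d2 j \<Longrightarrow> join (length d1) x y \<in> free_grade V (d1 @ d2) j"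
  by (auto simp: free_grade_iff join_def nth_append)

lemma free_append_left: "x \<in> free V d1 \<Longrightarrow> x \<in> free V (d1 @ d2)"
  by (auto simp: free_iff) (metis nat_le_linear not_less polys_0)

lemma free_grade_append_left: "x \<in> free_grade V d1 j \<Longrightarrow> x \<in> free_grade V (d1 @ d2) j"
  by (auto simp: free_grade_iff nth_append)

lemma free_append_tail_0:
  "x \<in> free V (d1 @ d2) \<Longrightarrow> tail (length d1) x = 0 \<Longrightarrow> x \<in> free V d1"
  by (auto simp: free_iff tail_def fun_eq_iff) (metis le_add_diff_inverse2)

lemma tail_eq_0_left: "x \<in> free V d1 \<Longrightarrow> tail (length d1) x = 0"
  by (auto simp: free_iff tail_def fun_eq_iff)

lemma lin_append:
  "lin (m + n) (\<lambda>l. if l < m then c l else b (l - m)) x = lin m c x + lin n b (tail m x)"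
proof
  fix k
  have "(\<Sum>l<m + n. x l * (if l < m then c l else b (l - m)) k) =
        (\<Sum>l<m. x l * c l k) + (\<Sum>l<n. x (l + m) * b l k)"
    by (induction n) (auto simp: add_ac)
  then show "lin (m + n) (\<lambda>l. if l < m then c l else b (l - m)) x k =
             (lin m c x + lin n b (tail m x)) k"
    by (simp add: lin_def tail_def)
qed

lemma lin_join [simp]: "lin n c (join n x y) = lin n c x"
  by (simp add: lin_def join_def)

lemma free_append_head: "x \<in> free V (d1 @ d2) \<Longrightarrow> join (length d1) x 0 \<in> free V d1"
  by (auto simp: free_iff join_def)

lemma columns_append:
  assumes "columns V ds e c" "columns V ds f b"
  shows "columns V ds (e @ f) (\<lambda>l. if l < length e then c l else b (l - length e))"
  using assms by (auto simp: columns_def nth_append)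

lemma columns_append_left: "columns V d1 e c \<Longrightarrow> columns V (d1 @ d2) e c"
  by (auto simp: columns_def free_grade_append_left)


section \<open>Finite free resolutions with bounded degrees\<close>

text \<open>\<open>fin_res V L ds N t\<close>: the submodule \<open>N\<close> of the free module on \<open>ds\<close> has a free resolution with
  at most \<open>L\<close> terms whose \<open>i\<close>-th term has generators of degree at most \<open>t + i\<close>. For an ideal \<open>N\<close> of \<open>S\<close> this is
  a certificate for \<open>reg N \<le> t\<close>, hence for \<open>reg (S/N) \<le> t - 1\<close>. Resolutions are not required to be
  minimal, so that they can be glued, and the recursion over the length avoids choosing all
  differentials at once.\<close>

primrec fin_res :: "'v set \<Rightarrow> nat \<Rightarrow> int list \<Rightarrow> ('v, 'k::field) vec set \<Rightarrow> int \<Rightarrow> bool" where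
  "fin_res V 0 ds N t \<longleftrightarrow> N = {0}"
| "fin_res V (Suc L) ds N t \<longleftrightarrow>
     (\<exists>e c. columns V ds e c \<and> (\<forall>d\<in>set e. d \<le> t) \<and> lin (length e) c ` free V e = N \<and>
        fin_res V L e (lker V e c) (t + 1))"

lemma fin_resE:
  assumes "fin_res V (Suc L) ds N t"
  obtains e c where "columns V ds e c" "\<And>d. d \<in> set e \<Longrightarrow> d \<le> t" "lin (length e) c ` free V e = N"
    "fin_res V L e (lker V e c) (t + 1)"
  using assms by auto

lemma fin_resI:
  assumes "columns V ds e c" "\<And>d. d \<in> set e \<Longrightarrow> d \<le> t" "lin (length e) c ` free V e = N"
    "fin_res V L e (lker V e c) (t + 1)"
  shows "fin_res V (Suc L) ds N t"
  using assms by auto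

lemma fin_res_Suc: "fin_res V L ds N t \<Longrightarrow> fin_res V (Suc L) ds N t"
proof (induction L arbitrary: ds N t)
  case 0
  show ?case
    by (rule fin_resI[of V ds "[]" "\<lambda>_. 0"]) (use 0 in \<open>auto simp: columns_def\<close>)
next
  case (Suc L)
  from Suc.prems obtain e c where "columns V ds e c" "\<And>d. d \<in> set e \<Longrightarrow> d \<le> t"
    "lin (length e) c ` free V e = N" "fin_res V L e (lker V e c) (t + 1)"
    by (rule fin_resE) blast
  then show ?case by (intro fin_resI[of V ds e c] Suc.IH)
qed

lemma fin_res_mono:
  assumes "fin_res V L ds N t" "L \<le> L'" "t \<le> t'" shows "fin_res V L' ds N t'"
proof -
  have "fin_res V L ds N t'"
    using assms(1,3)
  proof (induction L arbitrary: ds N t t')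
    case (Suc L)
    from Suc.prems(1) obtain e c where "columns V ds e c" "\<And>d. d \<in> set e \<Longrightarrow> d \<le> t"
      "lin (length e) c ` free V e = N" "fin_res V L e (lker V e c) (t + 1)"
      by (rule fin_resE) blast
    moreover have "fin_res V L e (lker V e c) (t' + 1)"
      using Suc.prems(2) by (intro Suc.IH[OF \<open>fin_res V L e (lker V e c) (t + 1)\<close>]) simp
    moreover have "\<And>d. d \<in> set e \<Longrightarrow> d \<le> t'"
      using \<open>\<And>d. d \<in> set e \<Longrightarrow> d \<le> t\<close> Suc.prems(2) by (rule order_trans)
    ultimately show ?case
      using \<open>columns V ds e c\<close> \<open>lin (length e) c ` free V e = N\<close> by (intro fin_resI[of V ds e c])
  qed simp
  then show ?thesis
    by (induction rule: dec_induct[OF assms(2)]) (auto intro: fin_res_Suc simp del: fin_res.simps)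
qed

lemma fin_res_append_left: "fin_res V L d1 N t \<Longrightarrow> fin_res V L (d1 @ d2) N t"
  by (cases L) (auto intro: columns_append_left)

lemma fin_res_shift:
  fixes N :: "('v, 'k::field) vec set"
  shows "fin_res V L ds N t \<Longrightarrow> fin_res V L (map ((+) a) ds) N (a + t)"
proof (induction L arbitrary: ds N t)
  case (Suc L)
  from Suc.prems obtain e c where 1: "columns V ds e c" "\<And>d. d \<in> set e \<Longrightarrow> d \<le> t"
    "lin (length e) c ` free V e = N" "fin_res V L e (lker V e c) (t + 1)"
    by (rule fin_resE) blast
  have 2: "free V (map ((+) a) e) = (free V e :: ('v, 'k) vec set)" by (rule free_length_cong) simp
  show ?case
  proof (rule fin_resI[of V _ "map ((+) a) e" c])
    show "columns V (map ((+) a) ds) (map ((+) a) e) c"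
      using 1(1) by (simp add: columns_def free_grade_iff)
    show "fin_res V L (map ((+) a) e) (lker V (map ((+) a) e) c) (a + t + 1)"
      using Suc.IH[OF 1(4)] 2 by (simp add: add.assoc)
  qed (use 1 2 in auto)
qed simp

text \<open>The horseshoe lemma: generators of \<open>NA\<close> together with lifts of generators of \<open>NC\<close> generate \<open>N\<close>,
  and the relations between them again sit between the relations of the two ends.\<close>

lemma fin_res_horseshoe:
  assumes "fin_res V L dA NA t" "fin_res V L dC NC t" "graded_submodule V (dA @ dC) N"
    and "{x\<in>N. tail (length dA) x = 0} = NA" "tail (length dA) ` N = NC"
  shows "fin_res V L (dA @ dC) N t"
  using assms
proof (induction L arbitrary: dA NA dC NC N t)
  case 0
  have "N \<subseteq> {0}"
  proof
    fix x assume x: "x \<in> N"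
    then have "tail (length dA) x \<in> NC" using 0(5) by blast
    then have "tail (length dA) x = 0" using 0(2) by simp
    then have "x \<in> NA" using x 0(4) by blast
    then show "x \<in> {0}" using 0(1) by simp
  qed
  then show ?case using graded_submoduleD(2)[OF 0(3)] by auto
next
  case (Suc L)
  note N = graded_submoduleD[OF Suc.prems(3)]
  obtain eA cA where A: "columns V dA eA cA" "\<And>d. d \<in> set eA \<Longrightarrow> d \<le> t"
    "lin (length eA) cA ` free V eA = NA" "fin_res V L eA (lker V eA cA) (t + 1)"
    using Suc.prems(1) by (rule fin_resE) blast
  obtain eC cC where C: "columns V dC eC cC" "\<And>d. d \<in> set eC \<Longrightarrow> d \<le> t"
    "lin (length eC) cC ` free V eC = NC" "fin_res V L eC (lker V eC cC) (t + 1)"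
    using Suc.prems(2) by (rule fin_resE) blast
  let ?n = "length dA" and ?a = "length eA" and ?c = "length eC"
  have tail_component: "tail ?n (component (dA @ dC) d x) = component dC d (tail ?n x)" for d x
    by (auto simp: tail_def component_def fun_eq_iff nth_append)
  have "\<exists>b. b \<in> N \<and> b \<in> free_grade V (dA @ dC) (eC ! l) \<and> tail ?n b = cC l" if l: "l < ?c" for l
  proof -
    have "cC l \<in> NC" using C(3) lin_unit[OF l, of cC] unit_free[OF l, of V] by (metis imageI)
    then obtain x where x: "x \<in> N" "tail ?n x = cC l" using Suc.prems(5) by auto
    have "cC l \<in> free_grade V dC (eC ! l)" using C(1) l by (simp add: columns_def)
    then have "tail ?n (component (dA @ dC) (eC ! l) x) = cC l"
      using x(2) component_id by (metis tail_component)
    then show ?thesis using x(1) N(1) N(5) component_grade by blast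
  qed
  then obtain b where b: "\<And>l. l < ?c \<Longrightarrow> b l \<in> N \<and> b l \<in> free_grade V (dA @ dC) (eC ! l) \<and> tail ?n (b l) = cC l"
    by metis
  define c where "c = (\<lambda>l. if l < ?a then cA l else b (l - ?a))"
  have lin_c: "lin (length (eA @ eC)) c x = lin ?a cA x + lin ?c b (tail ?a x)" for x
    by (simp add: c_def lin_append)
  have cols: "columns V (dA @ dC) (eA @ eC) c"
    unfolding c_def
    by (rule columns_append[OF columns_append_left[OF A(1)]]) (use b in \<open>auto simp: columns_def\<close>)
  have inA: "lin ?a cA x \<in> NA" if "x \<in> free V eA" for x using A(3) that by auto
  have NA: "NA \<subseteq> N" using Suc.prems(4) by auto
  have linb: "lin ?c b z \<in> N" if "z \<in> free V eC" for z
    using submodule_lin[OF Suc.prems(3), of ?c b z] b free_polys[OF that] by auto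
  have tailb: "tail ?n (lin ?c b z) = lin ?c cC z" for z
    using b lin_cong[of ?c "\<lambda>l. tail ?n (b l)" cC] by (simp add: tail_lin)
  have tailA: "tail ?n x = 0" if "x \<in> NA" for x using that Suc.prems(4) by auto
  have lin_cA_cong: "lin ?a cA x \<in> NA" if "x \<in> free V (eA @ eC)" for x
  proof -
    have "lin ?a cA x = lin ?a cA (join ?a x 0)" by simp
    then show ?thesis using inA[OF free_append_head[OF that]] by metis
  qed
  show ?case
  proof (rule fin_resI[OF cols])
    show "\<And>d. d \<in> set (eA @ eC) \<Longrightarrow> d \<le> t" using A(2) C(2) by auto
    show "lin (length (eA @ eC)) c ` free V (eA @ eC) = N"
    proof (intro subset_antisym subsetI)
      fix y assume "y \<in> lin (length (eA @ eC)) c ` free V (eA @ eC)"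
      then obtain x where x: "x \<in> free V (eA @ eC)" "y = lin ?a cA x + lin ?c b (tail ?a x)"
        using lin_c by auto
      show "y \<in> N" unfolding x(2) using N(3) NA lin_cA_cong[OF x(1)] linb[OF tail_free[OF x(1)]] by blast
    next
      fix y assume y: "y \<in> N"
      then obtain z where z: "z \<in> free V eC" "tail ?n y = lin ?c cC z"
        using Suc.prems(5) C(3) by blast
      have "y - lin ?c b z \<in> N" "tail ?n (y - lin ?c b z) = 0"
        using N(7)[OF y linb[OF z(1)]] z(2) by (auto simp: tail_diff tailb)
      then have "y - lin ?c b z \<in> NA" using Suc.prems(4) by blast
      then obtain w where w: "w \<in> free V eA" "y - lin ?c b z = lin ?a cA w" using A(3) by blast
      have "y = lin (length (eA @ eC)) c (join ?a w z)"
        unfolding lin_c lin_join tail_join using w(2) by (metis diff_add_cancel)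
      then show "y \<in> lin (length (eA @ eC)) c ` free V (eA @ eC)" using join_free[OF w(1) z(1)] by blast
    qed
    show "fin_res V L (eA @ eC) (lker V (eA @ eC) c) (t + 1)"
    proof (rule Suc.IH[OF A(4) C(4) graded_submodule_lker[OF cols]])
      show "{x \<in> lker V (eA @ eC) c. tail ?a x = 0} = lker V eA cA"
        unfolding lin_c
        by (auto simp: free_append_left tail_eq_0_left intro: free_append_tail_0)
      show "tail ?a ` lker V (eA @ eC) c = lker V eC cC"
      proof (intro subset_antisym subsetI)
        fix z assume "z \<in> tail ?a ` lker V (eA @ eC) c"
        then obtain x where x: "x \<in> free V (eA @ eC)" "z = tail ?a x"
            "lin ?a cA x + lin ?c b (tail ?a x) = 0"
          unfolding lin_c by auto
        have "tail ?n (lin ?a cA x) + lin ?c cC z = 0"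
          using arg_cong[OF x(3), of "tail ?n"] by (simp add: tail_add tailb x(2))
        then have "lin ?c cC z = 0" using tailA[OF lin_cA_cong[OF x(1)]] by simp
        then show "z \<in> lker V eC cC" using tail_free[OF x(1)] x(2) by simp
      next
        fix z assume z: "z \<in> lker V eC cC"
        have "lin ?c b z \<in> NA" using Suc.prems(4) linb tailb z by auto
        then obtain w where w: "w \<in> free V eA" "lin ?c b z = lin ?a cA w" using A(3) by blast
        have "lin (length (eA @ eC)) c (join ?a (- w) z) = 0"
          unfolding lin_c lin_join tail_join using w(2) by (simp add: lin_uminus)
        then show "z \<in> tail ?a ` lker V (eA @ eC) c"
          using join_free[OF free_uminus[OF w(1)], of z eC] z by (intro image_eqI[of _ _ "join ?a (- w) z"]) auto
      qed
    qed
  qed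
qed

text \<open>A free summand complementary to \<open>Z\<close> contributes generators but no relations. A resolution
  without terms, as \<open>Z = 0\<close> may have, would leave no room for the new generators.\<close>

lemma fin_res_add_free:
  assumes Z: "fin_res V (Suc L) ds Z t" and a: "columns V ds f a" and f: "\<And>d. d \<in> set f \<Longrightarrow> d \<le> t"
    and inj: "\<And>x. x \<in> free V f \<Longrightarrow> lin (length f) a x \<in> Z \<Longrightarrow> x = 0"
  shows "fin_res V (Suc L) ds {z + lin (length f) a x | z x. z \<in> Z \<and> x \<in> free V f} t"
proof -
  obtain e c where C: "columns V ds e c" "\<And>d. d \<in> set e \<Longrightarrow> d \<le> t"
    "lin (length e) c ` free V e = Z" "fin_res V L e (lker V e c) (t + 1)"
    using Z by (rule fin_resE) blast
  let ?e = "length e" and ?f = "length f"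
  define b where "b = (\<lambda>l. if l < ?e then c l else a (l - ?e))"
  have lin_b: "lin (length (e @ f)) b x = lin ?e c x + lin ?f a (tail ?e x)" for x
    by (simp add: b_def lin_append)
  have head: "lin ?e c x \<in> Z" "- lin ?e c x \<in> Z" if "x \<in> free V (e @ f)" for x
  proof -
    have "lin ?e c x = lin ?e c (join ?e x 0)" "- lin ?e c x = lin ?e c (- (join ?e x 0))"
      by (simp_all add: lin_uminus)
    then show "lin ?e c x \<in> Z" "- lin ?e c x \<in> Z"
      using C(3) free_append_head[OF that] free_uminus by blast+
  qed
  have tail0: "tail ?e x = 0" if "x \<in> lker V (e @ f) b" for x
  proof (rule inj)
    have x: "x \<in> free V (e @ f)" "lin ?e c x + lin ?f a (tail ?e x) = 0" using that lin_b by auto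
    show "tail ?e x \<in> free V f" by (rule tail_free[OF x(1)])
    have "lin ?f a (tail ?e x) = - lin ?e c x" using x(2) by (rule add_eq_0_iff[THEN iffD1])
    then show "lin ?f a (tail ?e x) \<in> Z" using head(2)[OF x(1)] by (simp only:)
  qed
  have "lker V (e @ f) b = lker V e c"
  proof (intro subset_antisym subsetI)
    fix x assume x: "x \<in> lker V (e @ f) b"
    then show "x \<in> lker V e c" using tail0[OF x] lin_b[of x] free_append_tail_0[of x V e f] by auto
  next
    fix x assume "x \<in> lker V e c"
    then show "x \<in> lker V (e @ f) b" using lin_b[of x] by (auto simp: free_append_left tail_eq_0_left)
  qed
  with fin_res_append_left[OF C(4), of f]
  have ker: "fin_res V L (e @ f) (lker V (e @ f) b) (t + 1)"
    by (simp only:)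
  show ?thesis
  proof (rule fin_resI[OF _ _ _ ker])
    show "columns V ds (e @ f) b" unfolding b_def by (rule columns_append[OF C(1) a])
    show "\<And>d. d \<in> set (e @ f) \<Longrightarrow> d \<le> t" using C(2) f by auto
    show "lin (length (e @ f)) b ` free V (e @ f) = {z + lin ?f a x | z x. z \<in> Z \<and> x \<in> free V f}"
    proof (intro subset_antisym subsetI)
      fix y assume "y \<in> lin (length (e @ f)) b ` free V (e @ f)"
      then obtain x where "x \<in> free V (e @ f)" "y = lin ?e c x + lin ?f a (tail ?e x)" using lin_b by auto
      then show "y \<in> {z + lin ?f a x | z x. z \<in> Z \<and> x \<in> free V f}" using head(1) tail_free by blast
    next
      fix y assume "y \<in> {z + lin ?f a x | z x. z \<in> Z \<and> x \<in> free V f}"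
      then obtain z x where z: "y = z + lin ?f a x" "z \<in> Z" "x \<in> free V f" by auto
      then obtain w where w: "w \<in> free V e" "z = lin ?e c w" using C(3) by blast
      have "y = lin (length (e @ f)) b (join ?e w x)" using lin_b[of "join ?e w x"] z w by simp
      then show "y \<in> lin (length (e @ f)) b ` free V (e @ f)" using join_free[OF w(1) z(3)] by blast
    qed
  qed
qed

text \<open>Dividing both the ambient free module and \<open>N\<close> by a free submodule of \<open>N\<close> does not change the
  quotient by \<open>N\<close>: the generators of the submodule turn into relations one step further on.\<close>

lemma fin_res_quotient_free:
  assumes N: "fin_res V (Suc L) ds N t" and p: "columns V ds' ds p" and a: "columns V ds f a"
    and ker: "lker V ds p = lin (length f) a ` free V f" and aN: "\<And>l. l < length f \<Longrightarrow> a l \<in> N"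
    and inj: "lker V f a = {0}" and f: "\<And>d. d \<in> set f \<Longrightarrow> d \<le> t + 1"
  shows "fin_res V (Suc (Suc L)) ds' (lin (length ds) p ` N) t"
proof -
  obtain e c where C: "columns V ds e c" "\<And>d. d \<in> set e \<Longrightarrow> d \<le> t"
    "lin (length e) c ` free V e = N" "fin_res V L e (lker V e c) (t + 1)"
    using N by (rule fin_resE) blast
  obtain b where b: "columns V e f b" "\<And>x. lin (length e) c (lin (length f) b x) = lin (length f) a x"
    using graded_lift[OF C(1) a, unfolded C(3), OF aN] by blast
  let ?q = "\<lambda>l. lin (length ds) p (c l)"
  have linq: "lin (length e) ?q x = lin (length ds) p (lin (length e) c x)" for x
    by (simp add: lin_lin)
  have kerq: "lker V e ?q = {z + lin (length f) b x | z x. z \<in> lker V e c \<and> x \<in> free V f}"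
  proof (intro subset_antisym subsetI)
    fix y assume y: "y \<in> lker V e ?q"
    then have "lin (length e) c y \<in> lker V ds p" using lin_free[OF C(1)] linq by auto
    then obtain x where x: "x \<in> free V f" "lin (length e) c y = lin (length f) a x" using ker by auto
    have "y - lin (length f) b x \<in> lker V e c"
      using y x lin_free[OF b(1) x(1)] by (simp add: lin_diff b(2) free_diff)
    moreover have "y = (y - lin (length f) b x) + lin (length f) b x" by simp
    ultimately show "y \<in> {z + lin (length f) b x | z x. z \<in> lker V e c \<and> x \<in> free V f}"
      using x(1) by blast
  next
    fix y assume "y \<in> {z + lin (length f) b x | z x. z \<in> lker V e c \<and> x \<in> free V f}"
    then obtain z x where y: "y = z + lin (length f) b x" "z \<in> lker V e c" "x \<in> free V f" by auto
    have "lin (length f) a x \<in> lker V ds p" using ker y(3) by auto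
    then have "lin (length e) ?q y = 0" unfolding linq y(1) using y(2) by (simp add: lin_add b(2))
    then show "y \<in> lker V e ?q" using y lin_free[OF b(1) y(3)] by (simp add: free_add)
  qed
  show ?thesis
  proof (rule fin_resI)
    show "columns V ds' e ?q" by (rule columns_compose[OF p C(1)])
    show "lin (length e) ?q ` free V e = lin (length ds) p ` N"
      unfolding C(3)[symmetric] image_image linq ..
    show "\<And>d. d \<in> set e \<Longrightarrow> d \<le> t" by (rule C(2))
    show "fin_res V (Suc L) e (lker V e ?q) (t + 1)"
      unfolding kerq
    proof (rule fin_res_add_free[OF fin_res_Suc[OF C(4)] b(1) f])
      fix x assume x: "x \<in> free V f" "lin (length f) b x \<in> lker V e c"
      then have "lin (length f) a x = 0" using b(2)[of x] by simp
      then show "x = 0" using inj x(1) by blast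
    qed
  qed
qed

text \<open>\<open>equiv_presentation V d1 N1 d2 N2\<close> says that the graded modules presented by \<open>N1\<close> and \<open>N2\<close>,
  that is the quotients of the free modules on \<open>d1\<close> and \<open>d2\<close> by them, are isomorphic.\<close>

definition equiv_presentation ::
    "'v set \<Rightarrow> int list \<Rightarrow> ('v, 'k::field) vec set \<Rightarrow> int list \<Rightarrow> ('v, 'k) vec set \<Rightarrow> bool" where
  "equiv_presentation V d1 N1 d2 N2 \<longleftrightarrow>
     (\<exists>\<alpha> \<beta>. columns V d2 d1 \<alpha> \<and> columns V d1 d2 \<beta> \<and>
        (\<forall>x\<in>N1. lin (length d1) \<alpha> x \<in> N2) \<and> (\<forall>y\<in>N2. lin (length d2) \<beta> y \<in> N1) \<and>
        (\<forall>x\<in>free V d1. lin (length d2) \<beta> (lin (length d1) \<alpha> x) - x \<in> N1) \<and>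
        (\<forall>y\<in>free V d2. lin (length d1) \<alpha> (lin (length d2) \<beta> y) - y \<in> N2))"

text \<open>Schanuel's lemma. Both presentations are quotients of the same submodule \<open>K\<close> of the sum of the
  two free modules: \<open>K\<close> arises from \<open>N1\<close> by adding the graph of \<open>- \<beta>\<close>, and \<open>N2\<close> arises from \<open>K\<close> by
  dividing out the graph of \<open>- \<alpha>\<close>.\<close>

lemma fin_res_equiv_presentation:
  assumes fr: "fin_res V L d1 N1 t" and N1: "graded_submodule V d1 N1" and N2: "graded_submodule V d2 N2"
    and eq: "equiv_presentation V d1 N1 d2 N2"
    and d1: "\<And>d. d \<in> set d1 \<Longrightarrow> d \<le> t + 1" and d2: "\<And>d. d \<in> set d2 \<Longrightarrow> d \<le> t"
  shows "fin_res V (Suc (Suc L)) d2 N2 t"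
proof -
  let ?n = "length d1" and ?m = "length d2"
  obtain \<alpha> \<beta> where \<alpha>: "columns V d2 d1 \<alpha>" and \<beta>: "columns V d1 d2 \<beta>"
    and \<alpha>N: "\<And>x. x \<in> N1 \<Longrightarrow> lin ?n \<alpha> x \<in> N2" and \<beta>N: "\<And>y. y \<in> N2 \<Longrightarrow> lin ?m \<beta> y \<in> N1"
    and \<beta>\<alpha>: "\<And>x. x \<in> free V d1 \<Longrightarrow> lin ?m \<beta> (lin ?n \<alpha> x) - x \<in> N1"
    and \<alpha>\<beta>: "\<And>y. y \<in> free V d2 \<Longrightarrow> lin ?n \<alpha> (lin ?m \<beta> y) - y \<in> N2"
    using eq unfolding equiv_presentation_def by auto
  define g where "g = (\<lambda>l. join ?n (- \<beta> l) (unit l))"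
  define h where "h = (\<lambda>l. join ?n (unit l) (- \<alpha> l))"
  define p where "p = (\<lambda>l. if l < ?n then \<alpha> l else unit (l - ?n))"
  have join_lin: "lin m (\<lambda>l. join ?n (u l) (v l)) x = join ?n (lin m u x) (lin m v x)" for m u v x
    by (simp add: lin_def join_def fun_eq_iff)
  have lin_g: "lin ?m g y = join ?n (- lin ?m \<beta> y) y" if "y \<in> free V d2" for y
    unfolding g_def join_lin by (simp add: lin_columns_uminus lin_unit_id[OF that])
  have lin_h: "lin ?n h x = join ?n x (- lin ?n \<alpha> x)" if "x \<in> free V d1" for x
    unfolding h_def join_lin by (simp add: lin_columns_uminus lin_unit_id[OF that])
  have lin_p: "lin (length (d1 @ d2)) p x = lin ?n \<alpha> x + tail ?n x" if "x \<in> free V (d1 @ d2)" for x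
    by (simp add: p_def lin_append lin_unit_id[OF tail_free[OF that]])
  have g: "columns V (d1 @ d2) d2 g"
    using \<beta> unfolding columns_def g_def by (auto intro!: join_grade free_grade_uminus unit_grade)
  have h: "columns V (d1 @ d2) d1 h"
    using \<alpha> unfolding columns_def h_def by (auto intro!: join_grade free_grade_uminus unit_grade)
  have p: "columns V d2 (d1 @ d2) p"
    unfolding p_def by (rule columns_append[OF \<alpha> columns_unit])
  let ?K = "{z + lin ?m g y | z y. z \<in> N1 \<and> y \<in> free V d2}"
  have N1_tail: "tail ?n z = 0" "z \<in> free V d1" if "z \<in> N1" for z
    using graded_submoduleD(1)[OF N1] that tail_eq_0_left by auto
  have K: "fin_res V (Suc L) (d1 @ d2) ?K t"
  proof (rule fin_res_add_free[OF fin_res_Suc[OF fin_res_append_left[OF fr]] g d2])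
    fix y assume "y \<in> free V d2" "lin ?m g y \<in> N1"
    then show "y = 0" using N1_tail(1)[of "lin ?m g y"] lin_g by simp
  qed
  have join_add: "z + join ?n x y = join ?n (z + x) y" if "z \<in> N1" for z x y
    using N1_tail[OF that] by (auto simp: join_def fun_eq_iff free_iff)
  have "fin_res V (Suc (Suc L)) d2 (lin (length (d1 @ d2)) p ` ?K) t"
  proof (rule fin_res_quotient_free[OF K p h _ _ _ d1])
    show "lker V (d1 @ d2) p = lin ?n h ` free V d1"
    proof (intro subset_antisym subsetI)
      fix x assume "x \<in> lker V (d1 @ d2) p"
      then have x: "x \<in> free V (d1 @ d2)" "lin ?n \<alpha> x + tail ?n x = 0" using lin_p by auto
      let ?x = "join ?n x 0"
      have x': "?x \<in> free V d1" by (rule free_append_head[OF x(1)])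
      have "tail ?n x = - lin ?n \<alpha> x" using x(2) by (metis add_eq_0_iff)
      then have "lin ?n h ?x = join ?n ?x (tail ?n x)" using lin_h[OF x'] by simp
      also have "\<dots> = x" by (auto simp: join_def tail_def fun_eq_iff)
      finally show "x \<in> lin ?n h ` free V d1" using x' by (metis imageI)
    next
      fix x assume "x \<in> lin ?n h ` free V d1"
      then obtain y where y: "y \<in> free V d1" "x = join ?n y (- lin ?n \<alpha> y)" using lin_h by auto
      have "x \<in> free V (d1 @ d2)"
        unfolding y(2) by (intro join_free free_uminus lin_free[OF \<alpha>] y(1))
      then show "x \<in> lker V (d1 @ d2) p" using lin_p[of x] y(2) by simp
    qed
    show "h l \<in> ?K" if l: "l < ?n" for l
    proof -
      have l': "lin ?n \<alpha> (unit l) = \<alpha> l" by (rule lin_unit[OF l])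
      have \<alpha>l: "\<alpha> l \<in> free V d2" using columns_free[OF \<alpha> l] .
      let ?z = "- (lin ?m \<beta> (\<alpha> l) - unit l)"
      have z: "?z \<in> N1" using \<beta>\<alpha>[OF unit_free[OF l]] l' graded_submoduleD(6)[OF N1] by metis
      have "?z + lin ?m g (- \<alpha> l) = join ?n (unit l) (- \<alpha> l)"
        using lin_g[OF free_uminus[OF \<alpha>l]] join_add[OF z] by (simp add: lin_uminus)
      then have "h l = ?z + lin ?m g (- \<alpha> l)" by (simp add: h_def)
      then show ?thesis using z free_uminus[OF \<alpha>l] by blast
    qed
    show "lker V d1 h = {0}"
    proof -
      have "x = 0" if "x \<in> free V d1" "lin ?n h x = 0" for x
      proof
        fix k
        have "join ?n x (- lin ?n \<alpha> x) k = 0" using that lin_h by simp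
        then show "x k = 0 k" using that(1) by (cases "k < ?n") (auto simp: join_def free_iff)
      qed
      then show ?thesis by auto
    qed
  qed
  also have "lin (length (d1 @ d2)) p ` ?K = N2"
  proof (intro subset_antisym subsetI)
    fix u assume "u \<in> lin (length (d1 @ d2)) p ` ?K"
    then obtain z y where u: "z \<in> N1" "y \<in> free V d2" "u = lin (length (d1 @ d2)) p (z + lin ?m g y)"
      by auto
    have "z + lin ?m g y \<in> free V (d1 @ d2)"
      using N1_tail(2)[OF u(1)] lin_free[OF g u(2)] by (simp add: free_add free_append_left)
    then have "u = lin ?n \<alpha> z - (lin ?n \<alpha> (lin ?m \<beta> y) - y)"
      using u lin_p[of "z + lin ?m g y"] lin_g[OF u(2)]
      by (simp add: lin_add tail_add N1_tail lin_uminus)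
    then show "u \<in> N2" using graded_submoduleD(7)[OF N2 \<alpha>N[OF u(1)] \<alpha>\<beta>[OF u(2)]] by simp
  next
    fix y assume y: "y \<in> N2"
    then have y': "y \<in> free V d2" using graded_submoduleD(1)[OF N2] by auto
    let ?x = "lin ?m \<beta> y + lin ?m g y"
    have x: "?x \<in> ?K" using \<beta>N[OF y] y' by blast
    have "?x = join ?n 0 y" using join_add[OF \<beta>N[OF y]] lin_g[OF y'] by simp
    then have "lin (length (d1 @ d2)) p ?x = y"
      using lin_p[of ?x] join_free[OF free_0 y', of d1] by simp
    then show "y \<in> lin (length (d1 @ d2)) p ` ?K" using x by (rule image_eqI[OF sym])
  qed
  finally show ?thesis .
qed

text \<open>Two matrices with the same image present isomorphic modules, namely that image.\<close>

lemma equiv_presentation_lker: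
  assumes c1: "columns V ds e1 c1" and c2: "columns V ds e2 c2"
    and im: "lin (length e1) c1 ` free V e1 = lin (length e2) c2 ` free V e2"
  shows "equiv_presentation V e1 (lker V e1 c1) e2 (lker V e2 c2)"
proof -
  have 1: "c1 l \<in> lin (length e2) c2 ` free V e2" if "l < length e1" for l
    unfolding im[symmetric] using lin_unit[OF that, of c1, symmetric] unit_free[OF that] by (rule image_eqI)
  obtain \<alpha> where \<alpha>: "columns V e2 e1 \<alpha>"
      "\<And>x. lin (length e2) c2 (lin (length e1) \<alpha> x) = lin (length e1) c1 x"
    using graded_lift[OF c2 c1 1] by blast
  have 2: "c2 l \<in> lin (length e1) c1 ` free V e1" if "l < length e2" for l
    unfolding im using lin_unit[OF that, of c2, symmetric] unit_free[OF that] by (rule image_eqI)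
  obtain \<beta> where \<beta>: "columns V e1 e2 \<beta>"
      "\<And>x. lin (length e1) c1 (lin (length e2) \<beta> x) = lin (length e2) c2 x"
    using graded_lift[OF c1 c2 2] by blast
  show ?thesis unfolding equiv_presentation_def
    by (rule exI[of _ \<alpha>], rule exI[of _ \<beta>])
       (auto simp: \<alpha> \<beta> lin_diff lin_free[OF \<alpha>(1)] lin_free[OF \<beta>(1)] free_diff)
qed

text \<open>Nakayama's lemma: the basis elements of a minimal presentation are independent modulo the
  irrelevant ideal, so each of them needs a partner of the same degree in any other presentation.\<close>

lemma minimal_presentation_degrees:
  assumes eq: "equiv_presentation V d1 N1 d2 N2"
    and min: "\<And>x k. x \<in> N2 \<Longrightarrow> k < length d2 \<Longrightarrow> coeff (x k) 0 = 0"
  shows "set d2 \<subseteq> set d1"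
proof
  fix d assume "d \<in> set d2"
  then obtain k where k: "k < length d2" "d2 ! k = d" by (auto simp: in_set_conv_nth)
  obtain \<alpha> \<beta> where \<alpha>: "columns V d2 d1 \<alpha>" and \<beta>: "columns V d1 d2 \<beta>"
    and \<alpha>\<beta>: "\<And>y. y \<in> free V d2 \<Longrightarrow> lin (length d1) \<alpha> (lin (length d2) \<beta> y) - y \<in> N2"
    using eq unfolding equiv_presentation_def by auto
  show "d \<in> set d1"
  proof (rule ccontr)
    assume d: "d \<notin> set d1"
    have "coeff (\<beta> k l) 0 = 0" if "l < length d1" for l
    proof (rule ccontr)
      assume "coeff (\<beta> k l) 0 \<noteq> 0"
      moreover have "\<beta> k l \<in> homogeneous_part V (d2 ! k - d1 ! l)"
        using \<beta> k(1) that by (simp add: columns_def free_grade_iff)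
      ultimately have "d = d1 ! l" using homogeneous_constant_term k(2) by fastforce
      then show False using d that by simp
    qed
    then have "coeff (lin (length d1) \<alpha> (\<beta> k) k) 0 = 0"
      by (simp add: lin_def lookup_sum constant_term_mult)
    moreover have "lin (length d1) \<alpha> (\<beta> k) - unit k \<in> N2"
      using \<alpha>\<beta>[OF unit_free[OF k(1)]] by (simp add: lin_unit[OF k(1)])
    ultimately show False using min[of _ k] k(1) by (fastforce simp: lookup_minus unit_def)
  qed
qed


section \<open>Squarefree monomial ideals\<close>

text \<open>A squarefree monomial ideal is given by the upward closed family of the supports of its
  monomials. As a submodule of the free module of rank one it consists of vectors.\<close>

definition sqfree_ideal :: "'v set \<Rightarrow> ('v set \<Rightarrow> bool) \<Rightarrow> ('v, 'k::field) vec set" where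
  "sqfree_ideal V Q = {x \<in> free V [0]. \<forall>m\<in>supp (x 0). Q (supp m)}"

definition embed :: "('v, 'k::field) mpoly \<Rightarrow> ('v, 'k) vec" where
  "embed f = (\<lambda>k. if k = 0 then f else 0)"

lemma embed_0_apply [simp]: "embed f 0 = f"
  by (simp add: embed_def)

lemma free_rank1_iff: "x \<in> free V [d] \<longleftrightarrow> x 0 \<in> polys V \<and> x = embed (x 0)"
  by (auto simp: free_iff embed_def fun_eq_iff)

lemma free_rank1_cong: "x \<in> free V [d] \<longleftrightarrow> x \<in> free V [d']"
  by (simp add: free_rank1_iff)

lemma embed_free: "f \<in> polys V \<Longrightarrow> embed f \<in> free V [d]"
  by (simp add: free_rank1_iff)

lemma embed_grade: "f \<in> homogeneous_part V (j - d) \<Longrightarrow> embed f \<in> free_grade V [d] j"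
  by (auto simp: free_grade_iff embed_def)

lemma sqfree_ideal_iff:
  "x \<in> sqfree_ideal V Q \<longleftrightarrow> x \<in> free V [0] \<and> (\<forall>m\<in>supp (x 0). Q (supp m))"
  by (simp add: sqfree_ideal_def)

lemma graded_submodule_sqfree_ideal:
  assumes "mono Q" shows "graded_submodule V [0] (sqfree_ideal V Q :: ('v, 'k::field) vec set)"
  unfolding graded_submodule_def
proof (intro conjI ballI allI)
  show "sqfree_ideal V Q \<subseteq> (free V [0] :: ('v, 'k) vec set)" by (auto simp: sqfree_ideal_iff)
  show "0 \<in> (sqfree_ideal V Q :: ('v, 'k) vec set)" by (simp add: sqfree_ideal_iff)
next
  fix x y :: "('v, 'k) vec" assume "x \<in> sqfree_ideal V Q" "y \<in> sqfree_ideal V Q"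
  then show "x + y \<in> sqfree_ideal V Q"
    unfolding sqfree_ideal_iff using keys_add[of "x 0" "y 0"] by (auto simp: free_add)
next
  fix r :: "('v, 'k) mpoly" and x :: "('v, 'k) vec" assume r: "r \<in> polys V" and x: "x \<in> sqfree_ideal V Q"
  have "Q (supp m)" if "m \<in> supp (r * x 0)" for m
  proof -
    obtain a b where "m = a + b" "b \<in> supp (x 0)" using \<open>m \<in> supp (r * x 0)\<close> by (rule supp_mult_cases)
    then show ?thesis using x monoD[OF assms, of "supp b" "supp m"]
      by (simp add: sqfree_ideal_iff supp_monom_add)
  qed
  then show "scale r x \<in> sqfree_ideal V Q"
    using r x by (auto simp: sqfree_ideal_iff free_scale) (simp add: scale_def)
next
  fix d x assume "x \<in> (sqfree_ideal V Q :: ('v, 'k) vec set)"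
  then show "component [0] d x \<in> sqfree_ideal V Q"
    using free_grade_subset[OF component_grade[of x V "[0]" d]]
    by (auto simp: sqfree_ideal_iff) (auto simp: component_def hpart_def supp_restrict)
qed

lemma graded_submodule_preimage:
  assumes c: "columns V ds e c" and M: "graded_submodule V ds M"
  shows "graded_submodule V e {x \<in> free V e. lin (length e) c x \<in> M}"
  unfolding graded_submodule_def
proof (intro conjI ballI allI)
  show "0 \<in> {x \<in> free V e. lin (length e) c x \<in> M}" using graded_submoduleD(2)[OF M] by simp
qed (use graded_submoduleD[OF M] in
    \<open>auto simp only: mem_Collect_eq lin_add lin_scale lin_component[OF c] free_add free_scale
       intro: free_grade_subset[OF component_grade]\<close>)

text \<open>\<open>reg_le K V Q s\<close> bounds the regularity of \<open>S/J\<close> by \<open>s\<close>, where \<open>J\<close> is the ideal of \<open>Q\<close>. The argument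
  \<open>K\<close> names the coefficient field, which does not occur in the type of \<open>Q\<close>; the shift by one passes from
  \<open>S/J\<close> to \<open>J\<close>.\<close>

definition reg_le :: "'k::field itself \<Rightarrow> 'v set \<Rightarrow> ('v set \<Rightarrow> bool) \<Rightarrow> int \<Rightarrow> bool" where
  "reg_le K V Q s \<longleftrightarrow> (\<exists>L. fin_res V L [0] (sqfree_ideal V Q :: ('v, 'k) vec set) (s + 1))"

lemma reg_le_mono: "reg_le K V Q s \<Longrightarrow> s \<le> s' \<Longrightarrow> reg_le K V Q s'"
  unfolding reg_le_def by (blast intro: fin_res_mono[OF _ order_refl add_right_mono])

lemma monom_split: "x \<in> supp m \<Longrightarrow> \<exists>b. m = Poly_Mapping.single x 1 + b" for m :: "'v \<Rightarrow>\<^sub>0 nat"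
  by (rule exI[of _ "m - Poly_Mapping.single x 1"], rule poly_mapping_eqI)
     (auto simp: lookup_add lookup_minus lookup_single when_def in_keys_iff)

lemma supp_single_add: "supp (Poly_Mapping.single x (1::nat) + m) = insert x (supp m)"
  by (simp add: supp_monom_add)

lemmas supp_Suc_single_add = supp_single_add[unfolded One_nat_def]

lemma var_supp_mult: "supp (f * var x) = (+) (Poly_Mapping.single x 1) ` supp f"
  unfolding var_def by (subst mult.commute) (simp add: supp_monom_mult)

lemma var_polys: "x \<in> V \<Longrightarrow> var x \<in> polys V"
  using var_homogeneous by (rule homogeneous_polys)

lemma division_by_var:
  assumes "f \<in> polys V"
  obtains q where "q \<in> polys V" "\<And>m. m \<in> supp (f - q * var x) \<Longrightarrow> m \<in> supp f \<and> x \<notin> supp m"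
proof
  let ?q = "monom_quot (Poly_Mapping.single x 1) f"
  show "?q \<in> polys V"
    unfolding polys_iff
  proof
    fix m assume "m \<in> supp ?q"
    then have "supp (Poly_Mapping.single x 1 + m) \<subseteq> V"
      using assms by (simp add: polys_iff supp_monom_quot)
    then show "supp m \<subseteq> V" by (simp add: supp_monom_add)
  qed
  fix m assume "m \<in> supp (f - ?q * var x)"
  then have "m \<in> supp (f - Poly_Mapping.single (Poly_Mapping.single x 1) 1 * ?q)"
    by (simp add: var_def mult.commute)
  from monom_quot_remainder[OF this] monom_split[of x m] show "m \<in> supp f \<and> x \<notin> supp m" by auto
qed

lemma lin_singleton: "lin (Suc 0) b z = scale (z 0) (b 0)"
  by (simp add: lin_def scale_def fun_eq_iff)

lemma scale_embed: "scale r (embed f) = embed (r * f)"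
  by (simp add: scale_def embed_def fun_eq_iff)

lemma embed_add: "embed f + embed g = embed (f + g)"
  by (simp add: embed_def fun_eq_iff)

lemma sqfree_ideal_embed: "embed f \<in> sqfree_ideal V Q \<longleftrightarrow> f \<in> polys V \<and> (\<forall>m\<in>supp f. Q (supp m))"
  by (simp add: sqfree_ideal_iff free_rank1_iff)

text \<open>This comes from the exact sequence \<open>0 \<rightarrow> S/(J : x)(-1) \<rightarrow> S/J \<rightarrow> S/(J + x) \<rightarrow> 0\<close>. The horseshoe lemma
  resolves the relations \<open>N\<close> between the two generators \<open>x\<close> and \<open>1\<close> of \<open>S/J\<close>, and this presentation is
  equivalent to the one on the generator \<open>1\<close> alone.\<close>

lemma reg_le_colon:
  fixes K :: "'k::field itself"
  assumes Q: "mono Q" and x: "x \<in> V" and s: "0 \<le> s"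
    and colon: "reg_le K V (\<lambda>S. Q (insert x S)) (s - 1)" and plus: "reg_le K V (\<lambda>S. Q S \<or> x \<in> S) s"
  shows "reg_le K V Q s"
proof -
  define J :: "('a, 'k) vec set" where "J = sqfree_ideal V Q"
  define \<alpha> :: "nat \<Rightarrow> ('a, 'k) vec" where "\<alpha> = (\<lambda>l. if l = 0 then embed (var x) else embed 1)"
  define \<beta> :: "nat \<Rightarrow> ('a, 'k) vec" where "\<beta> = (\<lambda>l. unit 1)"
  define N where "N = {y \<in> free V [1, 0]. lin (length [1, 0 :: int]) \<alpha> y \<in> J}"
  have J: "graded_submodule V [0] J" unfolding J_def by (rule graded_submodule_sqfree_ideal[OF Q])
  have \<alpha>: "columns V [0] [1, 0] \<alpha>"
    by (auto simp: columns_def \<alpha>_def less_Suc_eq x intro!: embed_grade var_homogeneous)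
  have \<beta>: "columns V [1, 0] [0] \<beta>"
    using unit_grade[of 1 "[1, 0]" V] by (simp add: columns_def \<beta>_def)
  have N: "graded_submodule V [1, 0] N" unfolding N_def by (rule graded_submodule_preimage[OF \<alpha> J])
  have lin\<alpha>: "lin 2 \<alpha> y = embed (y 0 * var x + y 1)" for y
    by (simp add: lin_def \<alpha>_def embed_def fun_eq_iff numeral_2_eq_2)
  have lin\<alpha>\<beta>: "lin 2 \<alpha> (lin 1 \<beta> y) = y" if "y \<in> free V [0]" for y
    unfolding lin\<alpha> using that by (simp add: lin_singleton \<beta>_def scale_def unit_def free_rank1_iff)
  have N_iff: "y \<in> N \<longleftrightarrow> y \<in> free V [1, 0] \<and> embed (y 0 * var x + y 1) \<in> J" for y
    by (simp add: N_def lin\<alpha>[unfolded numeral_2_eq_2])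
  obtain L1 where "fin_res V L1 [0] (sqfree_ideal V (\<lambda>S. Q (insert x S)) :: ('a, 'k) vec set) s"
    using colon unfolding reg_le_def by auto
  from fin_res_shift[OF this, of 1]
  have L1: "fin_res V L1 [1] (sqfree_ideal V (\<lambda>S. Q (insert x S)) :: ('a, 'k) vec set) (s + 1)"
    by (simp add: add.commute)
  obtain L2 where L2: "fin_res V L2 [0] (sqfree_ideal V (\<lambda>S. Q S \<or> x \<in> S) :: ('a, 'k) vec set) (s + 1)"
    using plus unfolding reg_le_def by auto
  have "fin_res V (max L1 L2) ([1] @ [0]) N (s + 1)"
  proof (rule fin_res_horseshoe[OF fin_res_mono[OF L1] fin_res_mono[OF L2]])
    show "graded_submodule V ([1] @ [0]) N" using N by simp
    show "{y \<in> N. tail (length [1 :: int]) y = 0} = sqfree_ideal V (\<lambda>S. Q (insert x S))"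
    proof (intro subset_antisym subsetI)
      fix y assume "y \<in> {y \<in> N. tail (length [1 :: int]) y = 0}"
      then have y: "y \<in> N" "tail 1 y = 0" by auto
      have "y \<in> free V [1]" using free_append_tail_0[of y V "[1]" "[0]"] y N_iff by simp
      moreover have "y 1 = 0" using fun_cong[OF y(2), of 0] by (simp add: tail_def)
      ultimately show "y \<in> sqfree_ideal V (\<lambda>S. Q (insert x S))"
        using y(1)
        by (auto simp: free_rank1_cong[of y V 1 0] N_iff J_def sqfree_ideal_embed sqfree_ideal_iff[of y] var_supp_mult supp_single_add supp_Suc_single_add)
    next
      fix y :: "('a, 'k) vec" assume y: "y \<in> sqfree_ideal V (\<lambda>S. Q (insert x S))"
      then have y': "y \<in> free V [1]"
        by (simp add: sqfree_ideal_iff free_rank1_cong[of y V 1 0])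
      have y1: "y 1 = 0" using y' by (simp add: free_iff)
      have "y \<in> free V ([1] @ [0])" by (rule free_append_left[OF y'])
      moreover have "y 0 * var x \<in> polys V" by (intro polys_mult free_polys[OF y'] var_polys x)
      ultimately have "y \<in> N"
        using y y1 unfolding N_iff J_def sqfree_ideal_embed sqfree_ideal_iff[of y]
        by (auto simp: var_supp_mult supp_single_add supp_Suc_single_add)
      moreover have "tail (length [1 :: int]) y = 0" by (rule tail_eq_0_left[OF y'])
      ultimately show "y \<in> {y \<in> N. tail (length [1 :: int]) y = 0}" by simp
    qed
    show "tail (length [1 :: int]) ` N = sqfree_ideal V (\<lambda>S. Q S \<or> x \<in> S)"
    proof (intro subset_antisym subsetI)
      fix z assume "z \<in> tail (length [1 :: int]) ` N"
      then obtain y where y: "y \<in> N" "z = tail 1 y" by auto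
      have z: "z \<in> free V [0]" using y tail_free[of y V "[1]" "[0]"] N_iff by simp
      have z0: "z 0 = (y 0 * var x + y 1) - y 0 * var x" using y(2) by (simp add: tail_def)
      have "Q (supp m) \<or> x \<in> supp m" if "m \<in> supp (z 0)" for m
      proof -
        have "m \<in> supp (y 0 * var x + y 1) \<union> supp (y 0 * var x)"
          using that unfolding z0 by (rule subsetD[OF supp_diff_subset])
        then show ?thesis
          using y(1) by (auto simp: N_iff J_def sqfree_ideal_embed var_supp_mult supp_single_add supp_Suc_single_add)
      qed
      then show "z \<in> sqfree_ideal V (\<lambda>S. Q S \<or> x \<in> S)" using z by (simp add: sqfree_ideal_iff)
    next
      fix z :: "('a, 'k) vec" assume z: "z \<in> sqfree_ideal V (\<lambda>S. Q S \<or> x \<in> S)"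
      then have z': "z \<in> free V [0]" by (simp add: sqfree_ideal_iff)
      obtain q where q: "q \<in> polys V"
          "\<And>m. m \<in> supp (z 0 - q * var x) \<Longrightarrow> m \<in> supp (z 0) \<and> x \<notin> supp m"
        using division_by_var[OF free_polys[OF z']] by blast
      let ?y = "join 1 (embed (- q)) z"
      have "?y \<in> free V ([1] @ [0])"
        using join_free[OF embed_free[OF polys_uminus[OF q(1)], of 1] z'] by simp
      moreover have "?y 0 * var x + ?y 1 = z 0 - q * var x" by (simp add: join_def)
      moreover have "z 0 - q * var x \<in> polys V"
        by (intro polys_diff polys_mult free_polys[OF z'] q(1) var_polys x)
      ultimately have "?y \<in> N"
        using q(2) z unfolding N_iff J_def sqfree_ideal_embed by (auto simp: sqfree_ideal_iff)
      then show "z \<in> tail (length [1 :: int]) ` N" by (intro image_eqI[of _ _ ?y]) simp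
    qed
  qed auto
  then have NL: "fin_res V (max L1 L2) [1, 0] N (s + 1)" by simp
  have "equiv_presentation V [1, 0] N [0] J"
    unfolding equiv_presentation_def
  proof (intro exI conjI ballI)
    show "columns V [0] [1, 0] \<alpha>" "columns V [1, 0] [0] \<beta>" by (fact \<alpha>, fact \<beta>)
    fix y assume "y \<in> N"
    then show "lin (length [1, 0 :: int]) \<alpha> y \<in> J" by (simp only: N_def mem_Collect_eq)
  next
    fix y assume y: "y \<in> J"
    then have y': "y \<in> free V [0]" using graded_submoduleD(1)[OF J] by auto
    show "lin (length [0 :: int]) \<beta> y \<in> N"
      using lin_free[OF \<beta> y'] lin\<alpha>\<beta>[OF y'] y by (simp add: N_def numeral_2_eq_2)
  next
    fix y :: "('a, 'k) vec" assume y: "y \<in> free V [1, 0]"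
    let ?z = "lin (length [0 :: int]) \<beta> (lin (length [1, 0 :: int]) \<alpha> y)"
    have "lin 2 \<alpha> (?z - y) = 0"
      using lin\<alpha>\<beta>[OF lin_free[OF \<alpha> y]] by (simp add: lin_diff numeral_2_eq_2)
    then show "?z - y \<in> N"
      using graded_submoduleD(2)[OF J] lin_free[OF \<beta> lin_free[OF \<alpha> y]] y
      by (simp add: N_def free_diff numeral_2_eq_2)
  next
    fix y :: "('a, 'k) vec" assume y: "y \<in> free V [0]"
    show "lin (length [1, 0 :: int]) \<alpha> (lin (length [0 :: int]) \<beta> y) - y \<in> J"
      using lin\<alpha>\<beta>[OF y] graded_submoduleD(2)[OF J] by (simp add: numeral_2_eq_2)
  qed
  then have "fin_res V (Suc (Suc (max L1 L2))) [0] J (s + 1)"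
    by (rule fin_res_equiv_presentation[OF NL N J]) (use s in auto)
  then show ?thesis unfolding reg_le_def J_def by blast
qed

text \<open>Ideals generated by variables have regularity 0. Adjoining a variable \<open>x\<close> extends the list of
  generators by \<open>x\<close>, and the new relations are controlled by \<open>J : x = J\<close>.\<close>

lemma reg_le_vars:
  fixes K :: "'k::field itself"
  assumes "finite W" "W \<subseteq> V" shows "reg_le K V (\<lambda>S. S \<inter> W \<noteq> {}) 0"
  using assms
proof (induction W)
  case empty
  have "sqfree_ideal V (\<lambda>S. S \<inter> {} \<noteq> {}) = ({0} :: ('a, 'k) vec set)"
  proof (intro subset_antisym subsetI)
    fix x :: "('a, 'k) vec" assume x: "x \<in> sqfree_ideal V (\<lambda>S. S \<inter> {} \<noteq> {})"
    then have "x 0 = 0" by (auto simp: sqfree_ideal_iff in_keys_iff intro!: poly_mapping_eqI)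
    then have "x = 0" using x unfolding sqfree_ideal_iff free_rank1_iff by (auto simp: embed_def fun_eq_iff)
    then show "x \<in> {0}" by simp
  qed (auto simp: sqfree_ideal_iff)
  then have "fin_res V 0 [0] (sqfree_ideal V (\<lambda>S. S \<inter> {} \<noteq> {}) :: ('a, 'k) vec set) (0 + 1)" by simp
  then show ?case unfolding reg_le_def by blast
next
  case (insert x W)
  let ?Q = "\<lambda>S. S \<inter> W \<noteq> {}"
  have Q: "mono ?Q" by (auto simp: mono_def)
  define J :: "('a, 'k) vec set" where "J = sqfree_ideal V ?Q"
  have J: "graded_submodule V [0] J" unfolding J_def by (rule graded_submodule_sqfree_ideal[OF Q])
  have x: "x \<in> V" using insert.prems by simp
  obtain L where L: "fin_res V L [0] J 1"
    using insert.IH insert.prems unfolding reg_le_def J_def by auto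
  obtain e c where C: "columns V [0] e c" "\<And>d. d \<in> set e \<Longrightarrow> d \<le> 1" "lin (length e) c ` free V e = J"
    "fin_res V L e (lker V e c) (1 + 1)"
    using fin_res_Suc[OF L] by (rule fin_resE) blast
  let ?e = "length e"
  define b where "b = (\<lambda>l. if l < ?e then c l else (\<lambda>_. embed (var x)) (l - ?e))"
  have b: "columns V [0] (e @ [1]) b"
    unfolding b_def using var_homogeneous[OF x]
    by (intro columns_append[OF C(1)]) (auto simp: columns_def intro: embed_grade)
  have lin_b: "lin (length (e @ [1])) b y = lin ?e c y + embed (tail ?e y 0 * var x)" for y
    using lin_append[of ?e 1 c "\<lambda>_. embed (var x)" y]
    by (simp add: b_def lin_singleton scale_embed)
  have head: "lin ?e c y \<in> J" if "y \<in> free V (e @ [1])" for y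
  proof -
    have "lin ?e c y = lin ?e c (join ?e y 0)" by simp
    then show ?thesis using C(3) free_append_head[OF that] by blast
  qed
  have times_x: "embed (z 0 * var x) \<in> J \<longleftrightarrow> z \<in> J" if "z \<in> free V [1]" for z
  proof -
    have "z 0 * var x \<in> polys V" by (intro polys_mult free_polys[OF that] var_polys x)
    then show ?thesis
      using insert.hyps(2) that
      by (auto simp: free_rank1_cong[of z V 1 0] J_def sqfree_ideal_embed sqfree_ideal_iff[of z] var_supp_mult supp_single_add supp_Suc_single_add)
  qed
  have "fin_res V (Suc L) [0] (sqfree_ideal V (\<lambda>S. S \<inter> insert x W \<noteq> {}) :: ('a, 'k) vec set) 1"
  proof (rule fin_resI[OF b])
    show "\<And>d. d \<in> set (e @ [1]) \<Longrightarrow> d \<le> 1" using C(2) by auto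
    show "lin (length (e @ [1])) b ` free V (e @ [1]) = sqfree_ideal V (\<lambda>S. S \<inter> insert x W \<noteq> {})"
    proof (intro subset_antisym subsetI)
      fix y assume "y \<in> lin (length (e @ [1])) b ` free V (e @ [1])"
      then obtain w where w: "w \<in> free V (e @ [1])" "y = lin ?e c w + embed (tail ?e w 0 * var x)"
        using lin_b by auto
      let ?J = "sqfree_ideal V (\<lambda>S. S \<inter> insert x W \<noteq> {}) :: ('a, 'k) vec set"
      have "lin ?e c w \<in> ?J" using head[OF w(1)] by (auto simp: J_def sqfree_ideal_iff)
      moreover have "embed (tail ?e w 0 * var x) \<in> ?J"
        using polys_mult[OF free_polys[OF tail_free[OF w(1)]] var_polys[OF x]]
        by (auto simp: sqfree_ideal_embed var_supp_mult supp_single_add supp_Suc_single_add)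
      moreover have "graded_submodule V [0] ?J"
        by (rule graded_submodule_sqfree_ideal) (auto simp: mono_def)
      ultimately show "y \<in> ?J" unfolding w(2) by (blast intro: graded_submoduleD(3))
    next
      fix y :: "('a, 'k) vec" assume y: "y \<in> sqfree_ideal V (\<lambda>S. S \<inter> insert x W \<noteq> {})"
      then have y': "y \<in> free V [0]" by (simp add: sqfree_ideal_iff)
      obtain q where q: "q \<in> polys V"
          "\<And>m. m \<in> supp (y 0 - q * var x) \<Longrightarrow> m \<in> supp (y 0) \<and> x \<notin> supp m"
        using division_by_var[OF free_polys[OF y']] by blast
      have "y 0 - q * var x \<in> polys V"
        by (intro polys_diff polys_mult free_polys[OF y'] q(1) var_polys x)
      moreover have "supp m \<inter> W \<noteq> {}" if "m \<in> supp (y 0 - q * var x)" for m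
        using q(2)[OF that] y by (auto simp: sqfree_ideal_iff)
      ultimately have "embed (y 0 - q * var x) \<in> J"
        by (simp add: J_def sqfree_ideal_embed)
      then obtain w where w: "w \<in> free V e" "embed (y 0 - q * var x) = lin ?e c w" using C(3) by blast
      have "lin (length (e @ [1])) b (join ?e w (embed q)) = embed (y 0 - q * var x) + embed (q * var x)"
        unfolding lin_b by (simp add: w(2))
      also have "\<dots> = y" using y' by (simp add: embed_add free_rank1_iff)
      finally show "y \<in> lin (length (e @ [1])) b ` free V (e @ [1])"
        using join_free[OF w(1) embed_free[OF q(1), of 1]] by (rule image_eqI[OF sym])
    qed
    have "fin_res V L [1] J 2" using fin_res_shift[OF L, of 1] by simp
    then show "fin_res V L (e @ [1]) (lker V (e @ [1]) b) (1 + 1)"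
    proof (intro fin_res_horseshoe[OF C(4) _ graded_submodule_lker[OF b]])
      show "{y \<in> lker V (e @ [1]) b. tail ?e y = 0} = lker V e c"
      proof (intro subset_antisym subsetI)
        fix y assume "y \<in> {y \<in> lker V (e @ [1]) b. tail ?e y = 0}"
        then have y: "y \<in> free V (e @ [1])" "tail ?e y = 0" "lin (length (e @ [1])) b y = 0" by auto
        have "embed (0 :: ('a, 'k) mpoly) = 0" by (simp add: embed_def fun_eq_iff)
        then have "lin ?e c y = 0" using y(2,3) unfolding lin_b by simp
        then show "y \<in> lker V e c" using free_append_tail_0[OF y(1,2)] by simp
      next
        fix y assume "y \<in> lker V e c"
        then have y: "y \<in> free V e" "lin ?e c y = 0" by auto
        have "embed (0 :: ('a, 'k) mpoly) = 0" by (simp add: embed_def fun_eq_iff)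
        then have "lin (length (e @ [1])) b y = 0" unfolding lin_b using y by (simp add: tail_eq_0_left)
        then show "y \<in> {y \<in> lker V (e @ [1]) b. tail ?e y = 0}"
          using free_append_left[OF y(1)] tail_eq_0_left[OF y(1)] by simp
      qed
      show "tail ?e ` lker V (e @ [1]) b = J"
      proof (intro subset_antisym subsetI)
        fix z assume "z \<in> tail ?e ` lker V (e @ [1]) b"
        then obtain y where y: "y \<in> free V (e @ [1])" "z = tail ?e y"
            "lin ?e c y + embed (z 0 * var x) = 0" using lin_b by auto
        have "embed (z 0 * var x) = - lin ?e c y" using y(3) by (simp add: add_eq_0_iff2 add_eq_0_iff)
        then have "embed (z 0 * var x) \<in> J" using graded_submoduleD(6)[OF J head[OF y(1)]] by simp
        then show "z \<in> J" using times_x[of z] tail_free[OF y(1)] y(2) by simp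
      next
        fix z assume z: "z \<in> J"
        then have z': "z \<in> free V [1]"
          by (auto simp: J_def sqfree_ideal_iff free_rank1_cong[of z V 1 0])
        have "embed (z 0 * var x) \<in> J" using times_x[OF z'] z by simp
        then obtain w where w: "w \<in> free V e" "embed (z 0 * var x) = lin ?e c w" using C(3) by blast
        have "lin (length (e @ [1])) b (join ?e (- w) z) = 0"
          unfolding lin_b lin_join tail_join w(2) lin_uminus by simp
        moreover have "join ?e (- w) z \<in> free V (e @ [1])" by (rule join_free[OF free_uminus[OF w(1)] z'])
        ultimately have "join ?e (- w) z \<in> lker V (e @ [1]) b" by simp
        then show "z \<in> tail ?e ` lker V (e @ [1]) b" by (rule image_eqI[rotated]) simp
      qed
    qed simp
  qed
  then show ?case unfolding reg_le_def add_0_left by (rule exI)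
qed


section \<open>Regularity of edge ideals: the upper bound\<close>

text \<open>The supports of the monomials in the ideal generated by the variables in \<open>W\<close> and the edges
  in \<open>E\<close>.\<close>

definition edge_cond :: "'v set set \<Rightarrow> 'v set \<Rightarrow> 'v set \<Rightarrow> bool" where
  "edge_cond E W S \<longleftrightarrow> S \<inter> W \<noteq> {} \<or> (\<exists>e\<in>E. e \<subseteq> S)"

lemma mono_edge_cond: "mono (edge_cond E W)"
  unfolding mono_def edge_cond_def le_bool_def by blast

text \<open>Deleting a vertex \<open>x\<close> or its closed neighbourhood. In \<open>J : x\<close> the neighbours of \<open>x\<close> become
  generators, so that the edges at \<open>x\<close> are redundant.\<close>

lemma reg_le_delete_vertex:
  assumes E: "\<forall>e\<in>E. card e = 2" and x: "x \<in> V" "x \<notin> W" and s: "0 \<le> s"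
    and nbhd: "reg_le K V (edge_cond E (W \<union> {y. {x, y} \<in> E})) (s - 1)"
    and del: "reg_le K V (edge_cond E (insert x W)) s"
  shows "reg_le K V (edge_cond E W) s"
proof (rule reg_le_colon[OF mono_edge_cond x(1) s])
  have "edge_cond E W (insert x S) = edge_cond E (W \<union> {y. {x, y} \<in> E}) S" for S
  proof
    assume "edge_cond E W (insert x S)"
    then consider "S \<inter> W \<noteq> {}" | e where "e \<in> E" "e \<subseteq> insert x S"
      using x(2) by (auto simp: edge_cond_def)
    then show "edge_cond E (W \<union> {y. {x, y} \<in> E}) S"
    proof cases
      case 1 then show ?thesis by (auto simp: edge_cond_def)
    next
      case 2
      show ?thesis
      proof (cases "x \<in> e")
        case True
        then obtain y where "e = {x, y}" "y \<noteq> x"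
          using E 2(1) by (metis card_2_iff doubleton_eq_iff insertE singletonD)
        then show ?thesis using 2 by (auto simp: edge_cond_def)
      next
        case False
        then show ?thesis using 2 by (auto simp: edge_cond_def)
      qed
    qed
  qed (auto simp: edge_cond_def)
  then have "(\<lambda>S. edge_cond E W (insert x S)) = edge_cond E (W \<union> {y. {x, y} \<in> E})" by (rule ext)
  then show "reg_le K V (\<lambda>S. edge_cond E W (insert x S)) (s - 1)" using nbhd by simp
  have "(\<lambda>S. edge_cond E W S \<or> x \<in> S) = edge_cond E (insert x W)"
    by (auto simp: edge_cond_def fun_eq_iff)
  then show "reg_le K V (\<lambda>S. edge_cond E W S \<or> x \<in> S) s" using del by simp
qed

text \<open>If the vertices \<open>h (a + 1), \<dots>, h (a + m)\<close> form a path and cover all edges outside \<open>W\<close>, then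
  deleting the end of the path leaves a path with \<open>m - 1\<close> vertices, while deleting its closed
  neighbourhood leaves one with \<open>m - 2\<close>.\<close>

lemma reg_le_path_cover:
  assumes V: "finite V" and E: "\<forall>e\<in>E. card e = 2" "\<forall>e\<in>E. e \<subseteq> V" and h: "\<And>i. a < i \<Longrightarrow> i \<le> a + m \<Longrightarrow> h i \<in> V"
    and path: "\<And>i. a < i \<Longrightarrow> i < a + m \<Longrightarrow> {h i, h (Suc i)} \<in> E"
    and W: "W \<subseteq> V"
    and cover: "\<And>e. e \<in> E \<Longrightarrow> e \<inter> W = {} \<Longrightarrow> \<exists>i. a < i \<and> i \<le> a + m \<and> h i \<in> e"
  shows "reg_le K V (edge_cond E W) (int ((m + 1) div 2))"
  using h path W cover
proof (induction m arbitrary: W rule: less_induct)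
  case (less m)
  show ?case
  proof (cases "m = 0")
    case True
    have "e \<inter> W \<noteq> {}" if "e \<in> E" for e
    proof
      assume "e \<inter> W = {}"
      from less.prems(4)[OF that this] obtain i where "a < i" "i \<le> a + m" by blast
      then show False using True by simp
    qed
    then have "edge_cond E W S \<longleftrightarrow> S \<inter> W \<noteq> {}" for S
      unfolding edge_cond_def by (metis Int_mono order_refl subset_empty)
    then have "edge_cond E W = (\<lambda>S. S \<inter> W \<noteq> {})" by (rule ext)
    then show ?thesis
      using reg_le_vars[OF finite_subset[OF less.prems(3) V] less.prems(3)] True by simp
  next
    case m: False
    define x where "x = h (a + m)"
    have x: "x \<in> V" using less.prems(1)[of "a + m"] m by (simp add: x_def)
    have shorter: "reg_le K V (edge_cond E U) (int ((k + 1) div 2))"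
      if "k < m" "U \<subseteq> V" "\<And>e. e \<in> E \<Longrightarrow> e \<inter> U = {} \<Longrightarrow> \<exists>i. a < i \<and> i \<le> a + k \<and> h i \<in> e" for k U
      by (rule less.IH[OF that(1) _ _ that(2,3)]) (use less.prems(1,2) that(1) in auto)
    have drop_last: "\<exists>i. a < i \<and> i \<le> a + (m - 1) \<and> h i \<in> e" if e: "e \<in> E" "e \<inter> insert x W = {}" for e
    proof -
      obtain i where i: "a < i" "i \<le> a + m" "h i \<in> e" using less.prems(4)[of e] e by auto
      moreover have "i \<noteq> a + m" using i(3) e(2) by (auto simp: x_def)
      ultimately show ?thesis by (intro exI[of _ i]) auto
    qed
    have del: "reg_le K V (edge_cond E (insert x W)) (int ((m + 1) div 2))"
      by (rule reg_le_mono[OF shorter[of "m - 1"]]) (use m x less.prems(3) drop_last in \<open>auto intro: div_le_mono\<close>)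
    show ?thesis
    proof (cases "x \<in> W")
      case True
      then show ?thesis using del by (simp add: insert_absorb)
    next
      case False
      let ?W = "W \<union> {y. {x, y} \<in> E}"
      show ?thesis
      proof (rule reg_le_delete_vertex[OF E(1) x False _ _ del])
        have "\<exists>i. a < i \<and> i \<le> a + (m - 2) \<and> h i \<in> e" if e: "e \<in> E" "e \<inter> ?W = {}" for e
        proof -
          have xe: "x \<notin> e"
          proof
            assume "x \<in> e"
            then obtain y where "e = {x, y}"
              using E(1) e(1) by (metis card_2_iff doubleton_eq_iff insertE singletonD)
            then show False using e by auto
          qed
          then obtain i where i: "a < i" "i \<le> a + (m - 1)" "h i \<in> e" using drop_last[of e] e by auto
          moreover have "i \<noteq> a + (m - 1)"
          proof
            assume eq: "i = a + (m - 1)"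
            then have "{h i, h (Suc i)} \<in> E" "h (Suc i) = x" using less.prems(2)[of i] i m by (auto simp: x_def)
            then have "h i \<in> ?W" by (simp add: insert_commute)
            then show False using i(3) e(2) by blast
          qed
          ultimately show ?thesis by (intro exI[of _ i]) auto
        qed
        then have "reg_le K V (edge_cond E ?W) (int (((m - 2) + 1) div 2))"
          by (intro shorter) (use m less.prems(3) E(2) in auto)
        then show "reg_le K V (edge_cond E ?W) (int ((m + 1) div 2) - 1)"
        proof (rule reg_le_mono)
          have "(m - 2 + 1) div 2 + 1 \<le> (m + 1) div 2" using m by arith
          then show "int ((m - 2 + 1) div 2) \<le> int ((m + 1) div 2) - 1" by linarith
        qed
      qed simp
    qed
  qed
qed

lemma edge_ouroborosE:
  assumes "e \<in> snd (ouroboros n p)"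
  obtains i where "i \<in> {1..n}" "e = {X i, X (cyc_succ n i)}"
  | i j where "i \<in> {1..n}" "j \<in> {1..p}" "e = {X i, Y i j}"
  | i j where "i \<in> {1..n}" "j \<in> {1..p}" "e = {X (cyc_succ n i), Y i j}"
  using assms unfolding ouroboros_def by (simp only: snd_conv Un_iff mem_Collect_eq) blast

lemma cyc_succ_mem: "i \<in> {1..n} \<Longrightarrow> cyc_succ n i \<in> {1..n}"
  by (auto simp: cyc_succ_def)

lemma cycle_edge_ouroboros: "i \<in> {1..n} \<Longrightarrow> {X i, X (cyc_succ n i)} \<in> snd (ouroboros n p)"
  unfolding ouroboros_def snd_conv by blast

text \<open>The vertices \<open>X 1, \<dots>, X n\<close> cover all edges. Deleting \<open>X n\<close> opens the cycle to a path on \<open>n - 1\<close> of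
  them, and deleting its closed neighbourhood leaves a path on \<open>n - 3\<close>. Both branches of the deletion
  step give exactly \<open>n div 2\<close>.\<close>

lemma reg_le_ouroboros:
  assumes n: "n \<ge> 3"
  shows "reg_le K (fst (ouroboros n p)) (edge_cond (snd (ouroboros n p)) {}) (int (n div 2))"
proof -
  let ?V = "fst (ouroboros n p)" and ?E = "snd (ouroboros n p)"
  have V: "finite ?V" and E: "\<forall>e\<in>?E. card e = 2" "\<forall>e\<in>?E. e \<subseteq> ?V"
    using finite_simple_graph_ouroboros[OF n, of p] by (auto simp: finite_simple_graph_def)
  have XV: "X i \<in> ?V" if "0 < i" "i \<le> n" for i using that by (auto simp: ouroboros_def)
  have path: "{X i, X (Suc i)} \<in> ?E" if "0 < i" "i < n" for i
    using cycle_edge_ouroboros[of i n p] that by (simp add: cyc_succ_def)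
  have hub: "\<exists>i. 1 \<le> i \<and> i \<le> n \<and> X i \<in> e" if "e \<in> ?E" for e
    using that by (rule edge_ouroborosE) (use cyc_succ_mem in fastforce)+
  show ?thesis
  proof (rule reg_le_delete_vertex[OF E(1) XV[of n]])
    have "\<exists>i. 0 < i \<and> i \<le> 0 + (n - 1) \<and> X i \<in> e" if e: "e \<in> ?E" "e \<inter> {X n} = {}" for e
    proof -
      obtain i where i: "1 \<le> i" "i \<le> n" "X i \<in> e" using hub[OF e(1)] by blast
      moreover have "i \<noteq> n" using i(3) e(2) by auto
      ultimately show ?thesis by (intro exI[of _ i]) auto
    qed
    then have "reg_le K ?V (edge_cond ?E {X n}) (int ((n - 1 + 1) div 2))"
      by (intro reg_le_path_cover[OF V E, of 0 "n - 1" X]) (use XV path n in auto)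
    then show "reg_le K ?V (edge_cond ?E {X n}) (int (n div 2))" using n by simp
    let ?W = "{y. {X n, y} \<in> ?E}"
    have W: "?W \<subseteq> ?V" using E(2) by auto
    have "\<exists>i. 1 < i \<and> i \<le> 1 + (n - 3) \<and> X i \<in> e" if e: "e \<in> ?E" "e \<inter> ?W = {}" for e
    proof -
      obtain i where i: "1 \<le> i" "i \<le> n" "X i \<in> e" using hub[OF e(1)] by blast
      have "X n \<notin> e"
      proof
        assume "X n \<in> e"
        then obtain y where "e = {X n, y}"
          using E(1) e(1) by (metis card_2_iff doubleton_eq_iff insertE singletonD)
        then show False using e by auto
      qed
      moreover have "X 1 \<in> ?W" using cycle_edge_ouroboros[of n n p] n by (simp add: cyc_succ_def)
      moreover have "X (n - 1) \<in> ?W" using path[of "n - 1"] n by (simp add: insert_commute)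
      ultimately have "i \<noteq> n" "i \<noteq> 1" "i \<noteq> n - 1" using i(3) e(2) by blast+
      then show ?thesis using i n by (intro exI[of _ i]) auto
    qed
    then have "reg_le K ?V (edge_cond ?E ?W) (int ((n - 3 + 1) div 2))"
      by (intro reg_le_path_cover[OF V E, of 1 "n - 3" X]) (use XV path n W in auto)
    then show "reg_le K ?V (edge_cond ?E ({} \<union> ?W)) (int (n div 2) - 1)"
      unfolding Un_empty_left
    proof (rule reg_le_mono)
      have "(n - 3 + 1) div 2 + 1 \<le> n div 2" using n by arith
      then show "int ((n - 3 + 1) div 2) \<le> int (n div 2) - 1" by linarith
    qed
  qed (use n in auto)
qed


section \<open>Monomial ideals as generated ideals\<close>

lemma poly_ring_simps [simp]:
  "mult (poly_ring V) = (*)" "one (poly_ring V) = 1" "zero (poly_ring V) = 0" "add (poly_ring V) = (+)"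
  by (simp_all add: poly_ring_def)

lemma cring_poly_ring: "cring (poly_ring V :: ('v, 'k::field) mpoly ring)"
proof (rule cringI)
  show "abelian_group (poly_ring V :: ('v, 'k) mpoly ring)"
  proof (rule abelian_groupI)
    fix x :: "('v, 'k) mpoly" assume "x \<in> polys V"
    then show "\<exists>y\<in>polys V. y \<oplus>\<^bsub>poly_ring V\<^esub> x = \<zero>\<^bsub>poly_ring V\<^esub>"
      by (intro bexI[of _ "- x"]) (auto simp: polys_uminus)
  qed (auto simp: polys_add add_ac)
  show "Group.comm_monoid (poly_ring V :: ('v, 'k) mpoly ring)"
    by (rule Group.comm_monoidI) (auto simp: polys_mult mult_ac)
qed (auto simp: distrib_right)

lemma ideal_poly_ringI:
  assumes "I \<subseteq> polys V" "0 \<in> I" "\<And>f g. f \<in> I \<Longrightarrow> g \<in> I \<Longrightarrow> f + g \<in> I"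
    "\<And>f g. f \<in> I \<Longrightarrow> g \<in> polys V \<Longrightarrow> g * f \<in> I"
  shows "ideal I (poly_ring V :: ('v, 'k::field) mpoly ring)"
proof -
  interpret cring "poly_ring V :: ('v, 'k) mpoly ring" by (rule cring_poly_ring)
  show ?thesis
  proof (rule idealI)
    show "ring (poly_ring V :: ('v, 'k) mpoly ring)" by (rule ring_axioms)
    show "subgroup I (add_monoid (poly_ring V))"
    proof (rule add.subgroupI)
      fix f assume f: "f \<in> I"
      have "f \<in> polys V" using assms(1) f by auto
      then have "\<ominus>\<^bsub>poly_ring V\<^esub> f = - f"
        by (intro minus_equality) (auto simp: polys_uminus)
      then show "\<ominus>\<^bsub>poly_ring V\<^esub> f \<in> I"
        using assms(4)[OF f polys_uminus[OF polys_1]] by simp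
    qed (use assms in auto)
  qed (use assms in \<open>auto simp: mult.commute\<close>)
qed

text \<open>Membership in an ideal generated by monomials is decided term by term: the polynomials all of
  whose monomials are divisible by a generator form an ideal.\<close>

lemma monomial_ideal:
  assumes A: "\<And>a. a \<in> A \<Longrightarrow> supp a \<subseteq> V"
  shows "Idl\<^bsub>poly_ring V\<^esub> ((\<lambda>a. Poly_Mapping.single a (1 :: 'k::field)) ` A) =
         {f \<in> polys V. \<forall>m\<in>supp f. \<exists>a\<in>A. \<exists>b. m = a + b}" (is "?I = ?M")
proof (intro subset_antisym)
  interpret cring "poly_ring V :: ('a, 'k) mpoly ring" by (rule cring_poly_ring)
  have M: "ideal ?M (poly_ring V)"
  proof (rule ideal_poly_ringI)
    fix f g :: "('a, 'k) mpoly" assume "f \<in> ?M" "g \<in> ?M"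
    then show "f + g \<in> ?M" using keys_add[of f g] by (auto simp: polys_add)
  next
    fix f g :: "('a, 'k) mpoly" assume f: "f \<in> ?M" and g: "g \<in> polys V"
    have "\<exists>a\<in>A. \<exists>b. m = a + b" if m: "m \<in> supp (g * f)" for m
    proof -
      obtain u v where uv: "m = u + v" "v \<in> supp f" using m by (rule supp_mult_cases)
      then obtain a b where "a \<in> A" "v = a + b" using f by auto
      then show ?thesis using uv(1) by (intro bexI[of _ a] exI[of _ "u + b"]) (simp_all add: add_ac)
    qed
    then show "g * f \<in> ?M" using f g by (auto simp: polys_mult)
  qed auto
  show "?I \<subseteq> ?M"
  proof (rule genideal_minimal[OF M], safe)
    fix a assume a: "a \<in> A"
    then show "Poly_Mapping.single a 1 \<in> polys V" using A by simp
    fix m assume "m \<in> supp (Poly_Mapping.single a (1 :: 'k))"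
    then have "m = a + 0" by simp
    then show "\<exists>a\<in>A. \<exists>b. m = a + b" using a by blast
  qed
  have "(\<lambda>a. Poly_Mapping.single a (1 :: 'k)) ` A \<subseteq> polys V" using A by auto
  then have id: "ideal ?I (poly_ring V)" and gen: "\<And>a. a \<in> A \<Longrightarrow> Poly_Mapping.single a 1 \<in> ?I"
    using genideal_ideal genideal_self by blast+
  interpret I: ideal ?I "poly_ring V" by (rule id)
  show "?M \<subseteq> ?I"
  proof
    fix f assume f: "f \<in> ?M"
    have "Poly_Mapping.single m (coeff f m) \<in> ?I" if m: "m \<in> supp f" for m
    proof -
      obtain a b where ab: "a \<in> A" "m = a + b" using f m by auto
      have "supp m \<subseteq> V" using f m by (simp add: polys_iff)
      then have "supp b \<subseteq> V" by (simp add: ab(2) supp_monom_add)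
      then have "Poly_Mapping.single b (coeff f m) * Poly_Mapping.single a 1 \<in> ?I"
        using I.I_l_closed[OF gen[OF ab(1)], of "Poly_Mapping.single b (coeff f m)"] by simp
      then show ?thesis by (simp add: mult_single ab(2) add.commute)
    qed
    moreover have "(\<Sum>m\<in>B. Poly_Mapping.single m (coeff f m)) \<in> ?I"
      if "finite B" "B \<subseteq> supp f" "\<And>m. m \<in> supp f \<Longrightarrow> Poly_Mapping.single m (coeff f m) \<in> ?I" for B
      using that(1,2)
    proof (induction B)
      case empty
      then show ?case using I.zero_closed by simp
    next
      case (insert m B)
      then show ?case using I.a_closed[of "Poly_Mapping.single m (coeff f m)"] that(3) by simp
    qed
    ultimately have "(\<Sum>m\<in>supp f. Poly_Mapping.single m (coeff f m)) \<in> ?I" by simp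
    moreover have "(\<Sum>m\<in>supp f. Poly_Mapping.single m (coeff f m)) = f"
      by (rule poly_mapping_eqI) (auto simp: lookup_sum lookup_single when_def in_keys_iff)
    ultimately show "f \<in> ?I" by simp
  qed
qed

lemma monom_dvd_pair:
  fixes m :: "'v \<Rightarrow>\<^sub>0 nat"
  assumes "u \<noteq> v"
  shows "(\<exists>b. m = Poly_Mapping.single u 1 + Poly_Mapping.single v 1 + b) \<longleftrightarrow> {u, v} \<subseteq> supp m"
proof
  assume uv: "{u, v} \<subseteq> supp m"
  then obtain b where b: "m = Poly_Mapping.single u 1 + b" using monom_split[of u m] by auto
  then have "v \<in> supp b" using uv assms by (auto simp: supp_single_add supp_Suc_single_add)
  then show "\<exists>b. m = Poly_Mapping.single u 1 + Poly_Mapping.single v 1 + b"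
    using b monom_split[of v b] by (auto simp: add.assoc)
qed (auto simp: supp_monom_add)

lemma edge_ideal_iff:
  assumes "finite_simple_graph G"
  shows "f \<in> (edge_ideal G :: ('v, 'k::field) mpoly set) \<longleftrightarrow>
           f \<in> polys (fst G) \<and> (\<forall>m\<in>supp f. edge_cond (snd G) {} (supp m))"
proof -
  define A :: "('v \<Rightarrow>\<^sub>0 nat) set"
    where "A = {Poly_Mapping.single u 1 + Poly_Mapping.single v 1 | u v. {u, v} \<in> snd G}"
  have E: "u \<noteq> v \<and> {u, v} \<subseteq> fst G" if "{u, v} \<in> snd G" for u v
    using assms that by (force simp: finite_simple_graph_def)
  have "{var u * var v | u v. {u, v} \<in> snd G} = (\<lambda>a. Poly_Mapping.single a (1 :: 'k)) ` A"
    by (auto simp: A_def var_def mult_single)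
  then have "(edge_ideal G :: ('v, 'k) mpoly set) =
      {f \<in> polys (fst G). \<forall>m\<in>supp f. \<exists>a\<in>A. \<exists>b. m = a + b}"
    unfolding edge_ideal_def using E by (subst monomial_ideal[symmetric]) (auto simp: A_def supp_monom_add)
  moreover have "(\<exists>a\<in>A. \<exists>b. m = a + b) \<longleftrightarrow> edge_cond (snd G) {} (supp m)" for m
  proof
    assume "\<exists>a\<in>A. \<exists>b. m = a + b"
    then obtain u v b where "{u, v} \<in> snd G" "m = Poly_Mapping.single u 1 + Poly_Mapping.single v 1 + b"
      by (auto simp: A_def)
    then show "edge_cond (snd G) {} (supp m)"
      unfolding edge_cond_def by (intro disjI2 bexI[of _ "{u, v}"]) (auto simp: supp_monom_add)
  next
    assume "edge_cond (snd G) {} (supp m)"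
    then obtain e where e: "e \<in> snd G" "e \<subseteq> supp m" by (auto simp: edge_cond_def)
    obtain u v where uv: "e = {u, v}" "u \<noteq> v"
      using assms e(1) by (metis card_2_iff finite_simple_graph_def)
    then obtain b where "m = Poly_Mapping.single u 1 + Poly_Mapping.single v 1 + b"
      using monom_dvd_pair[of u v m] e(2) by blast
    then show "\<exists>a\<in>A. \<exists>b. m = a + b" using e(1) uv(1) unfolding A_def by blast
  qed
  ultimately show ?thesis by simp
qed

lemma sqfree_ideal_edge_ideal:
  assumes "finite_simple_graph G"
  shows "x \<in> sqfree_ideal (fst G) (edge_cond (snd G) {}) \<longleftrightarrow>
           x \<in> free (fst G) [0] \<and> x 0 \<in> (edge_ideal G :: ('v, 'k::field) mpoly set)"
  using edge_ideal_iff[OF assms] free_polys by (auto simp: sqfree_ideal_iff)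

lemma supp_eq_empty: "supp m = {} \<Longrightarrow> m = (0 :: 'v \<Rightarrow>\<^sub>0 nat)"
  by (rule poly_mapping_eqI) (auto simp: in_keys_iff)

lemma single_one_neq_0: "Poly_Mapping.single v (Suc 0) = 0 \<Longrightarrow> False"
  by (metis lookup_single_eq lookup_zero nat.distinct(1))

lemma irrelevant_ideal_iff:
  "f \<in> (irrelevant_ideal V :: ('v, 'k::field) mpoly set) \<longleftrightarrow> f \<in> polys V \<and> coeff f 0 = 0"
proof -
  define A :: "('v \<Rightarrow>\<^sub>0 nat) set" where "A = (\<lambda>v. Poly_Mapping.single v 1) ` V"
  have "var ` V = (\<lambda>a. Poly_Mapping.single a (1 :: 'k)) ` A"
    by (auto simp: A_def var_def)
  then have I: "(irrelevant_ideal V :: ('v, 'k) mpoly set) =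
      {f \<in> polys V. \<forall>m\<in>supp f. \<exists>a\<in>A. \<exists>b. m = a + b}"
    unfolding irrelevant_ideal_def by (subst monomial_ideal[symmetric]) (auto simp: A_def)
  have "(\<exists>a\<in>A. \<exists>b. m = a + b) \<longleftrightarrow> m \<noteq> 0" if "supp m \<subseteq> V" for m
  proof
    assume "m \<noteq> 0"
    then obtain v where "v \<in> supp m" by (metis equals0I supp_eq_empty)
    then show "\<exists>a\<in>A. \<exists>b. m = a + b" using monom_split[of v m] that by (auto simp: A_def)
  next
    assume "\<exists>a\<in>A. \<exists>b. m = a + b"
    then show "m \<noteq> 0" unfolding A_def by (auto simp: monom_add_eq_0_iff dest: single_one_neq_0)
  qed
  then have "(\<forall>m\<in>supp f. \<exists>a\<in>A. \<exists>b. m = a + b) \<longleftrightarrow> coeff f 0 = 0" if "f \<in> polys V" for f :: "('v, 'k) mpoly"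
    using that unfolding polys_iff by (metis in_keys_iff)
  then show ?thesis unfolding I by auto
qed


section \<open>Resolutions as sequences of matrices\<close>

text \<open>A resolution of \<open>S/J\<close> is encoded by the matrices \<open>c i\<close> of its differentials and a matrix \<open>r\<close> that
  lifts the augmentation to \<open>S\<close>. Exactness then says that the image of \<open>c i\<close> is the \<open>i\<close>-th syzygy
  module \<open>syz i\<close>, the kernel of the map one step to the right.\<close>

primrec syz :: "'v set \<Rightarrow> ('v, 'k::field) vec set \<Rightarrow> (nat \<Rightarrow> int list) \<Rightarrow> (nat \<Rightarrow> nat \<Rightarrow> ('v, 'k) vec) \<Rightarrow>
    (nat \<Rightarrow> ('v, 'k) vec) \<Rightarrow> nat \<Rightarrow> ('v, 'k) vec set" where
  "syz V J ds c r 0 = {x \<in> free V (ds 0). lin (length (ds 0)) r x \<in> J}"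
| "syz V J ds c r (Suc i) = lker V (ds (Suc i)) (c i)"

definition matrix_resolution :: "'v set \<Rightarrow> ('v, 'k::field) vec set \<Rightarrow> (nat \<Rightarrow> int list) \<Rightarrow>
    (nat \<Rightarrow> nat \<Rightarrow> ('v, 'k) vec) \<Rightarrow> (nat \<Rightarrow> ('v, 'k) vec) \<Rightarrow> bool" where
  "matrix_resolution V J ds c r \<longleftrightarrow>
     columns V [0] (ds 0) r \<and> (\<forall>i. columns V (ds i) (ds (Suc i)) (c i)) \<and>
     (\<forall>y\<in>free V [0]. \<exists>x\<in>free V (ds 0). lin (length (ds 0)) r x - y \<in> J) \<and>
     (\<forall>i. lin (length (ds (Suc i))) (c i) ` free V (ds (Suc i)) = syz V J ds c r i)"

definition minimal_submodule :: "int list \<Rightarrow> ('v, 'k::field) vec set \<Rightarrow> bool" where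
  "minimal_submodule ds N \<longleftrightarrow> (\<forall>x\<in>N. \<forall>k<length ds. coeff (x k) 0 = 0)"

lemma matrix_resolutionD:
  assumes "matrix_resolution V J ds c r"
  shows "columns V [0] (ds 0) r" "columns V (ds i) (ds (Suc i)) (c i)"
    "y \<in> free V [0] \<Longrightarrow> \<exists>x\<in>free V (ds 0). lin (length (ds 0)) r x - y \<in> J"
    "lin (length (ds (Suc i))) (c i) ` free V (ds (Suc i)) = syz V J ds c r i"
  using assms unfolding matrix_resolution_def by blast+

lemma graded_submodule_syz:
  assumes "matrix_resolution V J ds c r" "graded_submodule V [0] J"
  shows "graded_submodule V (ds i) (syz V J ds c r i)"
proof (cases i)
  case 0
  then show ?thesis
    using graded_submodule_preimage[OF matrix_resolutionD(1)[OF assms(1)] assms(2)] by simp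
next
  case (Suc j)
  then show ?thesis
    using graded_submodule_lker[OF matrix_resolutionD(2)[OF assms(1), of j]] by simp
qed

text \<open>The generator \<open>1\<close> of \<open>S/J\<close> lifts to a homogeneous vector \<open>w\<close> of degree 0, and \<open>r\<close> leads back.\<close>

lemma equiv_presentation_syz_0:
  fixes J :: "('v, 'k::field) vec set"
  assumes res: "matrix_resolution V J ds c r" and J: "graded_submodule V [0] J"
  shows "equiv_presentation V [0] J (ds 0) (syz V J ds c r 0)"
proof -
  let ?n = "length (ds 0)"
  note r = matrix_resolutionD(1)[OF res]
  obtain x where x: "x \<in> free V (ds 0)" "lin ?n r x - embed 1 \<in> J"
    using matrix_resolutionD(3)[OF res embed_free[OF polys_1]] by auto
  define w where "w = component (ds 0) 0 x"
  have w: "w \<in> free_grade V (ds 0) 0" unfolding w_def by (rule component_grade[OF x(1)])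
  have "component [0] 0 (lin ?n r x - embed 1) = lin ?n r w - embed 1"
  proof -
    have "component [0] 0 (embed (1 :: ('v, 'k) mpoly)) = embed 1"
      by (rule component_id[of _ V]) (simp add: embed_grade)
    moreover have "component [0] 0 (u - v) = component [0] 0 u - component [0] 0 v" for u v :: "('v, 'k) vec"
      by (auto simp: component_def fun_eq_iff hpart_def coeff_restrict lookup_minus intro!: poly_mapping_eqI)
    ultimately show ?thesis by (simp add: w_def lin_component[OF r])
  qed
  then have wJ: "lin ?n r w - embed 1 \<in> J" using graded_submoduleD(5)[OF J x(2), of 0] by simp
  define \<alpha> where "\<alpha> = (\<lambda>l :: nat. w)"
  have \<alpha>: "columns V (ds 0) [0] \<alpha>" using w by (simp add: columns_def \<alpha>_def)
  have r\<alpha>: "lin ?n r (lin (length [0 :: int]) \<alpha> y) - y \<in> J" if y: "y \<in> free V [0]" for y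
  proof -
    have "y = scale (y 0) (embed 1)" using y by (simp add: scale_embed free_rank1_iff)
    then have "lin ?n r (lin (length [0 :: int]) \<alpha> y) - y = scale (y 0) (lin ?n r w) - scale (y 0) (embed 1)"
      by (simp add: lin_singleton \<alpha>_def lin_scale)
    also have "\<dots> = scale (y 0) (lin ?n r w - embed 1)"
      by (simp add: scale_def fun_eq_iff right_diff_distrib)
    finally show ?thesis using graded_submoduleD(4)[OF J free_polys[OF y] wJ] by simp
  qed
  show ?thesis unfolding equiv_presentation_def
  proof (intro exI conjI ballI)
    show "columns V (ds 0) [0] \<alpha>" "columns V [0] (ds 0) r" by (fact \<alpha>, fact r)
    fix y assume y: "y \<in> J"
    then have y': "y \<in> free V [0]" using graded_submoduleD(1)[OF J] by auto
    have "lin ?n r (lin (length [0 :: int]) \<alpha> y) - y + y \<in> J"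
      by (rule graded_submoduleD(3)[OF J r\<alpha>[OF y'] y])
    then show "lin (length [0 :: int]) \<alpha> y \<in> syz V J ds c r 0"
      using lin_free[OF \<alpha> y'] by (simp only: syz.simps mem_Collect_eq diff_add_cancel)
  next
    fix y assume "y \<in> syz V J ds c r 0"
    then show "lin ?n r y \<in> J" by simp
  next
    fix y :: "('v, 'k) vec" assume "y \<in> free V [0]"
    then show "lin ?n r (lin (length [0 :: int]) \<alpha> y) - y \<in> J" by (rule r\<alpha>)
  next
    fix y :: "('v, 'k) vec" assume y: "y \<in> free V (ds 0)"
    have ry: "lin ?n r y \<in> free V [0]" by (rule lin_free[OF r y])
    show "lin (length [0 :: int]) \<alpha> (lin ?n r y) - y \<in> syz V J ds c r 0"
      using r\<alpha>[OF ry] free_diff[OF lin_free[OF \<alpha> ry] y] by (simp add: lin_diff)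
  qed
qed

text \<open>Step by step, Schanuel's lemma carries a finite resolution of \<open>J\<close> over to the syzygy modules of the
  minimal resolution, and Nakayama's lemma bounds the degrees of their minimal generators.\<close>

lemma minimal_resolution_upper:
  assumes res: "matrix_resolution V J ds c r" and J: "graded_submodule V [0] J"
    and min: "\<And>i. minimal_submodule (ds i) (syz V J ds c r i)"
    and fin: "fin_res V L [0] J (s + 1)" and s: "0 \<le> s"
  shows "d \<in> set (ds i) \<Longrightarrow> d \<le> s + int i"
proof -
  note syz = graded_submodule_syz[OF res J]
  have "(\<exists>L. fin_res V L (ds i) (syz V J ds c r i) (s + 1 + int i)) \<and> (\<forall>d\<in>set (ds i). d \<le> s + int i)"
  proof (induction i)
    case 0
    note eq = equiv_presentation_syz_0[OF res J]
    have "set (ds 0) \<subseteq> set [0]"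
      by (rule minimal_presentation_degrees[OF eq]) (use min[of 0] in \<open>simp only: minimal_submodule_def\<close>)
    then have d: "\<forall>d\<in>set (ds 0). d \<le> s" using s by auto
    moreover have "fin_res V (Suc (Suc L)) (ds 0) (syz V J ds c r 0) (s + 1)"
      by (rule fin_res_equiv_presentation[OF fin J syz eq]) (use d s in auto)
    ultimately show ?case unfolding of_nat_0 add_0_right by blast
  next
    case (Suc i)
    then obtain L where L: "fin_res V L (ds i) (syz V J ds c r i) (s + 1 + int i)" by blast
    obtain e a where e: "columns V (ds i) e a" "\<And>d. d \<in> set e \<Longrightarrow> d \<le> s + 1 + int i"
      "lin (length e) a ` free V e = syz V J ds c r i" "fin_res V L e (lker V e a) (s + 1 + int i + 1)"
      using fin_res_Suc[OF L] by (rule fin_resE) blast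
    have eq: "equiv_presentation V e (lker V e a) (ds (Suc i)) (syz V J ds c r (Suc i))"
      unfolding syz.simps
      by (rule equiv_presentation_lker[OF e(1) matrix_resolutionD(2)[OF res]])
         (unfold e(3), rule matrix_resolutionD(4)[OF res, symmetric])
    have "set (ds (Suc i)) \<subseteq> set e"
      by (rule minimal_presentation_degrees[OF eq]) (use min[of "Suc i"] in \<open>simp only: minimal_submodule_def\<close>)
    then have d: "\<forall>d\<in>set (ds (Suc i)). d \<le> s + 1 + int i" using e(2) by blast
    have "fin_res V (Suc (Suc L)) (ds (Suc i)) (syz V J ds c r (Suc i)) (s + 1 + int i + 1)"
      by (rule fin_res_equiv_presentation[OF e(4) graded_submodule_lker[OF e(1)] syz eq])
         (use d e(2) in \<open>fastforce+\<close>)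
    moreover have "s + 1 + int i + 1 = s + 1 + int (Suc i)" "s + 1 + int i = s + int (Suc i)" by auto
    ultimately show ?case using d by metis
  qed
  then show "d \<in> set (ds i) \<Longrightarrow> d \<le> s + int i" by blast
qed

text \<open>In a minimal resolution the columns of the matrices are nonzero and their nonzero entries have
  positive degree, so degrees increase at every step. Together with the upper bound, this leaves only
  finitely many values for the difference of degree and homological position of a generator.\<close>

lemma minimal_resolution_lower:
  assumes res: "matrix_resolution V J ds c r" and J: "graded_submodule V [0] J"
    and min: "\<And>i. minimal_submodule (ds i) (syz V J ds c r i)"
  shows "d \<in> set (ds i) \<Longrightarrow> int i \<le> d"
proof (induction i arbitrary: d)
  case 0
  have "set (ds 0) \<subseteq> set [0]"
    by (rule minimal_presentation_degrees[OF equiv_presentation_syz_0[OF res J]])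
       (use min[of 0] in \<open>simp only: minimal_submodule_def\<close>)
  then show ?case using 0 by auto
next
  case (Suc i)
  then obtain k where k: "k < length (ds (Suc i))" "ds (Suc i) ! k = d" by (auto simp: in_set_conv_nth)
  have "unit k \<notin> syz V J ds c r (Suc i)"
    using min[of "Suc i"] k(1) unfolding minimal_submodule_def by (force simp: unit_def)
  then have "c i k \<noteq> 0" using unit_free[OF k(1), of V] by (auto simp: lin_unit[OF k(1)])
  then obtain l where l: "c i k l \<noteq> 0" by (auto simp: fun_eq_iff)
  have ck: "c i k \<in> free_grade V (ds i) d"
    using matrix_resolutionD(2)[OF res, of i] k by (auto simp: columns_def)
  then have l': "l < length (ds i)" "c i k l \<in> homogeneous_part V (d - ds i ! l)"
    using l unfolding free_grade_iff by (meson not_less)+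
  have "lin (length (ds (Suc i))) (c i) (unit k) \<in> syz V J ds c r i"
    using unit_free[OF k(1), of V] matrix_resolutionD(4)[OF res, of i] by blast
  then have c0: "coeff (c i k l) 0 = 0"
    using min[of i] l'(1) by (simp add: lin_unit[OF k(1)] minimal_submodule_def)
  obtain m where m: "m \<in> supp (c i k l)" using l by (metis keys_zero poly_mapping_eqI equals0I in_keys_iff)
  then have "m \<noteq> 0" using c0 by (auto simp: in_keys_iff)
  then have "0 < monom_degree m" using monom_degree_eq_0_iff by (metis gr0I)
  then have "0 < d - ds i ! l" using l'(2) m by (auto simp: homogeneous_part_iff)
  moreover have "int i \<le> ds i ! l" using Suc.IH l'(1) by simp
  ultimately show ?case by simp
qed

definition skip :: "nat \<Rightarrow> nat \<Rightarrow> nat" where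
  "skip k l = (if l < k then l else Suc l)"

lemma sum_skip:
  fixes f :: "nat \<Rightarrow> 'a::comm_monoid_add"
  assumes "k \<le> n" shows "(\<Sum>l<Suc n. f l) = f k + (\<Sum>l<n. f (skip k l))"
proof -
  have "bij_betw (skip k) {..<n} ({..<Suc n} - {k})"
  proof (rule bij_betw_byWitness[where f' = "\<lambda>l. if l < k then l else l - 1"])
    show "skip k ` {..<n} \<subseteq> {..<Suc n} - {k}" by (auto simp: skip_def)
  qed (use assms in \<open>auto simp: skip_def\<close>)
  then have "(\<Sum>l<n. f (skip k l)) = sum f ({..<Suc n} - {k})"
    by (rule sum.reindex_bij_betw)
  moreover have "(\<Sum>l<Suc n. f l) = f k + sum f ({..<Suc n} - {k})"
    using assms by (intro sum.remove) auto
  ultimately show ?thesis by simp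
qed

text \<open>The component of degree \<open>e ! k\<close> of the relation \<open>u\<close> is again a relation, and its \<open>k\<close>-th coordinate
  is a nonzero constant. It expresses the \<open>k\<close>-th generator by the others.\<close>

lemma drop_redundant_generator:
  assumes c: "columns V ds e c" and u: "u \<in> lker V e c" and k: "k < length e" "coeff (u k) 0 \<noteq> 0"
  shows "\<exists>e' c'. length e' < length e \<and> columns V ds e' c' \<and>
           lin (length e') c' ` free V e' = lin (length e) c ` free V e"
proof -
  obtain n where n: "length e = Suc n" using k(1) by (cases "length e") auto
  define a where "a = coeff (u k) 0"
  define w where "w = component e (e ! k) u"
  have "w \<in> lker V e c"
    unfolding w_def by (rule graded_submoduleD(5)[OF graded_submodule_lker[OF c] u])
  then have w: "w \<in> free V e" "lin (length e) c w = 0" by auto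
  have "w \<in> free_grade V e (e ! k)"
    unfolding w_def using u by (intro component_grade) auto
  then have "w k \<in> homogeneous_part V (e ! k - e ! k)" using k(1) unfolding free_grade_iff by blast
  then have "w k \<in> homogeneous_part V 0" by simp
  moreover have "coeff (w k) 0 = a" using k(1) by (simp add: w_def component_def hpart_def coeff_restrict a_def)
  ultimately have wk: "w k = Poly_Mapping.single 0 a" using homogeneous_deg_0 by metis
  define b :: "('a, 'b) mpoly" where "b = Poly_Mapping.single 0 (inverse a)"
  have bP: "b \<in> polys V" by (simp add: b_def)
  have bw: "b * w k = 1" using k(2) by (simp add: b_def wk mult_single a_def)
  define e' where "e' = map (\<lambda>l. e ! skip k l) [0..<n]"
  define c' where "c' = (\<lambda>l. c (skip k l))"
  have skip: "skip k l < length e" if "l < n" for l using that n by (auto simp: skip_def)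
  have len: "length e' = n" by (simp add: e'_def)
  have kn: "k \<le> n" using k(1) n by simp
  have cols: "columns V ds e' c'"
    using c skip by (simp add: columns_def e'_def c'_def)
  have split: "lin (length e) c x = scale (x k) (c k) + lin n c' (\<lambda>l. x (skip k l))" for x
    by (rule ext) (simp only: lin_def n scale_def c'_def plus_fun_apply sum_skip[OF kn])
  have "lin n c' ` free V e' = lin (length e) c ` free V e"
  proof (intro subset_antisym subsetI)
    fix y assume "y \<in> lin n c' ` free V e'"
    then obtain x where x: "x \<in> free V e'" "y = lin n c' x" by auto
    define z where "z = (\<lambda>l. if l = k then 0 else x (if l < k then l else l - 1))"
    have "z \<in> free V e" using x(1) k(1) by (auto simp: free_iff z_def len n)
    moreover have "(\<lambda>l. z (skip k l)) = x" by (auto simp: z_def skip_def fun_eq_iff)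
    moreover have "scale (z k) (c k) = 0" by (simp add: z_def scale_def fun_eq_iff)
    ultimately have "lin (length e) c z = y" using split[of z] x(2) by simp
    then show "y \<in> lin (length e) c ` free V e" using \<open>z \<in> free V e\<close> by (rule image_eqI[OF sym])
  next
    fix y assume "y \<in> lin (length e) c ` free V e"
    then obtain x where x: "x \<in> free V e" "y = lin (length e) c x" by auto
    \<comment> \<open>subtracting a multiple of the relation \<open>w\<close> removes the \<open>k\<close>-th coordinate\<close>
    define x' where "x' = x - scale (x k * b) w"
    have x': "x' \<in> free V e"
      unfolding x'_def by (intro free_diff free_scale polys_mult free_polys[OF x(1)] bP x(1) w(1))
    have "x' k = 0" using bw by (simp add: x'_def scale_def mult.assoc)
    then have 0: "scale (x' k) (c k) = 0" by (simp add: scale_def fun_eq_iff)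
    have "scale (x k * b) 0 = (0 :: ('a, 'b) vec)" by (simp add: scale_def fun_eq_iff)
    then have "lin (length e) c x' = y" by (simp add: x'_def lin_diff lin_scale w(2) x(2))
    then have "lin n c' (\<lambda>l. x' (skip k l)) = y" using split[of x'] 0 by simp
    moreover have "(\<lambda>l. x' (skip k l)) \<in> free V e'"
      using x' kn by (auto simp: free_iff len n skip_def)
    ultimately show "y \<in> lin n c' ` free V e'" by (rule image_eqI[OF sym])
  qed
  then show ?thesis using cols len n by (intro exI[of _ e'] exI[of _ c']) simp
qed

text \<open>A shortest list of homogeneous generators has no relation with a nonzero constant coefficient.
  By Schanuel's lemma its relations inherit a finite resolution, which replaces an appeal to
  Noetherianity when the choice is repeated.\<close>

lemma minimal_generators:
  assumes fin: "fin_res V L ds N t"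
  shows "\<exists>e c. columns V ds e c \<and> lin (length e) c ` free V e = N \<and>
           (\<exists>L t. fin_res V L e (lker V e c) t) \<and> minimal_submodule e (lker V e c)"
proof -
  obtain e1 c1 where 1: "columns V ds e1 c1" "lin (length e1) c1 ` free V e1 = N"
    "fin_res V L e1 (lker V e1 c1) (t + 1)"
    using fin_res_Suc[OF fin] by (rule fin_resE) blast
  define P where "P = (\<lambda>m. \<exists>e c. length e = m \<and> columns V ds e c \<and> lin (length e) c ` free V e = N)"
  have "P (length e1)" unfolding P_def using 1 by blast
  then have "P (LEAST m. P m)" by (rule LeastI)
  then obtain e c where e: "length e = (LEAST m. P m)" "columns V ds e c" "lin (length e) c ` free V e = N"
    unfolding P_def by blast
  have "minimal_submodule e (lker V e c)"
    unfolding minimal_submodule_def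
  proof (intro ballI allI impI, rule ccontr)
    fix u k assume "u \<in> lker V e c" "k < length e" "coeff (u k) 0 \<noteq> 0"
    from drop_redundant_generator[OF e(2) this] obtain e' c'
      where "length e' < length e" "columns V ds e' c'" "lin (length e') c' ` free V e' = N"
      using e(3) by blast
    then show False using not_less_Least[of "length e'" P] e(1) unfolding P_def by auto
  qed
  moreover
  \<comment> \<open>the degree bound only has to be large enough for both lists of generators\<close>
  define t' where "t' = Max (insert (t + 1) (set e1 \<union> set e))"
  have t': "t + 1 \<le> t'" "\<And>d. d \<in> set e1 \<Longrightarrow> d \<le> t' + 1" "\<And>d. d \<in> set e \<Longrightarrow> d \<le> t'"
  proof -
    have "d \<le> t'" if "d \<in> insert (t + 1) (set e1 \<union> set e)" for d
      unfolding t'_def using that by (intro Max_ge) auto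
    then show "t + 1 \<le> t'" "\<And>d. d \<in> set e1 \<Longrightarrow> d \<le> t' + 1" "\<And>d. d \<in> set e \<Longrightarrow> d \<le> t'" by force+
  qed
  have "equiv_presentation V e1 (lker V e1 c1) e (lker V e c)"
    by (rule equiv_presentation_lker[OF 1(1) e(2)]) (simp only: 1(2) e(3))
  from fin_res_equiv_presentation[OF fin_res_mono[OF 1(3) order_refl t'(1)] graded_submodule_lker[OF 1(1)]
      graded_submodule_lker[OF e(2)] this t'(2,3)]
  have "fin_res V (Suc (Suc L)) e (lker V e c) t'" by simp
  ultimately show ?thesis using e(2,3) by blast
qed

text \<open>Dependent choice of minimal generators for one syzygy module after the other; the finite resolution
  carried along keeps all of them finitely generated.\<close>

lemma minimal_resolution_exists:
  assumes J: "graded_submodule V [0] J" "minimal_submodule [0] J" and fin: "fin_res V L [0] J t"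
  shows "\<exists>ds c r. matrix_resolution V J ds c r \<and> (\<forall>i. minimal_submodule (ds i) (syz V J ds c r i))"
proof -
  define P where "P = (\<lambda>s :: int list \<times> ('a, 'b) vec set.
    (\<exists>L t. fin_res V L (fst s) (snd s) t) \<and> minimal_submodule (fst s) (snd s))"
  define R where "R = (\<lambda>s s' :: int list \<times> ('a, 'b) vec set. \<exists>c. columns V (fst s) (fst s') c \<and>
    lin (length (fst s')) c ` free V (fst s') = snd s \<and> snd s' = lker V (fst s') c)"
  have "\<exists>f. f 0 = ([0], J) \<and> (\<forall>i. P (f i) \<and> R (f i) (f (Suc i)))"
  proof -
    have "\<exists>f. \<forall>i. (P (f i) \<and> (i = 0 \<longrightarrow> f i = ([0], J))) \<and> R (f i) (f (Suc i))"
    proof (rule dependent_nat_choice)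
      show "\<exists>s. P s \<and> ((0 :: nat) = 0 \<longrightarrow> s = ([0], J))"
        by (rule exI[of _ "([0], J)"]) (use J(2) fin in \<open>auto simp only: P_def fst_conv snd_conv\<close>)
    next
      fix s and i :: nat assume "P s \<and> (i = 0 \<longrightarrow> s = ([0], J))"
      then obtain L t where "fin_res V L (fst s) (snd s) t" unfolding P_def by blast
      from minimal_generators[OF this] obtain e c where "columns V (fst s) e c"
        "lin (length e) c ` free V e = snd s" "\<exists>L t. fin_res V L e (lker V e c) t"
        "minimal_submodule e (lker V e c)" by blast
      then have "P (e, lker V e c)" "R s (e, lker V e c)" unfolding P_def R_def fst_conv snd_conv by blast+
      then show "\<exists>s'. (P s' \<and> (Suc i = 0 \<longrightarrow> s' = ([0], J))) \<and> R s s'" by blast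
    qed
    then show ?thesis by blast
  qed
  then obtain f where f: "f 0 = ([0], J)" "\<And>i. P (f i)" "\<And>i. R (f i) (f (Suc i))" by blast
  define ds where "ds = (\<lambda>i. fst (f i))"
  have "\<exists>c. \<forall>i. columns V (ds i) (ds (Suc i)) (c i) \<and>
      lin (length (ds (Suc i))) (c i) ` free V (ds (Suc i)) = snd (f i) \<and>
      snd (f (Suc i)) = lker V (ds (Suc i)) (c i)"
    using f(3) unfolding R_def ds_def by (intro choice allI)
  then obtain c where c: "\<And>i. columns V (ds i) (ds (Suc i)) (c i)"
    "\<And>i. lin (length (ds (Suc i))) (c i) ` free V (ds (Suc i)) = snd (f i)"
    "\<And>i. snd (f (Suc i)) = lker V (ds (Suc i)) (c i)"
    by blast
  have ds0: "ds 0 = [0]" by (simp add: ds_def f(1))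
  have syz: "syz V J ds c unit i = snd (f i)" for i
  proof (cases i)
    case 0
    have "syz V J ds c unit 0 = J"
    proof (intro subset_antisym subsetI)
      fix x assume "x \<in> syz V J ds c unit 0"
      then have x: "x \<in> free V [0]" "lin (length [0 :: int]) unit x \<in> J" by (simp_all add: ds0)
      then show "x \<in> J" using lin_unit_id[OF x(1)] by metis
    next
      fix x assume x: "x \<in> J"
      then have x': "x \<in> free V [0]" using graded_submoduleD(1)[OF J(1)] by auto
      then show "x \<in> syz V J ds c unit 0"
        unfolding syz.simps ds0 mem_Collect_eq lin_unit_id[OF x'] using x by (rule conjI)
    qed
    then show ?thesis by (simp add: 0 f(1))
  qed (simp add: c(3))
  have "matrix_resolution V J ds c unit"
    unfolding matrix_resolution_def
  proof (intro conjI allI ballI)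
    show "columns V [0] (ds 0) unit" unfolding ds0 by (rule columns_unit)
    fix y :: "('a, 'b) vec" assume y: "y \<in> free V [0]"
    show "\<exists>x\<in>free V (ds 0). lin (length (ds 0)) unit x - y \<in> J"
      unfolding ds0 using lin_unit_id[OF y] graded_submoduleD(2)[OF J(1)] y
      by (intro bexI[of _ y]) simp_all
  qed (simp_all only: c syz)
  moreover have "\<forall>i. minimal_submodule (ds i) (syz V J ds c unit i)"
  proof
    fix i show "minimal_submodule (ds i) (syz V J ds c unit i)"
      unfolding syz using f(2)[of i] unfolding P_def ds_def by (rule conjunct2)
  qed
  ultimately show ?thesis by blast
qed


section \<open>Passing between resolutions and matrices\<close>

lemma free_module_simps [simp]:
  "zero (free_module V ds) = 0" "add (free_module V ds) = (+)" "smult (free_module V ds) = scale"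
  by (simp_all add: free_module_def scale_def fun_eq_iff)

lemma lin_Suc: "lin (Suc n) b z = lin n b z + scale (z n) (b n)"
  by (simp add: lin_def scale_def fun_eq_iff)

lemma lin_unit_free: "x \<in> free V ds \<Longrightarrow> n \<le> length ds \<Longrightarrow> lin n unit x \<in> free V ds"
proof (induction n)
  case (Suc n)
  then show ?case unfolding lin_Suc
    by (intro free_add free_scale unit_free free_polys[of x]) auto
qed simp

text \<open>A homomorphism is only constrained on the carrier, where it agrees with the matrix of the images
  of the basis.\<close>

lemma graded_hom_free_module:
  assumes h: "h \<in> graded_hom (poly_ring V) (free_module V e) (free_module V ds)"
  shows "columns V ds e (\<lambda>l. h (unit l))"
    and "x \<in> free V e \<Longrightarrow> h x = lin (length e) (\<lambda>l. h (unit l)) x"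
proof -
  have add: "\<And>x y. x \<in> free V e \<Longrightarrow> y \<in> free V e \<Longrightarrow> h (x + y) = h x + h y"
    and smult: "\<And>r x. r \<in> polys V \<Longrightarrow> x \<in> free V e \<Longrightarrow> h (scale r x) = scale r (h x)"
    and grade: "\<And>j x. x \<in> free_grade V e j \<Longrightarrow> h x \<in> free_grade V ds j"
    using h unfolding graded_hom_def by (auto simp: image_subset_iff)
  show "columns V ds e (\<lambda>l. h (unit l))"
    unfolding columns_def by (intro allI impI grade unit_grade)
  assume x: "x \<in> free V e"
  have zero: "h 0 = 0"
    using smult[OF polys_0 free_0] by (simp add: scale_def fun_eq_iff zero_fun_def)
  have "h (lin n unit x) = lin n (\<lambda>l. h (unit l)) x" if "n \<le> length e" for n
    using that
  proof (induction n)
    case 0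
    then show ?case using zero by (metis lin_zero_columns)
  next
    case (Suc n)
    have "h (lin (Suc n) unit x) = h (lin n unit x) + scale (x n) (h (unit n))"
      unfolding lin_Suc using Suc.prems
      by (subst add) (auto intro: lin_unit_free x free_scale free_polys unit_free simp: smult free_polys[OF x] unit_free)
    then show ?case unfolding lin_Suc Suc.IH[OF Suc_leD[OF Suc.prems]] .
  qed
  from this[of "length e"] show "h x = lin (length e) (\<lambda>l. h (unit l)) x" using lin_unit_id[OF x] by simp
qed

lemma lin_graded_hom:
  assumes "columns V ds e c"
  shows "lin (length e) c \<in> graded_hom (poly_ring V) (free_module V e) (free_module V ds)"
  unfolding graded_hom_def using lin_free[OF assms] lin_free_grade[OF assms]
  by (auto simp: lin_add lin_scale)

definition vec_ideal :: "'v set \<Rightarrow> ('v, 'k::field) mpoly set \<Rightarrow> ('v, 'k) vec set" where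
  "vec_ideal V I = {x \<in> free V [0]. x 0 \<in> I}"

context
  fixes V :: "'v set" and I :: "('v, 'k::field) mpoly set" and M
  assumes I: "ideal I (poly_ring V)"
  defines "M \<equiv> quotient_module V I"
begin

abbreviation coset :: "('v, 'k) mpoly \<Rightarrow> ('v, 'k) mpoly set" where
  "coset f \<equiv> I +>\<^bsub>poly_ring V\<^esub> f"

interpretation I: ideal I "poly_ring V" by (rule I)

lemma quotient_carrier: "carrier M = coset ` polys V"
  by (auto simp: M_def quotient_module_def Let_def FactRing_def A_RCOSETS_defs a_r_coset_def)

lemma quotient_add: "f \<in> polys V \<Longrightarrow> g \<in> polys V \<Longrightarrow> coset f \<oplus>\<^bsub>M\<^esub> coset g = coset (f + g)"
  using I.a_rcos_sum[of f g] by (simp add: M_def quotient_module_def Let_def FactRing_def)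

lemma quotient_smult: "r \<in> polys V \<Longrightarrow> f \<in> polys V \<Longrightarrow> r \<odot>\<^bsub>M\<^esub> coset f = coset (r * f)"
  using I.rcoset_mult_add[of r f] by (simp add: M_def quotient_module_def Let_def FactRing_def)

lemma quotient_grade: "grade M j = coset ` homogeneous_part V j"
  by (simp add: M_def quotient_module_def Let_def)

lemma quotient_zero: "zero M = I"
  by (simp add: M_def quotient_module_def Let_def FactRing_def)

lemma coset_eq_iff: "f \<in> polys V \<Longrightarrow> g \<in> polys V \<Longrightarrow> coset f = coset g \<longleftrightarrow> f - g \<in> I"
proof -
  assume fg: "f \<in> polys V" "g \<in> polys V"
  have "\<ominus>\<^bsub>poly_ring V\<^esub> g = - g"
    using fg by (intro I.minus_equality) (auto simp: polys_uminus)
  then have "f \<ominus>\<^bsub>poly_ring V\<^esub> g = f - g" by (simp add: a_minus_def)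
  then show ?thesis using I.quotient_eq_iff_same_a_r_cos[OF I fg] by simp
qed

lemma coset_eq_I_iff: "f \<in> polys V \<Longrightarrow> coset f = I \<longleftrightarrow> f \<in> I"
  using coset_eq_iff[of f 0] I.a_rcos_zero[OF I additive_subgroup.zero_closed[OF ideal.axioms(1)[OF I]]] by simp

text \<open>The images of the basis elements are classes of homogeneous polynomials. Choosing
  representatives lifts the homomorphism to the polynomial ring.\<close>

lemma graded_hom_quotient:
  assumes h: "h \<in> graded_hom (poly_ring V) (free_module V e) M"
  shows "\<exists>r. columns V [0] e r \<and> (\<forall>x\<in>free V e. h x = coset (lin (length e) r x 0))"
proof -
  have add: "\<And>x y. x \<in> free V e \<Longrightarrow> y \<in> free V e \<Longrightarrow> h (x + y) = h x \<oplus>\<^bsub>M\<^esub> h y"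
    and smult: "\<And>r x. r \<in> polys V \<Longrightarrow> x \<in> free V e \<Longrightarrow> h (scale r x) = r \<odot>\<^bsub>M\<^esub> h x"
    and grade: "\<And>j x. x \<in> free_grade V e j \<Longrightarrow> h x \<in> grade M j"
    and closed: "\<And>x. x \<in> free V e \<Longrightarrow> h x \<in> carrier M"
    using h unfolding graded_hom_def by (auto simp: image_subset_iff)
  have "\<exists>f. f \<in> homogeneous_part V (e ! l) \<and> h (unit l) = coset f" if "l < length e" for l
    using grade[OF unit_grade[OF that]] unfolding quotient_grade by blast
  then obtain f where f: "\<And>l. l < length e \<Longrightarrow> f l \<in> homogeneous_part V (e ! l) \<and> h (unit l) = coset (f l)"
    by metis
  define r where "r = (\<lambda>l. embed (f l))"
  have r: "columns V [0] e r" using f by (auto simp: columns_def r_def intro!: embed_grade)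
  have fP: "f l \<in> polys V" if "l < length e" for l using f[OF that] homogeneous_polys by blast
  have zero: "h 0 = coset 0"
  proof -
    obtain g where g: "g \<in> polys V" "h 0 = coset g" using closed[OF free_0] quotient_carrier by auto
    have "h 0 = h (scale 0 0)" by (simp add: scale_def zero_fun_def)
    also have "\<dots> = 0 \<odot>\<^bsub>M\<^esub> coset g" using smult[OF polys_0 free_0] g(2) by simp
    also have "\<dots> = coset 0" using quotient_smult[OF polys_0 g(1)] by simp
    finally show ?thesis .
  qed
  have "h x = coset (lin (length e) r x 0)" if x: "x \<in> free V e" for x
  proof -
    have "h (lin n unit x) = coset (lin n r x 0) \<and> lin n r x 0 \<in> polys V" if "n \<le> length e" for n
      using that
    proof (induction n)
      case 0
      have "lin 0 unit x = 0" "lin 0 r x 0 = 0" by simp_all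
      then show ?case using zero by (metis polys_0)
    next
      case (Suc n)
      note IH = Suc.IH[OF Suc_leD[OF Suc.prems]]
      have n: "n < length e" using Suc.prems by simp
      have P: "x n * f n \<in> polys V" by (intro polys_mult free_polys[OF x] fP[OF n])
      have "h (lin (Suc n) unit x) = h (lin n unit x) \<oplus>\<^bsub>M\<^esub> h (scale (x n) (unit n))"
        unfolding lin_Suc using n
        by (intro add lin_unit_free x free_scale free_polys[OF x] unit_free) auto
      also have "h (scale (x n) (unit n)) = coset (x n * f n)"
        using smult[OF free_polys[OF x] unit_free[OF n]] f[OF n] quotient_smult[OF free_polys[OF x] fP[OF n]] by simp
      also have "h (lin n unit x) \<oplus>\<^bsub>M\<^esub> coset (x n * f n) = coset (lin n r x 0 + x n * f n)"
        using IH quotient_add P by simp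
      also have "lin n r x 0 + x n * f n = lin (Suc n) r x 0"
        by (simp add: lin_Suc scale_def r_def)
      finally show ?case using IH P by (simp add: lin_Suc scale_def r_def polys_add)
    qed
    from this[of "length e"] show ?thesis using lin_unit_id[OF x] by simp
  qed
  then show ?thesis using r by blast
qed

lemma free_module_kernel: "a_kernel (free_module V e) (free_module V ds) h = {x \<in> free V e. h x = 0}"
  by (simp add: a_kernel_def')

lemma quotient_kernel:
  assumes "columns V [0] e r" "\<And>x. x \<in> free V e \<Longrightarrow> h x = coset (lin (length e) r x 0)"
  shows "a_kernel (free_module V e) M h = {x \<in> free V e. lin (length e) r x \<in> vec_ideal V I}"
  unfolding a_kernel_def'
proof (rule Collect_cong, rule conj_cong[OF refl])
  fix x :: "('v, 'k) vec" assume x: "x \<in> free V e"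
  have "lin (length e) r x \<in> free V [0]" by (rule lin_free[OF assms(1) x])
  then show "h x = zero M \<longleftrightarrow> lin (length e) r x \<in> vec_ideal V I"
    unfolding quotient_zero vec_ideal_def assms(2)[OF x] using coset_eq_I_iff[OF free_polys] by simp
qed

lemma resolution_matrices:
  assumes res: "graded_free_resolution V M ds \<phi> \<epsilon>"
  obtains c r where "matrix_resolution V (vec_ideal V I) ds c r"
    "\<And>i x. x \<in> free V (ds (Suc i)) \<Longrightarrow> \<phi> i x = lin (length (ds (Suc i))) (c i) x"
proof -
  have \<epsilon>: "\<epsilon> \<in> graded_hom (poly_ring V) (free_module V (ds 0)) M"
    and \<phi>: "\<And>i. \<phi> i \<in> graded_hom (poly_ring V) (free_module V (ds (Suc i))) (free_module V (ds i))"
    and surj: "\<epsilon> ` free V (ds 0) = carrier M"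
    and ex0: "\<phi> 0 ` free V (ds (Suc 0)) = a_kernel (free_module V (ds 0)) M \<epsilon>"
    and ex: "\<And>i. \<phi> (Suc i) ` free V (ds (Suc (Suc i))) = a_kernel (free_module V (ds (Suc i))) (free_module V (ds i)) (\<phi> i)"
    using res unfolding graded_free_resolution_def Let_def One_nat_def by blast+
  obtain r where r: "columns V [0] (ds 0) r" "\<And>x. x \<in> free V (ds 0) \<Longrightarrow> \<epsilon> x = coset (lin (length (ds 0)) r x 0)"
    using graded_hom_quotient[OF \<epsilon>] by blast
  define c where "c = (\<lambda>i l. \<phi> i (unit l))"
  have c: "columns V (ds i) (ds (Suc i)) (c i)" for i
    unfolding c_def by (rule graded_hom_free_module(1)[OF \<phi>])
  have lin: "\<phi> i x = lin (length (ds (Suc i))) (c i) x" if "x \<in> free V (ds (Suc i))" for i x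
    unfolding c_def by (rule graded_hom_free_module(2)[OF \<phi> that])
  have im: "lin (length (ds (Suc i))) (c i) ` free V (ds (Suc i)) = \<phi> i ` free V (ds (Suc i))" for i
    by (rule image_cong) (simp_all add: lin)
  have "matrix_resolution V (vec_ideal V I) ds c r"
    unfolding matrix_resolution_def
  proof (intro conjI allI ballI)
    show "columns V [0] (ds 0) r" by (rule r(1))
    show "columns V (ds i) (ds (Suc i)) (c i)" for i by (rule c)
    show "lin (length (ds (Suc i))) (c i) ` free V (ds (Suc i)) = syz V (vec_ideal V I) ds c r i" for i
    proof (cases i)
      case 0
      then show ?thesis unfolding im using ex0 quotient_kernel[OF r] by simp
    next
      case (Suc j)
      have "{x \<in> free V (ds (Suc j)). \<phi> j x = 0} = lker V (ds (Suc j)) (c j)"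
        by (rule Collect_cong) (use lin in auto)
      then show ?thesis unfolding im Suc ex free_module_kernel syz.simps .
    qed
    fix y :: "('v, 'k) vec" assume y: "y \<in> free V [0]"
    have "coset (y 0) \<in> \<epsilon> ` free V (ds 0)" unfolding surj quotient_carrier using free_polys[OF y] by blast
    then obtain x where x: "x \<in> free V (ds 0)" "\<epsilon> x = coset (y 0)" by auto
    have lx: "lin (length (ds 0)) r x \<in> free V [0]" by (rule lin_free[OF r(1) x(1)])
    have "lin (length (ds 0)) r x 0 - y 0 \<in> I"
      using coset_eq_iff[OF free_polys[OF lx] free_polys[OF y]] x r(2) by simp
    then have "lin (length (ds 0)) r x - y \<in> vec_ideal V I" unfolding vec_ideal_def using free_diff[OF lx y] by simp
    then show "\<exists>x\<in>free V (ds 0). lin (length (ds 0)) r x - y \<in> vec_ideal V I" using x(1) by blast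
  qed
  then show ?thesis using lin that by blast
qed

lemma matrices_resolution:
  assumes res: "matrix_resolution V (vec_ideal V I) ds c r"
  shows "graded_free_resolution V M ds (\<lambda>i. lin (length (ds (Suc i))) (c i)) (\<lambda>x. coset (lin (length (ds 0)) r x 0))"
proof -
  note r = matrix_resolutionD(1)[OF res] and c = matrix_resolutionD(2)[OF res]
  let ?\<epsilon> = "\<lambda>x. coset (lin (length (ds 0)) r x 0)"
  have lP: "lin (length (ds 0)) r x 0 \<in> polys V" if "x \<in> free V (ds 0)" for x
    by (rule free_polys[OF lin_free[OF r that]])
  have \<epsilon>: "?\<epsilon> \<in> graded_hom (poly_ring V) (free_module V (ds 0)) M"
    unfolding graded_hom_def
  proof (intro CollectI conjI ballI allI)
    show "?\<epsilon> \<in> free V (ds 0) \<rightarrow> carrier M" using lP quotient_carrier by auto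
    fix j
    show "?\<epsilon> ` free_grade V (ds 0) j \<subseteq> grade M j"
      unfolding quotient_grade using lin_free_grade[OF r] by (auto simp: free_grade_iff[of _ V "[0]"])
  qed (auto simp: lin_add lin_scale quotient_add quotient_smult lP scale_def[of _ "lin _ _ _"])
  have surj: "?\<epsilon> ` free V (ds 0) = carrier M"
  proof (intro subset_antisym subsetI)
    fix C assume "C \<in> carrier M"
    then obtain f where f: "f \<in> polys V" "C = coset f" using quotient_carrier by auto
    obtain x where x: "x \<in> free V (ds 0)" "lin (length (ds 0)) r x - embed f \<in> vec_ideal V I"
      using matrix_resolutionD(3)[OF res embed_free[OF f(1)]] by blast
    then have "?\<epsilon> x = C" using coset_eq_iff[OF lP[OF x(1)] f(1)] f(2) by (simp add: vec_ideal_def)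
    then show "C \<in> ?\<epsilon> ` free V (ds 0)" using x(1) by blast
  qed (use lP quotient_carrier in auto)
  show ?thesis
    unfolding graded_free_resolution_def Let_def
  proof (intro conjI allI)
    show "lin (length (ds (Suc 0))) (c 0) ` carrier (free_module V (ds 1)) = a_kernel (free_module V (ds 0)) M ?\<epsilon>"
      using matrix_resolutionD(4)[OF res, of 0] quotient_kernel[OF r, of ?\<epsilon>] by simp
    show "lin (length (ds (Suc (Suc i)))) (c (Suc i)) ` free V (ds (Suc (Suc i))) =
          a_kernel (free_module V (ds (Suc i))) (free_module V (ds i)) (lin (length (ds (Suc i))) (c i))" for i
      using matrix_resolutionD(4)[OF res, of "Suc i"] by (simp add: free_module_kernel)
  qed (rule \<epsilon> lin_graded_hom c surj)+
qed

end


section \<open>Regular sequences of monomials: the lower bound\<close>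

lemma lin_scale_columns: "lin n (\<lambda>l. scale f (b l)) x = scale f (lin n b x)"
  by (simp add: lin_def scale_def fun_eq_iff sum_distrib_left mult.left_commute)

lemma lin_diff_columns: "lin n (\<lambda>l. b l - b' l) x = lin n b x - lin n b' x"
  by (simp add: lin_def fun_eq_iff right_diff_distrib sum_subtractf)

text \<open>Multiplication by \<open>f\<close> is a chain map that lifts the zero map of \<open>S/J\<close>, so it is null homotopic. The
  homotopy \<open>\<eta>\<close> is built one step at a time: the elements to be lifted are cycles, and the resolution is
  exact.\<close>

lemma multiplication_homotopy:
  fixes f :: "('v, 'k::field) mpoly"
  assumes res: "matrix_resolution V J ds c r" and f: "f \<in> polys V"
    and fJ: "\<And>y. y \<in> free V [0] \<Longrightarrow> scale f y \<in> J"
  shows "\<exists>\<eta>. (\<forall>i. \<forall>l<length (ds i). \<eta> i l \<in> free V (ds (Suc i))) \<and>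
    (\<forall>x\<in>free V (ds 0). lin (length (ds 1)) (c 0) (lin (length (ds 0)) (\<eta> 0) x) = scale f x) \<and>
    (\<forall>i. \<forall>x\<in>free V (ds (Suc i)).
       lin (length (ds (Suc (Suc i)))) (c (Suc i)) (lin (length (ds (Suc i))) (\<eta> (Suc i)) x) =
       scale f x - lin (length (ds i)) (\<eta> i) (lin (length (ds (Suc i))) (c i) x))"
proof -
  note im = matrix_resolutionD(4)[OF res]
  define d where "d = (\<lambda>i. lin (length (ds (Suc i))) (c i))"
  have d: "d i x \<in> syz V J ds c r i" if "x \<in> free V (ds (Suc i))" for i x
    using im[of i] that by (auto simp: d_def)
  have d_lin: "d i (lin n b x) = lin n (\<lambda>l. d i (b l)) x" for i n b x
    by (simp add: d_def lin_lin)
  have syz_free: "syz V J ds c r i \<subseteq> free V (ds i)" for i by (cases i) auto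
  define P where "P = (\<lambda>i h. (\<forall>l<length (ds i). h l \<in> free V (ds (Suc i))) \<and>
    (\<forall>x\<in>syz V J ds c r i. d i (lin (length (ds i)) h x) = scale f x) \<and>
    (i = 0 \<longrightarrow> (\<forall>x\<in>free V (ds 0). d 0 (lin (length (ds 0)) h x) = scale f x)))"
  define R where "R = (\<lambda>i h h'. \<forall>x\<in>free V (ds (Suc i)).
    d (Suc i) (lin (length (ds (Suc i))) h' x) = scale f x - lin (length (ds i)) h (d i x))"
  have lift: "\<exists>h. (\<forall>l<length (ds i). h l \<in> free V (ds (Suc i))) \<and> (\<forall>x. d i (lin (length (ds i)) h x) = lin (length (ds i)) y x)"
    if "\<And>l. l < length (ds i) \<Longrightarrow> y l \<in> syz V J ds c r i" for i y
  proof -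
    have "\<exists>z. z \<in> free V (ds (Suc i)) \<and> d i z = y l" if l: "l < length (ds i)" for l
      using that \<open>\<And>l. l < length (ds i) \<Longrightarrow> y l \<in> syz V J ds c r i\<close>[OF l] im[of i, symmetric]
      unfolding d_def by auto
    then obtain h where h: "\<And>l. l < length (ds i) \<Longrightarrow> h l \<in> free V (ds (Suc i)) \<and> d i (h l) = y l" by metis
    have "d i (lin (length (ds i)) h x) = lin (length (ds i)) y x" for x
      unfolding d_lin using h lin_cong[of "length (ds i)" "\<lambda>l. d i (h l)" y] by simp
    then show ?thesis using h by blast
  qed
  have scale_unit: "lin (length (ds i)) (\<lambda>l. scale f (unit l)) x = scale f x" if "x \<in> free V (ds i)" for i x
    unfolding lin_scale_columns lin_unit_id[OF that] ..
  have "\<exists>\<eta>. \<forall>i. P i (\<eta> i) \<and> R i (\<eta> i) (\<eta> (Suc i))"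
  proof (rule dependent_nat_choice)
    have "scale f (unit l) \<in> syz V J ds c r 0" if "l < length (ds 0)" for l
      using free_scale[OF f unit_free[OF that]] fJ[OF lin_free[OF matrix_resolutionD(1)[OF res] unit_free[OF that]]]
      by (simp add: lin_scale)
    then obtain h where h: "\<forall>l<length (ds 0). h l \<in> free V (ds (Suc 0))"
      "\<And>x. d 0 (lin (length (ds 0)) h x) = lin (length (ds 0)) (\<lambda>l. scale f (unit l)) x"
      using lift[of 0 "\<lambda>l. scale f (unit l)"] by blast
    have "P 0 h" unfolding P_def using h(1) scale_unit syz_free[of 0] unfolding h(2) by blast
    then show "\<exists>h. P 0 h" by blast
  next
    fix h i assume h: "P i h"
    let ?y = "\<lambda>l. scale f (unit l) - lin (length (ds i)) h (c i l)"
    have h_free: "lin (length (ds i)) h x \<in> free V (ds (Suc i))" if "x \<in> free V (ds i)" for x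
      using h unfolding P_def by (intro lin_mem_free free_polys[OF that]) blast
    have cl: "c i l = d i (unit l)" if "l < length (ds (Suc i))" for l
      unfolding d_def lin_unit[OF that] ..
    have "?y l \<in> syz V J ds c r (Suc i)" if l: "l < length (ds (Suc i))" for l
    proof -
      have "c i l \<in> syz V J ds c r i" unfolding cl[OF l] by (rule d[OF unit_free[OF l]])
      then have "d i (lin (length (ds i)) h (c i l)) = scale f (c i l)" "c i l \<in> free V (ds i)"
        using h syz_free[of i] unfolding P_def by blast+
      then have "d i (?y l) = 0" "?y l \<in> free V (ds (Suc i))"
        using h_free free_scale[OF f unit_free[OF l]] cl[OF l]
        by (auto simp: d_def lin_diff lin_scale free_diff)
      then show ?thesis by (simp add: d_def)
    qed
    then obtain h' where h': "\<forall>l<length (ds (Suc i)). h' l \<in> free V (ds (Suc (Suc i)))"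
      "\<And>x. d (Suc i) (lin (length (ds (Suc i))) h' x) = lin (length (ds (Suc i))) ?y x"
      using lift[of "Suc i" ?y] by blast
    have R: "R i h h'"
      unfolding R_def
    proof
      fix x :: "('v, 'k) vec" assume x: "x \<in> free V (ds (Suc i))"
      show "d (Suc i) (lin (length (ds (Suc i))) h' x) = scale f x - lin (length (ds i)) h (d i x)"
      proof -
        have "lin (length (ds i)) h (d i x) =
            lin (length (ds (Suc i))) (\<lambda>l. lin (length (ds i)) h (c i l)) x"
          unfolding d_def lin_lin ..
        then show ?thesis unfolding h'(2) lin_diff_columns scale_unit[OF x] by (simp only:)
      qed
    qed
    have "d (Suc i) (lin (length (ds (Suc i))) h' x) = scale f x" if "x \<in> syz V J ds c r (Suc i)" for x
    proof -
      have "x \<in> free V (ds (Suc i))" "d i x = 0" using that by (auto simp: d_def)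
      then show ?thesis using R unfolding R_def by simp
    qed
    then have "P (Suc i) h'" using h'(1) unfolding P_def by auto
    then show "\<exists>h'. P (Suc i) h' \<and> R i h h'" using R by blast
  qed
  then obtain \<eta> where "\<And>i. P i (\<eta> i)" "\<And>i. R i (\<eta> i) (\<eta> (Suc i))" by blast
  then show ?thesis unfolding P_def R_def d_def One_nat_def by (intro exI[of _ \<eta>] conjI) blast+
qed

text \<open>After restriction to the variables \<open>W\<close>, the ideal \<open>J\<close> is generated by the pairwise coprime
  monomials \<open>a 0, \<dots>, a (R - 1)\<close>.\<close>

locale coprime_monomials =
  fixes V :: "'v set" and J :: "('v, 'k::field) vec set" and ds c r
    and a :: "nat \<Rightarrow> 'v \<Rightarrow>\<^sub>0 nat" and R :: nat and W :: "'v set"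
  assumes res: "matrix_resolution V J ds c r" and W: "W \<subseteq> V"
    and a_nonzero: "\<And>j. j < R \<Longrightarrow> a j \<noteq> 0" and a_supp: "\<And>j. j < R \<Longrightarrow> supp (a j) \<subseteq> W"
    and a_coprime: "\<And>i j. i < R \<Longrightarrow> j < R \<Longrightarrow> i \<noteq> j \<Longrightarrow> supp (a i) \<inter> supp (a j) = {}"
    and a_mem: "\<And>j y. j < R \<Longrightarrow> y \<in> free V [0] \<Longrightarrow> scale (Poly_Mapping.single (a j) 1) y \<in> J"
    and J_supp: "\<And>x m. x \<in> J \<Longrightarrow> m \<in> supp (x 0) \<Longrightarrow> supp m \<subseteq> W \<Longrightarrow> \<exists>j<R. \<exists>b. m = a j + b"
begin

abbreviation f :: "nat \<Rightarrow> ('v, 'k) mpoly" where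
  "f j \<equiv> Poly_Mapping.single (a j) 1"

abbreviation d :: "nat \<Rightarrow> ('v, 'k) vec \<Rightarrow> ('v, 'k) vec" where
  "d i \<equiv> lin (length (ds (Suc i))) (c i)"

text \<open>\<open>tail_ideal i\<close> is the ideal generated by \<open>f i, \<dots>, f (R - 1)\<close> and the variables outside \<open>W\<close>. Modulo
  \<open>tail_ideal (Suc i)\<close>, the monomial \<open>f i\<close> is not a zero divisor.\<close>

definition tail_monom :: "nat \<Rightarrow> ('v \<Rightarrow>\<^sub>0 nat) \<Rightarrow> bool" where
  "tail_monom i m \<longleftrightarrow> (\<exists>j. i \<le> j \<and> j < R \<and> (\<exists>b. m = a j + b)) \<or> \<not> supp m \<subseteq> W"

definition tail_ideal :: "nat \<Rightarrow> ('v, 'k) mpoly set" where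
  "tail_ideal i = {g. \<forall>m\<in>supp g. tail_monom i m}"

lemma tail_monom_add: "tail_monom i m \<Longrightarrow> tail_monom i (m' + m)"
  unfolding tail_monom_def by (metis Un_subset_iff add.left_commute supp_monom_add)

lemma tail_ideal_mult: "g \<in> tail_ideal i \<Longrightarrow> h * g \<in> tail_ideal i"
  unfolding tail_ideal_def by (auto elim!: supp_mult_cases intro: tail_monom_add)

lemma tail_ideal_add: "g \<in> tail_ideal i \<Longrightarrow> h \<in> tail_ideal i \<Longrightarrow> g + h \<in> tail_ideal i"
  unfolding tail_ideal_def using keys_add[of g h] by auto

lemma tail_ideal_sum: "(\<And>l. l \<in> I \<Longrightarrow> g l \<in> tail_ideal i) \<Longrightarrow> (\<Sum>l\<in>I. g l) \<in> tail_ideal i"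
proof (induction I rule: infinite_finite_induct)
  case (insert l I)
  then show ?case by (simp add: tail_ideal_add)
qed (simp_all add: tail_ideal_def)

lemma not_dvd: "i < R \<Longrightarrow> j < R \<Longrightarrow> i \<noteq> j \<Longrightarrow> a i \<noteq> a j + b"
  by (metis Int_absorb1 Un_upper1 a_coprime a_nonzero inf_commute supp_eq_empty supp_monom_add)

lemma tail_monom_cancel:
  assumes i: "i < R" and t: "tail_monom (Suc i) (a i + m)" shows "tail_monom (Suc i) m"
proof (cases "supp (a i + m) \<subseteq> W")
  case True
  then obtain j b where j: "Suc i \<le> j" "j < R" "a i + m = a j + b"
    using t unfolding tail_monom_def by auto
  have "coeff (a j) k \<le> coeff m k" for k
  proof (cases "k \<in> supp (a j)")
    case True
    then have "k \<notin> supp (a i)" using a_coprime[of i j] i j by auto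
    then have "coeff (a i) k = 0" by (simp add: in_keys_iff)
    then show ?thesis using arg_cong[OF j(3), of "\<lambda>p. coeff p k"] by (simp add: lookup_add)
  qed (simp add: in_keys_iff)
  then have "m = a j + (m - a j)"
    by (intro poly_mapping_eqI) (simp add: lookup_add lookup_minus)
  then show ?thesis using j unfolding tail_monom_def by blast
next
  case False
  then show ?thesis using a_supp[OF i] unfolding tail_monom_def by (auto simp: supp_monom_add)
qed

lemma tail_ideal_cancel: "i < R \<Longrightarrow> f i * g \<in> tail_ideal (Suc i) \<Longrightarrow> g \<in> tail_ideal (Suc i)"
  unfolding tail_ideal_def by (auto simp: supp_monom_mult intro: tail_monom_cancel)

lemma tail_ideal_coeff:
  assumes i: "i < R" and g: "g \<in> tail_ideal (Suc i)" shows "coeff g (a i) = 0"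
proof -
  have "\<not> tail_monom (Suc i) (a i)"
    using not_dvd[OF i] a_supp[OF i] unfolding tail_monom_def by (auto simp: Suc_le_eq)
  then show ?thesis using g by (auto simp: tail_ideal_def in_keys_iff)
qed

text \<open>\<open>test i\<close> is a linear functional on the \<open>i\<close>-th term of the resolution, the component at
  \<open>{0, \<dots>, i - 1}\<close> of a chain map to the Koszul complex of the \<open>f j\<close>. It maps the \<open>i\<close>-th syzygies into
  \<open>tail_ideal i\<close>, and \<open>test (Suc i)\<close> arises from its values on the columns of the next matrix by dividing
  by \<open>f i\<close> modulo \<open>tail_ideal (Suc i)\<close>.\<close>

primrec test :: "nat \<Rightarrow> nat \<Rightarrow> ('v, 'k) vec" where
  "test 0 = r"
| "test (Suc i) = (\<lambda>l. embed (monom_quot (a i) (lin (length (ds i)) (test i) (c i l) 0)))"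

definition pair :: "nat \<Rightarrow> ('v, 'k) vec \<Rightarrow> ('v, 'k) mpoly" where
  "pair i x = lin (length (ds i)) (test i) x 0"

lemma pair_add: "pair i (x + y) = pair i x + pair i y"
  by (simp add: pair_def lin_add)

lemma pair_scale: "pair i (scale g x) = g * pair i x"
  by (simp add: pair_def lin_scale) (simp add: scale_def)

lemma pair_lin: "pair i (lin n b x) = (\<Sum>l<n. x l * pair i (b l))"
  by (simp add: pair_def lin_lin) (simp add: lin_def)

lemma test_columns: "columns V [\<Sum>j<i. int (monom_degree (a j))] (ds i) (test i)"
proof (induction i)
  case 0
  then show ?case using matrix_resolutionD(1)[OF res] by simp
next
  case (Suc i)
  let ?D = "\<Sum>j<i. int (monom_degree (a j))"
  show ?case
    unfolding columns_def
  proof (intro allI impI)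
    fix l assume "l < length (ds (Suc i))"
    then have "c i l \<in> free_grade V (ds i) (ds (Suc i) ! l)"
      using matrix_resolutionD(2)[OF res, of i] by (simp add: columns_def)
    from lin_free_grade[OF Suc.IH this]
    have "lin (length (ds i)) (test i) (c i l) 0 \<in> homogeneous_part V (ds (Suc i) ! l - ?D)"
      by (simp add: free_grade_iff)
    from monom_quot_homogeneous[OF this, of "a i"]
    show "test (Suc i) l \<in> free_grade V [\<Sum>j<Suc i. int (monom_degree (a j))] (ds (Suc i) ! l)"
      unfolding test.simps by (intro embed_grade) (simp add: algebra_simps)
  qed
qed

lemma pair_step:
  assumes i: "i < R" and syz: "\<And>x. x \<in> syz V J ds c r i \<Longrightarrow> pair i x \<in> tail_ideal i"
  shows "pair i (d i x) - f i * pair (Suc i) x \<in> tail_ideal (Suc i)"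
proof -
  let ?n = "length (ds (Suc i))"
  have "pair i (c i l) - f i * monom_quot (a i) (pair i (c i l)) \<in> tail_ideal (Suc i)" if l: "l < ?n" for l
  proof -
    have "lin ?n (c i) (unit l) \<in> syz V J ds c r i"
      using matrix_resolutionD(4)[OF res, of i] unit_free[OF l] by blast
    then have "pair i (c i l) \<in> tail_ideal i" using syz by (simp add: lin_unit[OF l])
    have "tail_monom (Suc i) m" if "m \<in> supp (pair i (c i l) - f i * monom_quot (a i) (pair i (c i l)))" for m
    proof -
      have m: "tail_monom i m" "\<not> (\<exists>b. m = a i + b)"
        using \<open>pair i (c i l) \<in> tail_ideal i\<close> monom_quot_remainder[OF that] by (auto simp: tail_ideal_def)
      show ?thesis
      proof (cases "supp m \<subseteq> W")
        case True
        then obtain j b where j: "i \<le> j" "j < R" "m = a j + b" using m(1) unfolding tail_monom_def by blast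
        then have "j \<noteq> i" using m(2) by blast
        then have "Suc i \<le> j" using j(1) by simp
        then show ?thesis unfolding tail_monom_def using j by blast
      qed (simp add: tail_monom_def)
    qed
    then show ?thesis unfolding tail_ideal_def by blast
  qed
  then have "(\<Sum>l<?n. x l * (pair i (c i l) - f i * monom_quot (a i) (pair i (c i l)))) \<in> tail_ideal (Suc i)"
    by (intro tail_ideal_sum tail_ideal_mult) auto
  also have "(\<Sum>l<?n. x l * (pair i (c i l) - f i * monom_quot (a i) (pair i (c i l)))) =
      pair i (d i x) - f i * pair (Suc i) x"
  proof -
    have "pair (Suc i) x = (\<Sum>l<?n. x l * monom_quot (a i) (pair i (c i l)))"
      by (simp add: pair_def) (simp add: lin_def)
    then show ?thesis
      by (simp add: pair_lin right_diff_distrib sum_subtractf sum_distrib_left mult.left_commute)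
  qed
  finally show ?thesis .
qed

lemma pair_syz: "i \<le> R \<Longrightarrow> x \<in> syz V J ds c r i \<Longrightarrow> pair i x \<in> tail_ideal i"
proof (induction i arbitrary: x)
  case 0
  then have "lin (length (ds 0)) r x \<in> J" by simp
  from J_supp[OF this] show ?case
    unfolding tail_ideal_def tail_monom_def pair_def by auto
next
  case (Suc i)
  have i: "i < R" using Suc.prems(1) by simp
  have "pair i (d i x) - f i * pair (Suc i) x \<in> tail_ideal (Suc i)"
    by (rule pair_step[OF i Suc.IH]) (use i in auto)
  moreover have "pair i (d i x) = 0" using Suc.prems(2) by (simp add: pair_def)
  ultimately have "f i * (- pair (Suc i) x) \<in> tail_ideal (Suc i)" by simp
  from tail_ideal_cancel[OF i this] show ?case by (simp add: tail_ideal_def)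
qed

text \<open>Applying the null homotopies for \<open>f 0, f 1, \<dots>\<close> in turn to a lift of \<open>1\<close> gives an element \<open>w i\<close> of each
  of the first \<open>R + 1\<close> terms of the resolution. Comparing the coefficients of the monomial \<open>a i\<close> shows
  that pairing \<open>w (Suc i)\<close> with \<open>test (Suc i)\<close> has the same constant coefficient as pairing \<open>w i\<close> with
  \<open>test i\<close>, so all of them are \<open>1\<close>. But \<open>test R\<close> lowers degrees by the sum of the degrees of the
  \<open>a j\<close>, and takes values without constant coefficient on generators of any other degree.\<close>

lemma degree_of_complete_intersection: "(\<Sum>j<R. int (monom_degree (a j))) \<in> set (ds R)"
proof -
  let ?n = "\<lambda>i. length (ds i)"
  have "\<exists>\<eta>. (\<forall>i. \<forall>l<?n i. \<eta> i l \<in> free V (ds (Suc i))) \<and>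
    (\<forall>x\<in>free V (ds 0). lin (?n 1) (c 0) (lin (?n 0) (\<eta> 0) x) = scale (f j) x) \<and>
    (\<forall>i. \<forall>x\<in>free V (ds (Suc i)). d (Suc i) (lin (?n (Suc i)) (\<eta> (Suc i)) x) =
       scale (f j) x - lin (?n i) (\<eta> i) (d i x))" if "j < R" for j
    by (rule multiplication_homotopy[OF res]) (use a_supp[OF that] W a_mem[OF that] in auto)
  then obtain \<eta> where \<eta>: "\<And>j i l. j < R \<Longrightarrow> l < ?n i \<Longrightarrow> \<eta> j i l \<in> free V (ds (Suc i))"
    "\<And>j x. j < R \<Longrightarrow> x \<in> free V (ds 0) \<Longrightarrow> d 0 (lin (?n 0) (\<eta> j 0) x) = scale (f j) x"
    "\<And>j i x. j < R \<Longrightarrow> x \<in> free V (ds (Suc i)) \<Longrightarrow> d (Suc i) (lin (?n (Suc i)) (\<eta> j (Suc i)) x) =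
       scale (f j) x - lin (?n i) (\<eta> j i) (d i x)"
    unfolding One_nat_def by metis
  obtain w0 where w0: "w0 \<in> free V (ds 0)" "lin (?n 0) r w0 - embed 1 \<in> J"
    using matrix_resolutionD(3)[OF res embed_free[OF polys_1]] by auto
  define w where "w = rec_nat w0 (\<lambda>i y. lin (?n i) (\<eta> i i) y)"
  have w_0: "w 0 = w0" and w_Suc: "w (Suc i) = lin (?n i) (\<eta> i i) (w i)" for i
    by (simp_all add: w_def)
  have \<eta>_free: "lin (?n i) (\<eta> j i) x \<in> free V (ds (Suc i))" if "j < R" "x \<in> free V (ds i)" for i j x
    using \<eta>(1)[OF that(1)] by (intro lin_mem_free free_polys[OF that(2)])
  have w_free: "w i \<in> free V (ds i)" if "i \<le> R" for i
    using that by (induction i) (auto simp: w_0 w_Suc w0 \<eta>_free)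
  \<comment> \<open>\<open>w (Suc i)\<close> would have boundary \<open>f i\<close> times \<open>w i\<close> if \<open>w i\<close> were a cycle; the boundary of \<open>w i\<close> is a
    combination of \<open>f 0, \<dots>, f (i - 1)\<close>, which do not contribute to the coefficient of \<open>a i\<close>\<close>
  have boundary: "\<exists>y. d i (w (Suc i)) = scale (f i) (w i) + lin i y f" if "i < R" for i
    using that
  proof (induction i)
    case 0
    have "d 0 (w (Suc 0)) = scale (f 0) (w 0) + lin 0 (\<lambda>_. 0) f"
      unfolding w_Suc by (simp only: \<eta>(2)[OF 0 w_free[of 0]] lin_zero_columns) simp
    then show ?case by blast
  next
    case (Suc i)
    from Suc.IH[OF Suc_lessD[OF Suc.prems]]
    obtain y where y: "d i (w (Suc i)) = scale (f i) (w i) + lin i y f" by blast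
    define h where "h = lin (?n i) (\<eta> (Suc i) i)"
    define y' where "y' = (\<lambda>j. - h (if j = i then w i else y j))"
    have "lin (Suc i) y' f = - (lin i (\<lambda>j. h (y j)) f + scale (f i) (h (w i)))"
      by (simp add: lin_Suc y'_def scale_def lin_def fun_eq_iff sum_negf)
    also have "\<dots> = - h (d i (w (Suc i)))"
      unfolding y h_def lin_add lin_scale lin_lin by (simp add: add.commute)
    finally have "d (Suc i) (w (Suc (Suc i))) = scale (f (Suc i)) (w (Suc i)) + lin (Suc i) y' f"
      using \<eta>(3)[OF Suc.prems w_free[of "Suc i"]] Suc.prems unfolding w_Suc[of "Suc i"] h_def by simp
    then show ?case by blast
  qed
  have "coeff (pair i (w i)) 0 = 1" if "i \<le> R" for i
    using that
  proof (induction i)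
    case 0
    have "0 \<notin> supp ((lin (?n 0) r w0 - embed 1) 0)"
    proof
      assume "0 \<in> supp ((lin (?n 0) r w0 - embed 1) 0)"
      from J_supp[OF w0(2) this] obtain j b where "j < R" "0 = a j + b" by auto
      then show False using a_nonzero[of j] monom_add_eq_0_iff[of "a j" b] by simp
    qed
    then show ?case by (simp add: in_keys_iff lookup_minus pair_def w_0)
  next
    case (Suc i)
    have i: "i < R" using Suc.prems by simp
    obtain y where y: "d i (w (Suc i)) = scale (f i) (w i) + lin i y f" using boundary[OF i] by blast
    define g where "g = pair i (d i (w (Suc i))) - f i * pair (Suc i) (w (Suc i))"
    have g: "g \<in> tail_ideal (Suc i)"
      unfolding g_def using i by (intro pair_step pair_syz) auto
    have "coeff (pair i (d i (w (Suc i)))) (a i) = coeff (f i * pair i (w i)) (a i + 0) + (\<Sum>l<i. coeff (f l * pair i (y l)) (a i))"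
      unfolding y by (simp add: pair_add pair_scale pair_lin lookup_add lookup_sum)
    also have "(\<Sum>l<i. coeff (f l * pair i (y l)) (a i)) = 0"
    proof (intro sum.neutral ballI)
      fix l assume "l \<in> {..<i}"
      then have "a i \<notin> supp (f l * pair i (y l))"
        using not_dvd[of i l] i by (auto simp: supp_monom_mult)
      then show "coeff (f l * pair i (y l)) (a i) = 0" by (simp add: in_keys_iff)
    qed
    also have "coeff (f i * pair i (w i)) (a i + 0) = 1"
      unfolding coeff_monom_mult using Suc by simp
    finally have "coeff (pair i (d i (w (Suc i)))) (a i) = 1" by simp
    moreover have "pair i (d i (w (Suc i))) = f i * pair (Suc i) (w (Suc i)) + g" by (simp add: g_def)
    ultimately have "1 = coeff (f i * pair (Suc i) (w (Suc i))) (a i + 0) + coeff g (a i)"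
      by (simp add: lookup_add)
    then show ?case unfolding coeff_monom_mult using tail_ideal_coeff[OF i g] by simp
  qed
  from this[of R] have nonzero: "(\<Sum>l<?n R. coeff (w R l) 0 * coeff (test R l 0) 0) \<noteq> 0"
    by (simp add: pair_def lin_def lookup_sum constant_term_mult)
  obtain l where l: "l < ?n R" "coeff (test R l 0) 0 \<noteq> 0"
    using sum.not_neutral_contains_not_neutral[OF nonzero] by auto
  have "test R l 0 \<in> homogeneous_part V (ds R ! l - (\<Sum>j<R. int (monom_degree (a j))))"
    using test_columns[of R] l(1) by (simp add: columns_def free_grade_iff)
  from homogeneous_constant_term[OF this l(2)] show ?thesis using l(1) by (auto simp: in_set_conv_nth)
qed

end


section \<open>The triangular ouroboros snake\<close>

lemma monom_degree_single [simp]: "monom_degree (Poly_Mapping.single v e) = e"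
  by (simp add: monom_degree_def)

lemma vec_ideal_edge_ideal:
  assumes "finite_simple_graph G"
  shows "vec_ideal (fst G) (edge_ideal G :: ('v, 'k::field) mpoly set) = sqfree_ideal (fst G) (edge_cond (snd G) {})"
  unfolding vec_ideal_def using sqfree_ideal_edge_ideal[OF assms] by (auto simp: set_eq_iff)

text \<open>The edges from \<open>X i\<close> to \<open>Y i 1\<close> with \<open>i\<close> odd and \<open>i < n\<close> form an induced matching, because cyclic
  neighbours of odd \<open>i < n\<close> are even or equal to \<open>n\<close>. On its vertices the edge ideal is generated by
  \<open>n div 2\<close> coprime monomials of degree 2.\<close>

lemma ouroboros_induced_matching:
  fixes ds c r
  assumes n: "n \<ge> 3" and p: "p \<ge> 1"
    and res: "matrix_resolution (fst (ouroboros n p))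
      (sqfree_ideal (fst (ouroboros n p)) (edge_cond (snd (ouroboros n p)) {}) :: (snake_vertex, 'k::field) vec set) ds c r"
  shows "2 * int (n div 2) \<in> set (ds (n div 2))"
proof -
  let ?V = "fst (ouroboros n p)" and ?E = "snd (ouroboros n p)"
  define R where "R = n div 2"
  define W where "W = {X (2 * j + 1) | j. j < R} \<union> {Y (2 * j + 1) 1 | j. j < R}"
  define a where "a = (\<lambda>j. Poly_Mapping.single (X (2 * j + 1)) (1::nat) + Poly_Mapping.single (Y (2 * j + 1) 1) 1)"
  have supp_a: "supp (a j) = {X (2 * j + 1), Y (2 * j + 1) 1}" for j
    by (simp add: a_def supp_monom_add insert_commute)
  have bound: "2 * j + 1 < n" if "j < R" for j using that by (simp add: R_def)
  have edge: "{X (2 * j + 1), Y (2 * j + 1) 1} \<in> ?E" if "j < R" for j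
  proof -
    have "2 * j + 1 \<in> {1..n}" "1 \<in> {1..p}" using bound[OF that] p by auto
    then show ?thesis unfolding ouroboros_def snd_conv by blast
  qed
  have induced: "\<exists>j<R. e = {X (2 * j + 1), Y (2 * j + 1) 1}" if e: "e \<in> ?E" "e \<subseteq> W" for e
    using e(1)
  proof (cases rule: edge_ouroborosE)
    case (1 i)
    then obtain j k where jk: "j < R" "i = 2 * j + 1" "k < R" "cyc_succ n i = 2 * k + 1"
      using e(2) by (auto simp: W_def)
    then have "2 * j + 2 = 2 * k + 1" using bound[of j] by (simp add: cyc_succ_def)
    then show ?thesis by presburger
  next
    case (2 i j)
    then obtain k where "k < R" "i = 2 * k + 1" "j = 1" using e(2) by (auto simp: W_def)
    then show ?thesis using 2(3) by blast
  next
    case (3 i j)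
    then obtain l k where jk: "l < R" "i = 2 * l + 1" "k < R" "cyc_succ n i = 2 * k + 1"
      using e(2) by (auto simp: W_def)
    then have "2 * l + 2 = 2 * k + 1" using bound[of l] by (simp add: cyc_succ_def)
    then show ?thesis by presburger
  qed
  interpret coprime_monomials ?V "sqfree_ideal ?V (edge_cond ?E {}) :: (snake_vertex, 'k) vec set" ds c r a R W
  proof
    have "{X (2 * j + 1), Y (2 * j + 1) 1} \<subseteq> ?V" if "j < R" for j
      using edge[OF that] finite_simple_graph_ouroboros[OF n, of p] by (auto simp only: finite_simple_graph_def)
    then show "W \<subseteq> ?V" unfolding W_def by blast
    show "supp (a i) \<inter> supp (a j) = {}" if "i \<noteq> j" for i j using that by (auto simp: supp_a)
    fix j assume j: "j < R"
    show "a j \<noteq> 0" using supp_a[of j] by (metis insert_not_empty keys_zero)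
    show "supp (a j) \<subseteq> W" using j by (auto simp: supp_a W_def)
    have aV: "supp (a j) \<subseteq> ?V"
      unfolding supp_a using edge[OF j] finite_simple_graph_ouroboros[OF n, of p]
      by (auto simp only: finite_simple_graph_def)
    fix y :: "(snake_vertex, 'k) vec" assume y: "y \<in> free ?V [0]"
    have "edge_cond ?E {} (supp m)" if "m \<in> supp (Poly_Mapping.single (a j) 1 * y 0)" for m
    proof -
      obtain b where "m = a j + b" using \<open>m \<in> _\<close> by (auto simp: supp_monom_mult)
      then have "{X (2 * j + 1), Y (2 * j + 1) 1} \<subseteq> supp m" by (simp add: supp_monom_add supp_a)
      then show ?thesis unfolding edge_cond_def using edge[OF j] by blast
    qed
    then show "scale (Poly_Mapping.single (a j) 1) y \<in> sqfree_ideal ?V (edge_cond ?E {})"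
      using free_scale[OF polys_single[OF aV] y] by (auto simp: sqfree_ideal_iff) (simp add: scale_def)
  next
    fix x :: "(snake_vertex, 'k) vec" and m
    assume x: "x \<in> sqfree_ideal ?V (edge_cond ?E {})" "m \<in> supp (x 0)" and m: "supp m \<subseteq> W"
    then obtain e where e: "e \<in> ?E" "e \<subseteq> supp m" by (auto simp: sqfree_ideal_iff edge_cond_def)
    then obtain j where "j < R" "e = {X (2 * j + 1), Y (2 * j + 1) 1}" using induced[of e] m by blast
    then show "\<exists>j<R. \<exists>b. m = a j + b"
      using e(2) monom_dvd_pair[of "X (2 * j + 1)" "Y (2 * j + 1) 1" m] unfolding a_def by blast
  qed (rule res)
  have "(\<Sum>j<R. int (monom_degree (a j))) = 2 * int R"
    by (simp add: a_def monom_degree_add)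
  then show ?thesis using degree_of_complete_intersection unfolding R_def by simp
qed

theorem theorem4p3:
  fixes n p :: nat
  assumes "n \<ge> 3" and "p \<ge> 3"
  shows "regularity (fst (ouroboros n p))
           (quotient_module (fst (ouroboros n p))
              (edge_ideal (ouroboros n p) :: (snake_vertex, 'k::field) mpoly set))
         = \<lceil>(real n - 1) / 2\<rceil>"
proof -
  let ?G = "ouroboros n p"
  let ?V = "fst ?G" and ?E = "snd ?G"
  define I where "I = (edge_ideal ?G :: (snake_vertex, 'k) mpoly set)"
  define J where "J = (sqfree_ideal ?V (edge_cond ?E {}) :: (snake_vertex, 'k) vec set)"
  have G: "finite_simple_graph ?G" by (rule finite_simple_graph_ouroboros[OF assms(1)])
  have vec_I: "vec_ideal ?V I = J" unfolding I_def J_def by (rule vec_ideal_edge_ideal[OF G])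
  have I: "ideal I (poly_ring ?V)"
  proof -
    interpret cring "poly_ring ?V :: (snake_vertex, 'k) mpoly ring" by (rule cring_poly_ring)
    have "var u * var v \<in> polys ?V" if "{u, v} \<in> ?E" for u v
      using G that by (auto simp: finite_simple_graph_def intro!: polys_mult var_polys)
    then show ?thesis unfolding I_def edge_ideal_def by (intro genideal_ideal) auto
  qed
  have J: "graded_submodule ?V [0] J" unfolding J_def by (rule graded_submodule_sqfree_ideal[OF mono_edge_cond])
  have J_min: "minimal_submodule [0] J"
  proof -
    have "\<not> edge_cond ?E {} (supp 0)"
      using G by (force simp: edge_cond_def finite_simple_graph_def)
    then have "0 \<notin> supp (x 0)" if "x \<in> J" for x
      using that unfolding J_def sqfree_ideal_iff by blast
    then show ?thesis unfolding minimal_submodule_def by (simp add: in_keys_iff)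
  qed
  obtain L where L: "fin_res ?V L [0] J (int (n div 2) + 1)"
    using reg_le_ouroboros[OF assms(1), of "TYPE('k)" p] unfolding reg_le_def J_def by blast
  have irrelevant: "f \<in> irrelevant_ideal ?V \<longleftrightarrow> f \<in> polys ?V \<and> coeff f 0 = 0" for f :: "(snake_vertex, 'k) mpoly"
    by (rule irrelevant_ideal_iff)
  let ?min = "\<lambda>ds. \<exists>\<phi> \<epsilon>. minimal_graded_free_resolution ?V (quotient_module ?V I) ds \<phi> \<epsilon>"
  have "\<exists>ds. ?min ds"
  proof -
    obtain ds c r where res: "matrix_resolution ?V J ds c r"
      and min: "\<And>i. minimal_submodule (ds i) (syz ?V J ds c r i)"
      using minimal_resolution_exists[OF J J_min L] by blast
    have "lin (length (ds (Suc i))) (c i) x k \<in> irrelevant_ideal ?V"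
      if "x \<in> free ?V (ds (Suc i))" "k < length (ds i)" for i x k
    proof -
      have "lin (length (ds (Suc i))) (c i) x \<in> syz ?V J ds c r i"
        using matrix_resolutionD(4)[OF res, of i] that(1) by blast
      then show ?thesis
        using min[of i] that(2) free_polys[OF lin_free[OF matrix_resolutionD(2)[OF res] that(1)]]
        unfolding irrelevant minimal_submodule_def by blast
    qed
    then show ?thesis
      using matrices_resolution[OF I, unfolded vec_I, OF res]
      unfolding minimal_graded_free_resolution_def by blast
  qed
  then have "?min (SOME ds. ?min ds)" by (rule someI_ex)
  then obtain ds \<phi> \<epsilon> where ds: "ds = (SOME ds. ?min ds)"
    and F: "minimal_graded_free_resolution ?V (quotient_module ?V I) ds \<phi> \<epsilon>" by blast
  obtain c r where res: "matrix_resolution ?V J ds c r"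
    and \<phi>: "\<And>i x. x \<in> free ?V (ds (Suc i)) \<Longrightarrow> \<phi> i x = lin (length (ds (Suc i))) (c i) x"
    using F resolution_matrices[OF I, unfolded vec_I]
    unfolding minimal_graded_free_resolution_def by blast
  have min: "minimal_submodule (ds i) (syz ?V J ds c r i)" for i
    unfolding minimal_submodule_def
  proof (intro ballI allI impI)
    fix y k assume y: "y \<in> syz ?V J ds c r i" and k: "k < length (ds i)"
    then obtain x where x: "x \<in> free ?V (ds (Suc i))" "y = \<phi> i x"
      using matrix_resolutionD(4)[OF res, of i] \<phi> by force
    then have "y k \<in> irrelevant_ideal ?V"
      using F k unfolding minimal_graded_free_resolution_def by blast
    then show "coeff (y k) 0 = 0" unfolding irrelevant by blast
  qed
  define A where "A = {j - int i | i j. graded_betti ?V (quotient_module ?V I) i j \<noteq> 0}"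
  have A: "A = {j - int i | i j. j \<in> set (ds i)}"
    unfolding A_def graded_betti_def ds[symmetric] by (simp add: count_list_0_iff)
  have range: "0 \<le> x \<and> x \<le> int (n div 2)" if "x \<in> A" for x
  proof -
    obtain i j where x: "x = j - int i" "j \<in> set (ds i)" using \<open>x \<in> A\<close> unfolding A by blast
    then show ?thesis
      using minimal_resolution_lower[OF res J min x(2)] minimal_resolution_upper[OF res J min L _ x(2)] by simp
  qed
  have "int (n div 2) \<in> A"
  proof -
    have "2 * int (n div 2) \<in> set (ds (n div 2))"
      by (rule ouroboros_induced_matching[OF assms(1) _ res[unfolded J_def]]) (use assms(2) in simp)
    then show ?thesis unfolding A by (intro CollectI exI[of _ "n div 2"] exI[of _ "2 * int (n div 2)"]) simp
  qed
  moreover have "finite A"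
    by (rule finite_subset[of _ "{0..int (n div 2)}"]) (use range in auto)
  ultimately have "Max A = int (n div 2)"
    using range by (intro Max_eqI) auto
  moreover have "\<lceil>(real n - 1) / 2\<rceil> = int (n div 2)"
  proof (rule ceiling_unique)
    have "n = 2 * (n div 2) + n mod 2" "n mod 2 \<le> 1" by auto
    then have n: "real n = 2 * real (n div 2) + real (n mod 2)" "real (n mod 2) \<le> 1"
      by (metis of_nat_add of_nat_mult of_nat_numeral, simp)
    then show "(real n - 1) / 2 \<le> of_int (int (n div 2))" by simp
    show "of_int (int (n div 2)) - 1 < (real n - 1) / 2" using n by simp
  qed
  ultimately show ?thesis unfolding regularity_def A_def I_def by simp
qed

end
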